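(* Let $d\ge 2$, let $\Omega\subset\mathbb{R}^d$ be a compact $C^2$-domain with boundary $\Gamma:=\partial\Omega$, and let $\mu\ge\sqrt{\operatorname{diam}(\Omega)}+1$ be a given parameter. Let $0<p\le\infty$ and let $r,j,l$ be nonnegative integers. Then there is a constant $C>0$ such that for every positive integer $n$ and every $f\in\Pi_n^d$, $$\Bigl\|\varphi_{n,\Gamma}^{\,j}\,\mathcal{D}_{n,\mu}^{r,\,j+l}f\Bigr\|_{L^p(\Omega)}\le C\,n^{r+j+2l}\,\|f\|_{L^p(\Omega)}.$$ Here $C$ depends only on $\Omega$, $\mu$, $r,j,l$, and on $p$ as $p\to0$ (i.e. for every $p_0>0$ the constant $C$ can be chosen the same for all $p\in[p_0,\infty]$).
   Context: $\|\cdot\|$ is the Euclidean norm on $\mathbb{R}^d$, $B_r(\xi)=\{\eta\in\mathbb{R}^d:\|\eta-\xi\|<r\}$, $\mathbb{S}^{d-1}$ is the unit sphere of $\mathbb{R}^d$, $\operatorname{dist}(\xi,E)=\inf_{\eta\in E}\|\xi-\eta\|$, and $\operatorname{diam}(E)=\max_{\xi,\eta\in E}\|\xi-\eta\|$. A bounded set $\Omega\subset\mathbb{R}^d$ is called a $C^2$-domain if there exist a constant $\kappa_0>0$ and a finite cover of $\partial\Omega$ by open sets $U_1,\dots,U_J\subset\mathbb{R}^d$ such that (i) for each $1\le j\le J$ there is $\Phi_j\in C^2(\mathbb{R}^d)$ with $U_j\cap\partial\Omega=\{\xi\in U_j:\Phi_j(\xi)=0\}$ and $\nabla\Phi_j(\xi)\ne0$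 for all $\xi\in U_j\cap\partial\Omega$; (ii) for each $\xi\in\partial\Omega$, $B_{\kappa_0}(\xi-\kappa_0\mathbf{n}_\xi)\subset\Omega$ and $B_{\kappa_0}(\xi+\kappa_0\mathbf{n}_\xi)\subset\mathbb{R}^d\setminus\Omega$, where $\mathbf{n}_\xi$ is the unit outer normal vector to $\partial\Omega$ at $\xi$. $\Pi_n^d$ is the space of real algebraic polynomials in $d$ variables of total degree at most $n$. $L^p(\Omega)$ is taken with respect to Lebesgue measure, with $L^\infty(\Omega)=C(\Omega)$ with the uniform norm. For $\xi\in\mathbb{R}^d$, $\partial_\xi f=(\xi\cdot\nabla)f$ and $\partial_\xi^\ell=(\xi\cdot\nabla)^\ell$. For $\xi\in\Omega$, $\eta\in\Gamma$, $f\in C^\infty(\Omega)$, $n\in\{1,2,\dots\}$ and nonnegative integers $l_1,l_2$: $$\mathcal{D}_\eta^{l_1,l_2}f(\xi):=\max\bigl\{|\partial_{\tau}^{l_1}\partial_{\mathbf{n}_\eta}^{l_2}f(\xi)|:\ \tau\in\mathbb{S}^{d-1},\ \tau\cdot\mathbf{n}_\eta=0\bigr\},$$ $$\varphi_{n,\Gamma}(\xi):=\sqrt{\operatorname{dist}(\xi,\Gamma)}+n^{-1},$$ $$\mathcal{D}_{n,\mu}^{l_1,l_2}f(\xi):=\max\bigl\{\mathcal{D}_\eta^{l_1,l_2}f(\xi):\ \eta\in\Gamma,\ \|\eta-\xi\|\le\mu\,\varphi_{n,\Gamma}(\xi)\bigr\}.$$ *)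

theory Defs
  imports "HOL-Analysis.Analysis"
begin

definition grad :: "('a::real_inner \<Rightarrow> real) \<Rightarrow> 'a \<Rightarrow> 'a" where
  "grad f x = (THE D. GDERIV f x :> D)"

definition dir_deriv :: "'a::real_inner \<Rightarrow> ('a \<Rightarrow> real) \<Rightarrow> 'a \<Rightarrow> real" where
  "dir_deriv v f = (\<lambda>x. v \<bullet> grad f x)"

definition C2 :: "('a::euclidean_space \<Rightarrow> real) \<Rightarrow> bool" where
  "C2 F \<longleftrightarrow> (\<exists>H :: 'a \<Rightarrow> 'a \<Rightarrow>\<^sub>L 'a.
      (\<forall>x. GDERIV F x :> grad F x) \<and>
      (\<forall>x. (grad F has_derivative blinfun_apply (H x)) (at x)) \<and>
      continuous_on UNIV H)"

definition boundary_equation ::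
  "'a::euclidean_space set \<Rightarrow> 'a set \<Rightarrow> ('a \<Rightarrow> real) \<Rightarrow> bool" where
  "boundary_equation \<Omega> U F \<longleftrightarrow>
     C2 F \<and> U \<inter> frontier \<Omega> = {x \<in> U. F x = 0} \<and> (\<forall>x \<in> U \<inter> frontier \<Omega>. grad F x \<noteq> 0)"

text \<open>The unit outer normal is the unit vector along the gradient of a local boundary equation
  whose sign is fixed by pointing from \<open>\<Omega>\<close> to its complement. It does not depend on the
  boundary equation: see \<open>unit_outer_normal_unique\<close> below.\<close>

definition is_unit_outer_normal :: "'a::euclidean_space set \<Rightarrow> 'a \<Rightarrow> 'a \<Rightarrow> bool" where
  "is_unit_outer_normal \<Omega> x v \<longleftrightarrow>
     norm v = 1 \<and>
     (\<exists>U F. open U \<and> x \<in> U \<and> boundary_equation \<Omega> U F \<and> (\<exists>c. v = c *\<^sub>R grad F x)) \<and>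
     (\<forall>\<^sub>F t in at_right 0. x + t *\<^sub>R v \<notin> \<Omega> \<and> x - t *\<^sub>R v \<in> \<Omega>)"

definition unit_outer_normal :: "'a::euclidean_space set \<Rightarrow> 'a \<Rightarrow> 'a" where
  "unit_outer_normal \<Omega> x = (THE v. is_unit_outer_normal \<Omega> x v)"

definition C2_domain :: "'a::euclidean_space set \<Rightarrow> bool" where
  "C2_domain \<Omega> \<longleftrightarrow> bounded \<Omega> \<and>
     (\<exists>\<kappa>>0. \<exists>\<U>. finite \<U> \<and> (\<forall>U\<in>\<U>. open U) \<and> frontier \<Omega> \<subseteq> \<Union>\<U> \<and>
        (\<forall>U\<in>\<U>. \<exists>F. boundary_equation \<Omega> U F) \<and>
        (\<forall>x\<in>frontier \<Omega>. \<exists>v. is_unit_outer_normal \<Omega> x v \<and>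
            ball (x - \<kappa> *\<^sub>R v) \<kappa> \<subseteq> \<Omega> \<and> ball (x + \<kappa> *\<^sub>R v) \<kappa> \<subseteq> - \<Omega>))"

definition poly_space :: "nat \<Rightarrow> (real^'d \<Rightarrow> real) set" where
  "poly_space n = {f. \<exists>c. f = (\<lambda>x. \<Sum>\<alpha> | (\<Sum>i\<in>UNIV. \<alpha> i) \<le> n. c \<alpha> * (\<Prod>i\<in>UNIV. (x $ i) ^ \<alpha> i))}"

text \<open>\<open>normal_tangential_deriv \<Omega> l1 l2 f \<eta> x\<close> is $\mathcal{D}_\eta^{l_1,l_2} f(x)$ and
  \<open>boundary_deriv_max \<Omega> \<mu> n l1 l2 f x\<close> is $\mathcal{D}_{n,\mu}^{l_1,l_2} f(x)$. The suprema are
  attained in the situations considered: the index sets are compact, nonempty for dimension at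
  least 2 and for \<open>x \<in> \<Omega>\<close>, \<open>\<mu> \<ge> sqrt (diameter \<Omega>) + 1\<close> respectively, and the functions
  maximised are continuous.\<close>

definition normal_tangential_deriv ::
  "'a::euclidean_space set \<Rightarrow> nat \<Rightarrow> nat \<Rightarrow> ('a \<Rightarrow> real) \<Rightarrow> 'a \<Rightarrow> 'a \<Rightarrow> real" where
  "normal_tangential_deriv \<Omega> l1 l2 f \<eta> x =
     (SUP \<tau>\<in>{\<tau>. norm \<tau> = 1 \<and> \<tau> \<bullet> unit_outer_normal \<Omega> \<eta> = 0}.
        \<bar>(dir_deriv \<tau> ^^ l1) ((dir_deriv (unit_outer_normal \<Omega> \<eta>) ^^ l2) f) x\<bar>)"

definition bdry_weight :: "'a::euclidean_space set \<Rightarrow> nat \<Rightarrow> 'a \<Rightarrow> real" where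
  "bdry_weight \<Gamma> n x = sqrt (infdist x \<Gamma>) + 1 / real n"

definition boundary_deriv_max ::
  "'a::euclidean_space set \<Rightarrow> real \<Rightarrow> nat \<Rightarrow> nat \<Rightarrow> nat \<Rightarrow> ('a \<Rightarrow> real) \<Rightarrow> 'a \<Rightarrow> real" where
  "boundary_deriv_max \<Omega> \<mu> n l1 l2 f x =
     (SUP \<eta>\<in>{\<eta> \<in> frontier \<Omega>. norm (\<eta> - x) \<le> \<mu> * bdry_weight (frontier \<Omega>) n x}.
        normal_tangential_deriv \<Omega> l1 l2 f \<eta> x)"

text \<open>The (quasi-)norm takes values in \<^typ>\<open>ennreal\<close>, so that a function outside $L^p$ has
  norm \<open>\<infinity>\<close>. For \<open>p = \<infinity>\<close> it is the uniform norm, not an essential supremum.\<close>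

definition Lp_norm :: "ennreal \<Rightarrow> 'a::euclidean_space set \<Rightarrow> ('a \<Rightarrow> real) \<Rightarrow> ennreal" where
  "Lp_norm p \<Omega> g =
     (if p = \<infinity> then SUP x\<in>\<Omega>. ennreal \<bar>g x\<bar>
      else let I = (\<integral>\<^sup>+x\<in>\<Omega>. ennreal (\<bar>g x\<bar> powr enn2real p) \<partial>lebesgue)
           in if I = \<infinity> then \<infinity> else ennreal (enn2real I powr (1 / enn2real p)))"

lemma grad_eq:
  assumes "GDERIV f x :> D"
  shows "grad f x = D"
  unfolding grad_def
proof (rule the_equality)
  fix E assume "GDERIV f x :> E"
  then have "(\<lambda>h. h \<bullet> E) = (\<lambda>h. h \<bullet> D)"
    using assms unfolding gderiv_def by (rule has_derivative_unique)
  then have "(E - D) \<bullet> E = (E - D) \<bullet> D" by (rule fun_cong)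
  then have "(E - D) \<bullet> (E - D) = 0" by (simp add: inner_diff_right)
  then show "E = D" by simp
qed (rule assms)

lemma finite_multi_indices: "finite {\<alpha> :: 'd::finite \<Rightarrow> nat. (\<Sum>i\<in>UNIV. \<alpha> i) \<le> n}"
proof (rule finite_subset)
  show "{\<alpha> :: 'd \<Rightarrow> nat. (\<Sum>i\<in>UNIV. \<alpha> i) \<le> n} \<subseteq> Pi\<^sub>E UNIV (\<lambda>_. {..n})"
  proof (intro subsetI PiE_I)
    fix \<alpha> :: "'d \<Rightarrow> nat" and i :: 'd
    assume "\<alpha> \<in> {\<alpha>. sum \<alpha> UNIV \<le> n}"
    moreover have "\<alpha> i \<le> sum \<alpha> UNIV" by (rule member_le_sum) auto
    ultimately show "\<alpha> i \<in> {..n}" by simp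
  qed auto
  show "finite (Pi\<^sub>E (UNIV :: 'd set) (\<lambda>_. {..n}))" by (rule finite_PiE) auto
qed

lemma unit_outer_normal_unique:
  fixes \<Omega> :: "'a::euclidean_space set"
  assumes x: "x \<in> frontier \<Omega>"
    and v: "is_unit_outer_normal \<Omega> x v" and w: "is_unit_outer_normal \<Omega> x w"
  shows "v = w"
proof (rule ccontr)
  assume ne: "v \<noteq> w"
  have nv: "norm v = 1" and nw: "norm w = 1"
    using v w by (auto simp: is_unit_outer_normal_def)
  have vv: "v \<bullet> v = 1" "w \<bullet> w = 1"
    using nv nw by (auto simp: norm_eq_1)
  have nopp: "v \<noteq> - w"
  proof
    assume eq: "v = - w"
    have "\<forall>\<^sub>F t in at_right 0. x + t *\<^sub>R v \<notin> \<Omega> \<and> x - t *\<^sub>R v \<in> \<Omega>"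
      "\<forall>\<^sub>F t in at_right 0. x + t *\<^sub>R w \<notin> \<Omega> \<and> x - t *\<^sub>R w \<in> \<Omega>"
      using v w by (auto simp: is_unit_outer_normal_def)
    then have "\<forall>\<^sub>F t in at_right (0::real). False"
      by eventually_elim (use eq in auto)
    then show False by simp
  qed
  obtain U F c where U: "open U" "x \<in> U" "boundary_equation \<Omega> U F" "v = c *\<^sub>R grad F x"
    using v by (auto simp: is_unit_outer_normal_def)
  obtain V G b where V: "open V" "x \<in> V" "boundary_equation \<Omega> V G" "w = b *\<^sub>R grad G x"
    using w by (auto simp: is_unit_outer_normal_def)
  have c: "c \<noteq> 0" and b: "b \<noteq> 0" using nv nw U(4) V(4) by auto
  define s where "s = v \<bullet> w"
  define m where "m = 1 - \<bar>s\<bar>"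
  have m: "m > 0"
  proof -
    have "\<bar>s\<bar> \<le> 1" using Cauchy_Schwarz_ineq2[of v w] nv nw by (simp add: s_def)
    moreover have "s \<noteq> 1"
    proof
      assume "s = 1"
      then have "(v - w) \<bullet> (v - w) = 0" using vv
        by (simp add: s_def inner_diff_left inner_diff_right inner_commute)
      then show False using ne by simp
    qed
    moreover have "s \<noteq> -1"
    proof
      assume "s = -1"
      then have "(v + w) \<bullet> (v + w) = 0" using vv
        by (simp add: s_def inner_add_left inner_add_right inner_commute)
      then show False using nopp by (simp add: eq_neg_iff_add_eq_0)
    qed
    ultimately show ?thesis by (auto simp: m_def abs_if split: if_splits)
  qed
  have GF: "GDERIV F y :> grad F y" and GG: "GDERIV G y :> grad G y" for y
    using U(3) V(3) by (auto simp: boundary_equation_def C2_def)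
  have F0: "F x = 0" and G0: "G x = 0"
    using U(2,3) V(2,3) x unfolding boundary_equation_def by blast+
  have dF: "((\<lambda>y. c * F y) has_derivative (\<lambda>h. h \<bullet> v)) (at x)"
    using has_derivative_mult_right[OF GF[of x, unfolded gderiv_def], of c] U(4) by simp
  have dG: "((\<lambda>y. b * G y) has_derivative (\<lambda>h. h \<bullet> w)) (at x)"
    using has_derivative_mult_right[OF GG[of x, unfolded gderiv_def], of b] V(4) by simp
  define e where "e = m / 4"
  have e: "e > 0" using m by (simp add: e_def)
  obtain d1 where d1: "d1 > 0"
    "\<And>y. norm (y - x) < d1 \<Longrightarrow> \<bar>c * F y - (y - x) \<bullet> v\<bar> \<le> e * norm (y - x)"
    using dF[unfolded has_derivative_at_alt, THEN conjunct2, rule_format, OF e] F0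
    by (auto simp: algebra_simps)
  obtain d2 where d2: "d2 > 0"
    "\<And>y. norm (y - x) < d2 \<Longrightarrow> \<bar>b * G y - (y - x) \<bullet> w\<bar> \<le> e * norm (y - x)"
    using dG[unfolded has_derivative_at_alt, THEN conjunct2, rule_format, OF e] G0
    by (auto simp: algebra_simps)
  have "open (U \<inter> V)" "x \<in> U \<inter> V" using U V by auto
  then obtain d3 where d3: "d3 > 0" "ball x d3 \<subseteq> U \<inter> V"
    by (meson open_contains_ball)
  define t where "t = min d1 (min d2 d3) / 3"
  have t: "t > 0" "2 * t < d1" "2 * t < d2" "2 * t < d3"
    using d1 d2 d3 by (auto simp: t_def)
  define p where "p q = x + t *\<^sub>R (w + q *\<^sub>R v)" for q
  have np: "norm (p q - x) \<le> 2 * t" if "\<bar>q\<bar> \<le> 1" for q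
  proof -
    have "norm (w + q *\<^sub>R v) \<le> norm w + \<bar>q\<bar> * norm v"
      by (metis norm_scaleR norm_triangle_ineq)
    then have "norm (w + q *\<^sub>R v) \<le> 2" using nv nw that by simp
    then show ?thesis using t(1) by (simp add: p_def)
  qed
  have pv: "(p q - x) \<bullet> v = t * (s + q)" and pw: "(p q - x) \<bullet> w = t * (1 + q * s)" for q
    using vv by (simp_all add: p_def s_def inner_add_left inner_commute[of w v])
  have err: "e * norm (p q - x) \<le> t * m / 2" if "\<bar>q\<bar> \<le> 1" for q
    using mult_left_mono[OF np[OF that], of e] e by (simp add: e_def mult_ac)
  have tm: "t * m > 0" using t m by simp
  have "c * F (p 1) > 0"
  proof -
    have "\<bar>c * F (p 1) - t * (s + 1)\<bar> \<le> t * m / 2"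
      using d1(2)[of "p 1"] np[of 1] t err[of 1] pv[of 1] by auto
    moreover have "t * m \<le> t * (s + 1)" using t by (intro mult_left_mono) (auto simp: m_def)
    ultimately show ?thesis using tm by linarith
  qed
  moreover have "c * F (p (-1)) < 0"
  proof -
    have "\<bar>c * F (p (-1)) - t * (s + (-1))\<bar> \<le> t * m / 2"
      using d1(2)[of "p (-1)"] np[of "-1"] t err[of "-1"] pv[of "-1"] by auto
    moreover have "t * (s + (-1)) \<le> t * (- m)"
      using t by (intro mult_left_mono) (auto simp: m_def)
    ultimately show ?thesis using tm by (simp only: mult_minus_right)
  qed
  moreover have "continuous_on {-1..1} (\<lambda>q. c * F (p q))"
  proof -
    have "continuous_on UNIV F"
      using GF unfolding gderiv_def
      by (meson continuous_at_imp_continuous_on has_derivative_continuous)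
    moreover have "continuous_on {-1..1} p"
      unfolding p_def by (intro continuous_intros)
    ultimately have "continuous_on {-1..1} (\<lambda>q. F (p q))"
      by (rule continuous_on_compose2) simp
    then show ?thesis by (rule continuous_on_mult_left)
  qed
  ultimately obtain q where q: "-1 \<le> q" "q \<le> 1" "c * F (p q) = 0"
    using IVT'[of "\<lambda>q. c * F (p q)" "-1" 0 1] by auto
  then have q1: "\<bar>q\<bar> \<le> 1" by auto
  have "p q \<in> U \<inter> V"
    using d3(2) np[OF q1] t(4) by (auto simp: subset_iff dist_norm norm_minus_commute)
  moreover have "F (p q) = 0" using q(3) c by simp
  ultimately have "G (p q) = 0"
    using U(3) V(3) unfolding boundary_equation_def by blast
  then have "\<bar>t * (1 + q * s)\<bar> \<le> t * m / 2"
    using d2(2)[of "p q"] np[OF q1] t err[OF q1] pw[of q] by auto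
  moreover have "t * m \<le> t * (1 + q * s)"
  proof -
    have "\<bar>q * s\<bar> \<le> 1 * \<bar>s\<bar>" unfolding abs_mult using q1 by (intro mult_right_mono) auto
    then show ?thesis using t by (intro mult_left_mono) (auto simp: m_def)
  qed
  ultimately show False using tm by linarith
qed

end

theory Submission
  imports Defs "HOL-Complex_Analysis.Complex_Analysis"
begin

text \<open>The two balls touching the boundary at each point make the normals Lipschitz.

  Let \<open>\<phi> = sqrt \<delta> + 1 / n\<close>, where \<open>\<delta>\<close> is the distance to the boundary, and let \<open>f\<close> be a polynomial of degree
  \<open>O(n)\<close> with \<open>\<bar>f\<bar> \<le> M\<close> on \<open>\<Omega>\<close>. Inside the inner ball at the boundary point \<open>b\<close> below \<open>x\<close>, with normal \<open>v\<close>, the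
  surface \<open>b + s \<tau> + w \<nu> - (t\<^sup>2 + a (s\<^sup>2 + w\<^sup>2)) v\<close> with tangential \<open>\<tau>\<close>, \<open>\<nu>\<close> stays in \<open>\<Omega>\<close> for real \<open>s\<close>, \<open>w\<close>, \<open>t\<close> in fixed
  intervals. Along it \<open>f\<close> is a polynomial in each parameter, so the Bernstein--Walsh growth estimate, applied
  to one parameter after the other, gives \<open>\<bar>f\<bar> \<le> C M\<close> for complex parameters of imaginary part
  \<open>O(1 / n)\<close>, which cover a complex polydisc around \<open>x\<close> of size \<open>1 / n\<close> in the tangential and \<open>\<phi> / n\<close> in
  the normal direction, and Cauchy's estimate yields the case \<open>p = \<infinity>\<close>; boundary points \<open>\<eta>\<close> within
  distance \<open>O(\<phi>)\<close> of \<open>x\<close> have normals within \<open>O(\<phi>)\<close> of \<open>v\<close>, which the polydisc tolerates.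

  For finite \<open>p\<close>, multiply \<open>f\<close> by a polynomial peaked at \<open>x\<close> that decays rapidly in the distance
  \<open>n \<rho>(x, y)\<close>, where \<open>\<rho>(x, y) = norm (x - y) + \<bar>sqrt (\<delta> x) - sqrt (\<delta> y)\<bar>\<close>. The maximum of the product controls
  the derivatives of \<open>f\<close> at \<open>x\<close>, and by the polydisc estimate the product is comparable to its maximum
  on a box of volume \<open>\<phi> / n\<^sup>d\<close>. This bounds the \<open>p\<close>-th power of the derivative at \<open>x\<close> by an integral of
  \<open>\<bar>f\<bar> powr p\<close> against a kernel whose integral in \<open>x\<close> is bounded, and Tonelli's theorem concludes.\<close>

section \<open>Complexified polynomials\<close>

text \<open>The parameter \<open>t\<close> enters the surface squared because a shift of
  \<open>t\<close> by \<open>1 / n\<close> near \<open>sqrt \<delta>\<close> moves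
  \<open>t^2\<close> by about \<open>\<phi> / n\<close>: the square unfolds the singularity at the
  boundary, and one growth estimate serves at every depth. A direction with normal component
  \<open>O(\<phi>)\<close>, followed for \<open>1 / n\<close>, drifts only \<open>\<phi> / n\<close>
  in the normal direction; hence tilted tangents are tolerated.

  \<open>\<delta>\<close> is not a polynomial, so the peaks are built from a quadratic,
  \<open>depth\<close>, whose square root differs from \<open>sqrt \<delta>\<close> by at most a
  multiple of the distance; that distance is already part of \<open>\<rho>\<close>.

  The maximum of the product is compared with an integral of \<open>\<bar>f\<bar> powr p\<close>
  over a box around the maximum point, wherever that point lies. This uses no convexity and so
  covers \<open>p < 1\<close>. The order of decay is at least \<open>4 * d / p0\<close>, which
  leaves a kernel of order \<open>4 * d\<close> for all \<open>p \<ge> p0\<close>: 4 for each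
  coordinate, because sublevel sets of \<open>n * \<rho>\<close> at level \<open>k\<close> have
  length growing like \<open>k^2\<close> and the sum of \<open>k^2 / k^4\<close> converges.\<close>

definition cvec :: "real^'d \<Rightarrow> complex^'d" where
  "cvec x = (\<chi> i. of_real (x $ i))"

lemma cvec_nth [simp]: "cvec x $ i = of_real (x $ i)"
  by (simp add: cvec_def)

text \<open>A relation rather than an operator: rule induction then carries a real polynomial and
  its complex extension along together. The index only bounds the degree from above, so degrees can
  be padded.\<close>

inductive complexifies :: "nat \<Rightarrow> (real^'d \<Rightarrow> real) \<Rightarrow> (complex^'d \<Rightarrow> complex) \<Rightarrow> bool" where
  const: "complexifies n (\<lambda>_. c) (\<lambda>_. of_real c)"
| add: "complexifies n f F \<Longrightarrow> complexifies n g G \<Longrightarrow> complexifies n (\<lambda>x. f x + g x) (\<lambda>z. F z + G z)"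
| coord: "complexifies n f F \<Longrightarrow> complexifies (Suc n) (\<lambda>x. x $ i * f x) (\<lambda>z. z $ i * F z)"

lemma complexifies_mono:
  assumes "complexifies n f F" "n \<le> m"
  shows "complexifies m f F"
  using assms
proof (induction arbitrary: m rule: complexifies.induct)
  case (coord n f F i)
  then obtain k where "m = Suc k" "n \<le> k" by (cases m) auto
  then show ?case using coord by (auto intro: complexifies.coord)
qed (auto intro: complexifies.intros)

lemma complexifies_cmult:
  assumes "complexifies n f F"
  shows "complexifies n (\<lambda>x. c * f x) (\<lambda>z. of_real c * F z)"
  using assms
proof (induction rule: complexifies.induct)
  case (const n c')
  show ?case using complexifies.const[of n "c * c'"] by simp
next
  case (add n f F g G)
  show ?case using complexifies.add[OF add.IH] by (simp add: algebra_simps)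
next
  case (coord n f F i)
  show ?case using complexifies.coord[OF coord.IH, of i] by (simp add: mult.left_commute)
qed

lemma complexifies_mult:
  assumes "complexifies n f F" "complexifies m g G"
  shows "complexifies (n + m) (\<lambda>x. f x * g x) (\<lambda>z. F z * G z)"
  using assms(1)
proof (induction rule: complexifies.induct)
  case (const n c)
  show ?case using complexifies_cmult[OF complexifies_mono[OF assms(2)]] by simp
next
  case (add n f1 F1 f2 F2)
  show ?case using complexifies.add[OF add.IH] by (simp add: algebra_simps)
next
  case (coord n f F i)
  show ?case using complexifies.coord[OF coord.IH, of i] by (simp add: mult.assoc)
qed

lemma complexifies_sum:
  assumes "\<And>a. a \<in> A \<Longrightarrow> complexifies n (f a) (F a)"
  shows "complexifies n (\<lambda>x. \<Sum>a\<in>A. f a x) (\<lambda>z. \<Sum>a\<in>A. F a z)"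
  using assms
proof (induction A rule: infinite_finite_induct)
  case (insert a A)
  then show ?case by (simp add: complexifies.add)
qed (use complexifies.const[of n 0] in auto)

lemma complexifies_power:
  assumes "complexifies n f F"
  shows "complexifies (k * n) (\<lambda>x. f x ^ k) (\<lambda>z. F z ^ k)"
proof (induction k)
  case 0
  show ?case using complexifies.const[of 0 1] by simp
next
  case (Suc k)
  show ?case using complexifies_mult[OF assms Suc.IH] by simp
qed

lemma complexifies_nth: "complexifies 1 (\<lambda>x. x $ i) (\<lambda>z. z $ i)"
  using complexifies.coord[OF complexifies.const[of 0 1], of i] by simp

lemma complexifies_prod:
  assumes "finite A" "\<And>a. a \<in> A \<Longrightarrow> complexifies (n a) (f a) (F a)"
  shows "complexifies (\<Sum>a\<in>A. n a) (\<lambda>x. \<Prod>a\<in>A. f a x) (\<lambda>z. \<Prod>a\<in>A. F a z)"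
  using assms
proof (induction A rule: finite_induct)
  case empty
  show ?case using complexifies.const[of 0 1] by simp
next
  case (insert a A)
  then show ?case by (simp add: complexifies_mult)
qed

lemma poly_space_complexifies:
  assumes "f \<in> poly_space n"
  obtains F where "complexifies n f F"
proof -
  obtain c where f: "f = (\<lambda>x. \<Sum>\<alpha> | (\<Sum>i\<in>UNIV. \<alpha> i) \<le> n. c \<alpha> * (\<Prod>i\<in>UNIV. (x $ i) ^ \<alpha> i))"
    using assms unfolding poly_space_def by blast
  have "complexifies n (\<lambda>x. c \<alpha> * (\<Prod>i\<in>UNIV. (x $ i) ^ \<alpha> i))
      (\<lambda>z. of_real (c \<alpha>) * (\<Prod>i\<in>UNIV. (z $ i) ^ \<alpha> i))"
    if "(\<Sum>i\<in>UNIV. \<alpha> i) \<le> n" for \<alpha> :: "'a \<Rightarrow> nat"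
  proof -
    have "complexifies (\<Sum>i\<in>UNIV. \<alpha> i * 1) (\<lambda>x::real^'a. \<Prod>i\<in>UNIV. (x $ i) ^ \<alpha> i)
        (\<lambda>z. \<Prod>i\<in>UNIV. (z $ i) ^ \<alpha> i)"
      by (intro complexifies_prod complexifies_power complexifies_nth) auto
    with that show ?thesis by (intro complexifies_cmult) (auto elim: complexifies_mono)
  qed
  then have "complexifies n f
      (\<lambda>z. \<Sum>\<alpha> | (\<Sum>i\<in>UNIV. \<alpha> i) \<le> n. of_real (c \<alpha>) * (\<Prod>i\<in>UNIV. (z $ i) ^ \<alpha> i))"
    unfolding f by (intro complexifies_sum) auto
  then show ?thesis by (rule that)
qed

lemma complexifies_cvec:
  assumes "complexifies n f F"
  shows "F (cvec x) = of_real (f x)"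
  using assms by (induction rule: complexifies.induct) auto

lemma complexifies_continuous:
  assumes "complexifies n f F"
  shows "continuous_on S f"
  using assms by (induction rule: complexifies.induct) (auto intro!: continuous_intros)

text \<open>Substituting a quadratic for every coordinate doubles the degree. Such arcs are what
  \<open>curved\<close> traces in each single parameter; \<open>c = 0\<close> gives the complex
  lines on which holomorphy is used.\<close>

lemma complexifies_quadratic_slice:
  assumes "complexifies n f F"
  shows "\<exists>Q. degree Q \<le> 2 * n \<and> (\<forall>s. poly Q s = F (\<chi> i. a $ i + s * b $ i + s^2 * c $ i))"
  using assms
proof (induction rule: complexifies.induct)
  case (const n c)
  show ?case by (intro exI[of _ "[:of_real c:]"]) auto
next
  case (add n f F g G)
  then obtain P Q where "degree P \<le> 2 * n" "degree Q \<le> 2 * n"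
    "\<forall>s. poly P s = F (\<chi> i. a $ i + s * b $ i + s^2 * c $ i)"
    "\<forall>s. poly Q s = G (\<chi> i. a $ i + s * b $ i + s^2 * c $ i)"
    by blast
  then show ?case by (intro exI[of _ "P + Q"]) (auto intro: degree_add_le)
next
  case (coord n f F k)
  then obtain P where P: "degree P \<le> 2 * n"
    "\<forall>s. poly P s = F (\<chi> i. a $ i + s * b $ i + s^2 * c $ i)"
    by blast
  have "degree ([:a $ k, b $ k, c $ k:] * P) \<le> degree [:a $ k, b $ k, c $ k:] + degree P"
    by (rule degree_mult_le)
  also have "\<dots> \<le> 2 * Suc n" using P(1) by simp
  finally show ?case using P(2)
    by (intro exI[of _ "[:a $ k, b $ k, c $ k:] * P"]) (auto simp: power2_eq_square algebra_simps)
qed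

lemma complexifies_holomorphic:
  assumes "complexifies n f F"
  shows "(\<lambda>s. F (\<chi> i. a $ i + s * b $ i)) holomorphic_on S"
proof -
  obtain Q where "\<And>s. poly Q s = F (\<chi> i. a $ i + s * b $ i + s^2 * (0::complex^'a) $ i)"
    using complexifies_quadratic_slice[OF assms, of a b 0] by blast
  then have "(\<lambda>s. F (\<chi> i. a $ i + s * b $ i)) = poly Q" by auto
  then show ?thesis by (auto intro: holomorphic_intros)
qed

section \<open>Directional derivatives of complexified polynomials\<close>

lemma GDERIV_nth: "GDERIV (\<lambda>x::real^'d. x $ i) x :> axis i 1"
  unfolding gderiv_def by (simp add: inner_axis bounded_linear_imp_has_derivative bounded_linear_vec_nth)

lemma complexifies_gderiv_ex:
  assumes "complexifies n f F"
  shows "\<exists>D. GDERIV f x :> D"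
  using assms
proof (induction rule: complexifies.induct)
  case (const n c)
  show ?case by (auto intro: GDERIV_const)
next
  case (add n f F g G)
  then show ?case by (auto intro: GDERIV_add)
next
  case (coord n f F i)
  obtain D where "GDERIV f x :> D" using coord.IH by blast
  from GDERIV_mult[OF GDERIV_nth this] show ?case by blast
qed

text \<open>The second component is again the complexification of the first one, which makes
  iterated directional derivatives accessible to Cauchy's estimate.\<close>

lemma complexifies_dir_deriv:
  assumes "complexifies n f F"
  shows "complexifies n (dir_deriv v f) (\<lambda>z. deriv (\<lambda>s. F (\<chi> i. z $ i + s * of_real (v $ i))) 0)"
  using assms
proof (induction rule: complexifies.induct)
  case (const n c)
  have "dir_deriv v (\<lambda>_::real^'a. c) = (\<lambda>_. 0)"
    unfolding dir_deriv_def by (subst grad_eq[OF GDERIV_const]) simp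
  then show ?case using complexifies.const[of n 0] by simp
next
  case (add n f F g G)
  have 1: "dir_deriv v (\<lambda>x. f x + g x) = (\<lambda>x. dir_deriv v f x + dir_deriv v g x)"
  proof
    fix x
    obtain D E where D: "GDERIV f x :> D" "GDERIV g x :> E"
      using complexifies_gderiv_ex add.hyps by blast
    show "dir_deriv v (\<lambda>x. f x + g x) x = dir_deriv v f x + dir_deriv v g x"
      using grad_eq[OF D(1)] grad_eq[OF D(2)] grad_eq[OF GDERIV_add[OF D]]
      by (simp add: dir_deriv_def inner_add_right)
  qed
  have hol: "(\<lambda>s. F (\<chi> i. z $ i + s * of_real (v $ i))) holomorphic_on UNIV"
      "(\<lambda>s. G (\<chi> i. z $ i + s * of_real (v $ i))) holomorphic_on UNIV" for z
    using complexifies_holomorphic[OF add.hyps(1), of z "cvec v"]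
      complexifies_holomorphic[OF add.hyps(2), of z "cvec v"] by simp_all
  have 2: "deriv (\<lambda>s. F (\<chi> i. z $ i + s * of_real (v $ i)) + G (\<chi> i. z $ i + s * of_real (v $ i))) 0
     = deriv (\<lambda>s. F (\<chi> i. z $ i + s * of_real (v $ i))) 0
       + deriv (\<lambda>s. G (\<chi> i. z $ i + s * of_real (v $ i))) 0" for z
    by (intro deriv_add holomorphic_on_imp_differentiable_at[OF hol(1)]
        holomorphic_on_imp_differentiable_at[OF hol(2)]) auto
  show ?case unfolding 1 2 using complexifies.add[OF add.IH] .
next
  case (coord n f F k)
  have 1: "dir_deriv v (\<lambda>x. x $ k * f x) = (\<lambda>x. v $ k * f x + x $ k * dir_deriv v f x)"
  proof
    fix x
    obtain D where D: "GDERIV f x :> D"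
      using complexifies_gderiv_ex coord.hyps by blast
    from grad_eq[OF GDERIV_mult[OF GDERIV_nth D]] grad_eq[OF D]
    show "dir_deriv v (\<lambda>x. x $ k * f x) x = v $ k * f x + x $ k * dir_deriv v f x"
      by (simp add: dir_deriv_def inner_add_right inner_axis)
  qed
  have hol: "(\<lambda>s. F (\<chi> i. z $ i + s * of_real (v $ i))) holomorphic_on UNIV" for z
    using complexifies_holomorphic[OF coord.hyps(1), of z "cvec v"] by simp
  have 2: "deriv (\<lambda>s. (\<chi> i. z $ i + s * of_real (v $ i)) $ k * F (\<chi> i. z $ i + s * of_real (v $ i))) 0
     = of_real (v $ k) * F z + z $ k * deriv (\<lambda>s. F (\<chi> i. z $ i + s * of_real (v $ i))) 0" for z
  proof -
    have "((\<lambda>s. F (\<chi> i. z $ i + s * of_real (v $ i))) has_field_derivative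
        deriv (\<lambda>s. F (\<chi> i. z $ i + s * of_real (v $ i))) 0) (at 0)"
      using holomorphic_derivI[OF hol] by auto
    then have "((\<lambda>s. (z $ k + s * of_real (v $ k)) * F (\<chi> i. z $ i + s * of_real (v $ i)))
        has_field_derivative of_real (v $ k) * F z
          + z $ k * deriv (\<lambda>s. F (\<chi> i. z $ i + s * of_real (v $ i))) 0) (at 0)"
      by (auto intro!: derivative_eq_intros simp: vec_nth_inverse)
    then show ?thesis by (simp add: DERIV_imp_deriv)
  qed
  show ?case unfolding 1 2
    using complexifies.add[OF complexifies_cmult[OF complexifies_mono[OF coord.hyps(1)]]
        complexifies.coord[OF coord.IH, of k], of "v $ k"] by simp
qed

lemma complexifies_dir_deriv_iterate:
  assumes "complexifies n f F"
  shows "\<exists>G. complexifies n ((dir_deriv v ^^ m) f) G \<and>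
    (\<forall>z. G z = (deriv ^^ m) (\<lambda>s. F (\<chi> i. z $ i + s * of_real (v $ i))) 0)"
proof -
  \<comment> \<open>The identity is proved along the whole line: knowing it at \<open>s = 0\<close>
    only would not allow another differentiation in \<open>s\<close>.\<close>
  have "\<exists>G. complexifies n ((dir_deriv v ^^ m) f) G \<and>
    (\<forall>z s. G (\<chi> i. z $ i + s * of_real (v $ i)) = (deriv ^^ m) (\<lambda>s. F (\<chi> i. z $ i + s * of_real (v $ i))) s)"
  proof (induction m)
    case 0
    then show ?case using assms by auto
  next
    case (Suc m)
    then obtain G where G: "complexifies n ((dir_deriv v ^^ m) f) G"
      "\<And>z s. G (\<chi> i. z $ i + s * of_real (v $ i)) = (deriv ^^ m) (\<lambda>s. F (\<chi> i. z $ i + s * of_real (v $ i))) s"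
      by blast
    let ?H = "\<lambda>z. deriv (\<lambda>s. G (\<chi> i. z $ i + s * of_real (v $ i))) 0"
    have "?H (\<chi> i. z $ i + s * of_real (v $ i)) = (deriv ^^ Suc m) (\<lambda>s. F (\<chi> i. z $ i + s * of_real (v $ i))) s"
      for z s
    proof -
      have "(deriv ^^ Suc m) (\<lambda>s. F (\<chi> i. z $ i + s * of_real (v $ i))) s
          = deriv (\<lambda>t. G (\<chi> i. z $ i + t * of_real (v $ i))) s"
        by (simp add: G(2))
      also have "\<dots> = deriv (\<lambda>t. G (\<chi> i. z $ i + (t + s) * of_real (v $ i))) 0"
        by (subst deriv_shift_0) (simp add: o_def add.commute)
      finally show ?thesis by (simp add: algebra_simps)
    qed
    with complexifies_dir_deriv[OF G(1), of v] show ?case by auto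
  qed
  then obtain G where G: "complexifies n ((dir_deriv v ^^ m) f) G"
      "\<And>z s. G (\<chi> i. z $ i + s * of_real (v $ i)) = (deriv ^^ m) (\<lambda>s. F (\<chi> i. z $ i + s * of_real (v $ i))) s"
      by blast
  have "G z = (deriv ^^ m) (\<lambda>s. F (\<chi> i. z $ i + s * of_real (v $ i))) 0" for z
    using G(2)[of z 0] by simp
  with G(1) show ?thesis by blast
qed

text \<open>Cauchy's inequality in one variable, applied twice: in \<open>w\<close> for each fixed
  \<open>s\<close>, which bounds the extension of the inner derivative on the disc of radius
  \<open>r1\<close>, and then in \<open>s\<close>.\<close>

lemma complexifies_Cauchy:
  assumes F: "complexifies n f F"
    and r: "r1 > 0" "r2 > 0"
    and B: "\<And>s w. norm s \<le> r1 \<Longrightarrow> norm w \<le> r2 \<Longrightarrow>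
        norm (F (\<chi> i. of_real (x $ i) + s * of_real (\<tau> $ i) + w * of_real (v $ i))) \<le> B"
  shows "\<bar>(dir_deriv \<tau> ^^ k) ((dir_deriv v ^^ m) f) x\<bar> \<le> fact k * (fact m * B / r2 ^ m) / r1 ^ k"
proof -
  obtain G where G: "complexifies n ((dir_deriv v ^^ m) f) G"
    "\<And>z. G z = (deriv ^^ m) (\<lambda>s. F (\<chi> i. z $ i + s * of_real (v $ i))) 0"
    using complexifies_dir_deriv_iterate[OF F] by metis
  obtain H where H: "complexifies n ((dir_deriv \<tau> ^^ k) ((dir_deriv v ^^ m) f)) H"
    "\<And>z. H z = (deriv ^^ k) (\<lambda>s. G (\<chi> i. z $ i + s * of_real (\<tau> $ i))) 0"
    using complexifies_dir_deriv_iterate[OF G(1)] by metis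
  have bG: "norm (G (\<chi> i. of_real (x $ i) + s * of_real (\<tau> $ i))) \<le> fact m * B / r2 ^ m"
    if s: "norm s \<le> r1" for s
  proof -
    have hol: "(\<lambda>w. F (\<chi> i. (\<chi> i. of_real (x $ i) + s * of_real (\<tau> $ i)) $ i + w * of_real (v $ i))) holomorphic_on S" for S
      using complexifies_holomorphic[OF F, of "(\<chi> i. of_real (x $ i) + s * of_real (\<tau> $ i))" "cvec v"] by simp
    show ?thesis unfolding G(2)
      by (rule Cauchy_inequality[OF hol holomorphic_on_imp_continuous_on[OF hol] r(2)])
         (use B[OF s] in \<open>auto simp: add.assoc\<close>)
  qed
  have hol: "(\<lambda>s. G (\<chi> i. cvec x $ i + s * of_real (\<tau> $ i))) holomorphic_on S" for S
    using complexifies_holomorphic[OF G(1), of "cvec x" "cvec \<tau>"] by simp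
  have "norm (H (cvec x)) \<le> fact k * (fact m * B / r2 ^ m) / r1 ^ k"
    unfolding H(2)
    by (rule Cauchy_inequality[OF hol holomorphic_on_imp_continuous_on[OF hol] r(1)])
       (use bG in \<open>auto\<close>)
  then show ?thesis by (simp add: complexifies_cvec[OF H(1)])
qed

section \<open>The Bernstein--Walsh estimate\<close>

text \<open>The substitution \<open>z = (w + 1 / w) / 2\<close> turns the growth estimate into the maximum principle
  on the unit disc, since \<open>w ^ N * poly Q ((w + 1 / w) / 2)\<close> is a polynomial in \<open>w\<close>.\<close>

lemma Bernstein_Walsh_disc:
  fixes Q :: "complex poly"
  assumes deg: "degree Q \<le> N" and M: "\<And>t. -1 \<le> t \<Longrightarrow> t \<le> 1 \<Longrightarrow> norm (poly Q (of_real t)) \<le> M"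
    and w: "w \<noteq> 0" "norm w \<le> 1"
  shows "norm (w ^ N * poly Q ((w + 1 / w) / 2)) \<le> M"
proof -
  \<comment> \<open>\<open>H\<close> is the product with its removable singularity at
    \<open>w = 0\<close> filled in. On the unit circle the argument of \<open>Q\<close> is
    \<open>Re z\<close>, so \<open>M\<close> applies there.\<close>
  define H where "H w = (\<Sum>k\<le>N. coeff Q k * ((w^2 + 1) / 2) ^ k * w ^ (N - k))" for w
  have H: "H w = w ^ N * poly Q ((w + 1 / w) / 2)" if "w \<noteq> 0" for w
  proof -
    have w1: "w * ((w + 1 / w) / 2) = (w^2 + 1) / 2"
      using that by (simp add: field_simps power2_eq_square)
    have "poly Q ((w + 1 / w) / 2) = (\<Sum>k\<le>N. coeff Q k * ((w + 1 / w) / 2) ^ k)"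
      unfolding poly_altdef using deg by (intro sum.mono_neutral_left) (auto simp: coeff_eq_0)
    then have "w ^ N * poly Q ((w + 1 / w) / 2) = (\<Sum>k\<le>N. w ^ N * (coeff Q k * ((w + 1 / w) / 2) ^ k))"
      by (simp add: sum_distrib_left)
    also have "\<dots> = H w" unfolding H_def
    proof (intro sum.cong refl)
      fix k assume "k \<in> {..N}"
      then have N: "w ^ N = w ^ k * w ^ (N - k)" by (simp flip: power_add)
      have "w ^ k * ((w + 1 / w) / 2) ^ k = ((w^2 + 1) / 2) ^ k"
        unfolding power_mult_distrib[symmetric] w1 ..
      then show "w ^ N * (coeff Q k * ((w + 1 / w) / 2) ^ k) = coeff Q k * ((w^2 + 1) / 2) ^ k * w ^ (N - k)"
        unfolding N by (simp add: mult_ac)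
    qed
    finally show ?thesis by simp
  qed
  have hol: "H holomorphic_on S" for S
    unfolding H_def by (auto intro!: holomorphic_intros)
  have "norm (H w) \<le> M"
  proof (rule maximum_modulus_frontier[of H "cball 0 1"])
    show "H holomorphic_on interior (cball 0 1)" by (rule hol)
    show "continuous_on (closure (cball 0 1)) H" by (rule holomorphic_on_imp_continuous_on[OF hol])
    fix z :: complex assume "z \<in> frontier (cball 0 1)"
    then have nz: "norm z = 1" by (simp add: frontier_cball)
    then have z0: "z \<noteq> 0" by auto
    have "1 / z = cnj z" using nz by (simp add: divide_conv_cnj)
    then have e: "(z + 1 / z) / 2 = of_real (Re z)" by (simp add: complex_eq_iff)
    have "\<bar>Re z\<bar> \<le> 1" using abs_Re_le_cmod[of z] nz by simp
    then show "norm (H z) \<le> M"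
      unfolding H[OF z0] e using M[of "Re z"] nz by (simp add: norm_mult norm_power)
  qed (use w in auto)
  with H[OF w(1)] show ?thesis by simp
qed

text \<open>With \<open>w = exp (\<i> * \<zeta>)\<close> the disc estimate is divided by
  \<open>norm w ^ N\<close>. This needs \<open>Im \<zeta> \<ge> 0\<close>; the other half plane
  follows because \<open>cos\<close> is even.\<close>

lemma Bernstein_Walsh_cos:
  fixes Q :: "complex poly"
  assumes deg: "degree Q \<le> N" and M: "\<And>t. -1 \<le> t \<Longrightarrow> t \<le> 1 \<Longrightarrow> norm (poly Q (of_real t)) \<le> M"
  shows "norm (poly Q (cos \<zeta>)) \<le> M * exp (real N * \<bar>Im \<zeta>\<bar>)"
proof -
  have *: "norm (poly Q (cos \<zeta>)) \<le> M * exp (real N * \<bar>Im \<zeta>\<bar>)" if "Im \<zeta> \<ge> 0" for \<zeta>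
  proof -
    define w where "w = exp (\<i> * \<zeta>)"
    have nw: "norm w = exp (- Im \<zeta>)" by (simp add: w_def)
    have cosw: "cos \<zeta> = (w + 1 / w) / 2"
      by (simp add: w_def cos_exp_eq exp_minus field_simps)
    have "norm w ^ N * norm (poly Q (cos \<zeta>)) \<le> M"
      using Bernstein_Walsh_disc[OF deg M, of w] that nw
      by (auto simp: cosw w_def norm_mult norm_power)
    moreover have "norm w ^ N = exp (- (real N * Im \<zeta>))"
      by (simp add: nw exp_of_nat_mult[symmetric])
    ultimately show ?thesis using that by (simp add: exp_minus field_simps)
  qed
  show ?thesis
  proof (cases "Im \<zeta> \<ge> 0")
    case False
    then show ?thesis using *[of "- \<zeta>"] by simp
  qed (rule *)
qed

lemma abs_le_abs_sinh: "\<bar>b\<bar> \<le> \<bar>sinh b\<bar>" for b :: real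
proof -
  have *: "b \<le> sinh b" if "b \<ge> 0" for b :: real
  proof -
    have "sinh 0 - 0 \<le> sinh b - b"
      by (rule DERIV_nonneg_imp_nondecreasing[OF that, of "\<lambda>b. sinh b - b"])
         (auto intro!: derivative_eq_intros exI simp: cosh_real_ge_1)
    then show ?thesis by simp
  qed
  show ?thesis using *[of b] *[of "- b"] by (cases "b \<ge> 0") auto
qed

text \<open>Write \<open>z / A = cos (a + \<i> * b)\<close>. Away from the endpoints
  \<open>\<bar>sin a\<bar> \<ge> 1 / 3\<close>, since \<open>1 - (11 / 12)^2 \<ge> 1 / 9\<close>, so
  \<open>Im (z / A) = - sin a * sinh b\<close> gives
  \<open>\<bar>b\<bar> \<le> 3 * \<bar>Im z\<bar> / A\<close>. The growth is thus exponential in the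
  imaginary part itself and not in its square root.\<close>

lemma Bernstein_Walsh_strip:
  fixes Q :: "complex poly"
  assumes deg: "degree Q \<le> N" and A: "A > 0"
    and M: "\<And>t. \<bar>t\<bar> \<le> A \<Longrightarrow> norm (poly Q (of_real t)) \<le> M"
    and z: "\<bar>Re z\<bar> \<le> 11 / 12 * A"
  shows "norm (poly Q z) \<le> M * exp (3 * real N * \<bar>Im z\<bar> / A)"
proof -
  define R where "R = pcompose Q [:0, of_real A:]"
  have R: "poly R u = poly Q (of_real A * u)" for u
    by (simp add: R_def poly_pcompose mult.commute)
  have degR: "degree R \<le> N"
    unfolding R_def using degree_pcompose_le[of Q "[:0, of_real A:]"] deg A by simp
  have MR: "norm (poly R (of_real t)) \<le> M" if "-1 \<le> t" "t \<le> 1" for t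
  proof -
    have "\<bar>A * t\<bar> \<le> A" using that A by (simp add: abs_mult)
    then show ?thesis using M[of "A * t"] by (simp add: R)
  qed
  have M0: "M \<ge> 0" using norm_ge_zero[of "poly Q (of_real 0)"] M[of 0] A by (simp del: norm_ge_zero)
  define u where "u = z / of_real A"
  define \<zeta> where "\<zeta> = Arccos u"
  have c: "cos \<zeta> = u" by (simp add: \<zeta>_def)
  define a b where "a = Re \<zeta>" and "b = Im \<zeta>"
  have x: "Re u = cos a * cosh b" and y: "Im u = - sin a * sinh b"
    unfolding c[symmetric] a_def b_def Re_cos Im_cos cosh_def sinh_def by (simp_all add: field_simps)
  have ux: "\<bar>Re u\<bar> \<le> 11 / 12" using z A by (simp add: u_def field_simps)
  have "\<bar>cos a\<bar> * 1 \<le> \<bar>cos a\<bar> * cosh b"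
    by (intro mult_left_mono) (auto simp: cosh_real_ge_1)
  also have "\<dots> = \<bar>Re u\<bar>" by (simp add: x abs_mult)
  finally have "\<bar>cos a\<bar> \<le> 11 / 12" using ux by simp
  then have "(cos a)^2 \<le> (11 / 12)^2" using abs_le_square_iff[of "cos a" "11 / 12"] by simp
  then have "(1 / 3)^2 \<le> (sin a)^2" using sin_cos_squared_add[of a] by (simp add: power2_eq_square)
  then have "1 / 3 \<le> \<bar>sin a\<bar>" using abs_le_square_iff[of "1 / 3 :: real" "sin a"] by simp
  then have "1 / 3 * \<bar>b\<bar> \<le> \<bar>sin a\<bar> * \<bar>sinh b\<bar>"
    using abs_le_abs_sinh[of b] by (intro mult_mono) auto
  then have b: "\<bar>b\<bar> \<le> 3 * \<bar>Im u\<bar>" by (simp add: y abs_mult)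
  have "norm (poly Q z) = norm (poly R (cos \<zeta>))" using A by (simp add: R c u_def)
  also have "\<dots> \<le> M * exp (real N * \<bar>Im \<zeta>\<bar>)" by (rule Bernstein_Walsh_cos[OF degR MR])
  also have "\<dots> \<le> M * exp (real N * (3 * \<bar>Im u\<bar>))"
    using b M0 by (intro mult_left_mono) (auto simp: b_def intro: mult_left_mono)
  finally show ?thesis using A by (simp add: u_def field_simps)
qed

section \<open>Domains with inner and outer tangent balls\<close>

text \<open>Otherwise the point dividing the segment between the centres in the ratio
  \<open>r : s\<close> would lie in both balls.\<close>

lemma ball_disjoint_dist:
  fixes a b :: "'a::real_normed_vector"
  assumes "ball a r \<inter> ball b s = {}" "r > 0" "s > 0"
  shows "r + s \<le> norm (a - b)"
proof (rule ccontr)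
  assume "\<not> ?thesis"
  then have lt: "norm (b - a) < r + s" by (simp add: norm_minus_commute)
  define m where "m = a + (r / (r + s)) *\<^sub>R (b - a)"
  have "norm (m - a) = r / (r + s) * norm (b - a)" using assms by (simp add: m_def)
  also have "\<dots> < r / (r + s) * (r + s)" using lt assms by (intro mult_strict_left_mono) auto
  finally have 1: "norm (m - a) < r" using assms by simp
  have "1 - r / (r + s) = s / (r + s)" using assms by (simp add: field_simps)
  moreover have "b - m = (1 - r / (r + s)) *\<^sub>R (b - a)"
    by (simp add: m_def algebra_simps)
  ultimately have "norm (b - m) = s / (r + s) * norm (b - a)" using assms by simp
  also have "\<dots> < s / (r + s) * (r + s)" using lt assms by (intro mult_strict_left_mono) auto
  finally have 2: "norm (b - m) < s" using assms by simp
  have "m \<in> ball a r \<inter> ball b s" using 1 2 by (simp add: dist_norm norm_minus_commute)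
  then show False using assms(1) by simp
qed

lemma abs_sqrt_diff_le:
  assumes "u \<ge> 0" "v \<ge> 0"
  shows "\<bar>sqrt u - sqrt v\<bar> \<le> sqrt \<bar>u - v\<bar>"
proof -
  have *: "sqrt u \<le> sqrt v + sqrt \<bar>u - v\<bar>" if "v \<ge> 0" for u v :: real
    using sqrt_add_le_add_sqrt[of v "\<bar>u - v\<bar>"] that real_sqrt_le_mono[of u "v + \<bar>u - v\<bar>"] by linarith
  show ?thesis using *[OF assms(1), of v] *[OF assms(2), of u] by (simp add: abs_minus_commute abs_le_iff)
qed

text \<open>\<open>nv\<close> is kept abstract and becomes \<open>unit_outer_normal\<close> in
  \<open>normal_domain\<close>. The regularity of the boundary enters through touching balls of one
  radius \<open>\<kappa>\<close> on both sides.\<close>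

locale ball_domain =
  fixes \<Omega> :: "'a::euclidean_space set" and \<kappa> :: real and nv :: "'a \<Rightarrow> 'a"
  assumes compact: "compact \<Omega>" and nonempty: "\<Omega> \<noteq> {}" and \<kappa>: "\<kappa> > 0"
    and norm_nv: "\<eta> \<in> frontier \<Omega> \<Longrightarrow> norm (nv \<eta>) = 1"
    and inner_ball: "\<eta> \<in> frontier \<Omega> \<Longrightarrow> ball (\<eta> - \<kappa> *\<^sub>R nv \<eta>) \<kappa> \<subseteq> \<Omega>"
    and outer_ball: "\<eta> \<in> frontier \<Omega> \<Longrightarrow> ball (\<eta> + \<kappa> *\<^sub>R nv \<eta>) \<kappa> \<subseteq> - \<Omega>"
begin

definition \<delta> :: "'a \<Rightarrow> real" where "\<delta> x = infdist x (frontier \<Omega>)"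

text \<open>Nearest boundary points need not be unique deep inside \<open>\<Omega>\<close>; any
  choice of a minimiser serves, and \<open>foot_eq\<close> still puts \<open>x\<close> on the normal
  line through it.\<close>

definition foot :: "'a \<Rightarrow> 'a" where "foot x = (SOME \<eta>. \<eta> \<in> frontier \<Omega> \<and> infdist x (frontier \<Omega>) = dist x \<eta>)"

definition nrm :: "'a \<Rightarrow> 'a" where "nrm x = nv (foot x)"

lemma frontier_nonempty: "frontier \<Omega> \<noteq> {}"
  using compact nonempty compact_imp_bounded frontier_eq_empty not_bounded_UNIV by blast

lemma foot: "foot x \<in> frontier \<Omega>" "\<delta> x = dist x (foot x)"
proof -
  have "\<exists>\<eta>. \<eta> \<in> frontier \<Omega> \<and> infdist x (frontier \<Omega>) = dist x \<eta>"
    using infdist_attains_inf[OF frontier_closed frontier_nonempty, of x] by auto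
  from someI_ex[OF this] show "foot x \<in> frontier \<Omega>" "\<delta> x = dist x (foot x)"
    by (auto simp: foot_def \<delta>_def)
qed

lemma \<delta>_nonneg [simp]: "\<delta> x \<ge> 0"
  by (simp add: \<delta>_def infdist_nonneg)

lemma \<delta>_le: "\<eta> \<in> frontier \<Omega> \<Longrightarrow> \<delta> x \<le> dist x \<eta>"
  unfolding \<delta>_def by (rule infdist_le)

lemma \<delta>_Lipschitz: "\<bar>\<delta> x - \<delta> y\<bar> \<le> norm (x - y)"
  using infdist_triangle[of x "frontier \<Omega>" y] infdist_triangle[of y "frontier \<Omega>" x]
  unfolding \<delta>_def dist_norm by (simp add: abs_le_iff norm_minus_commute)

lemma continuous_\<delta>: "continuous_on S \<delta>"
  unfolding \<delta>_def by (intro continuous_intros)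

lemma norm_nrm [simp]: "norm (nrm x) = 1"
  by (simp add: nrm_def norm_nv foot)

lemma nrm_nrm [simp]: "nrm x \<bullet> nrm x = 1"
  using norm_nrm[of x] by (simp only: norm_eq_1)

lemma closed_\<Omega>: "closed \<Omega>"
  using compact by (rule compact_imp_closed)

lemma frontier_subset: "frontier \<Omega> \<subseteq> \<Omega>"
  by (rule frontier_subset_closed[OF closed_\<Omega>])

text \<open>Balls are connected: one that meets \<open>\<Omega>\<close> and leaves it meets the
  frontier, and this one would do so closer to \<open>x\<close> than
  \<open>\<delta> x\<close>.\<close>

lemma in_\<Omega>_if_near:
  assumes "x \<in> \<Omega>" "dist x y < \<delta> x"
  shows "y \<in> \<Omega>"
proof (rule ccontr)
  assume "y \<notin> \<Omega>"
  have "ball x (\<delta> x) \<inter> frontier \<Omega> \<noteq> {}"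
  proof (rule connected_Int_frontier)
    have "x \<in> ball x (\<delta> x)" using assms(2) zero_le_dist[of x y] by (simp del: zero_le_dist)
    then show "ball x (\<delta> x) \<inter> \<Omega> \<noteq> {}" using assms by blast
    show "ball x (\<delta> x) - \<Omega> \<noteq> {}" using \<open>y \<notin> \<Omega>\<close> assms by auto
  qed auto
  then obtain \<eta> where "\<eta> \<in> ball x (\<delta> x)" "\<eta> \<in> frontier \<Omega>" by blast
  then show False using \<delta>_le[of \<eta> x] by simp
qed

text \<open>The open ball of radius \<open>\<delta> x\<close> around \<open>x\<close> stays in
  \<open>\<Omega>\<close> and so misses the outer ball at \<open>\<eta>\<close>. For
  \<open>\<delta> x = 0\<close> that ball is empty, and membership of \<open>x\<close> in
  \<open>\<Omega>\<close> takes over.\<close>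

lemma in_\<Omega>_not_outer: "x \<in> \<Omega> \<Longrightarrow> \<eta> \<in> frontier \<Omega> \<Longrightarrow> \<delta> x + \<kappa> \<le> norm (x - (\<eta> + \<kappa> *\<^sub>R nv \<eta>))"
proof (cases "\<delta> x = 0")
  case False
  assume x: "x \<in> \<Omega>" "\<eta> \<in> frontier \<Omega>"
  have "ball x (\<delta> x) \<inter> ball (\<eta> + \<kappa> *\<^sub>R nv \<eta>) \<kappa> = {}"
    using in_\<Omega>_if_near[OF x(1)] outer_ball[OF x(2)] by fastforce
  moreover have "\<delta> x > 0" using False \<delta>_nonneg[of x] by linarith
  ultimately show ?thesis using \<kappa> by (intro ball_disjoint_dist)
next
  case True
  assume x: "x \<in> \<Omega>" "\<eta> \<in> frontier \<Omega>"
  then have "x \<notin> ball (\<eta> + \<kappa> *\<^sub>R nv \<eta>) \<kappa>" using outer_ball by blast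
  then show ?thesis using True by (simp add: dist_norm norm_minus_commute)
qed

lemma inner_dist:
  assumes \<eta>: "\<eta> \<in> frontier \<Omega>"
  shows "\<kappa> - \<delta> y \<le> norm (y - (\<eta> - \<kappa> *\<^sub>R nv \<eta>))"
proof -
  let ?c = "\<eta> - \<kappa> *\<^sub>R nv \<eta>"
  have "ball ?c \<kappa> \<subseteq> interior \<Omega>" by (intro interior_maximal inner_ball \<eta> open_ball)
  then have "foot y \<notin> ball ?c \<kappa>" using foot(1)[of y] by (auto simp: frontier_def)
  then have "\<kappa> \<le> dist ?c (foot y)" by simp
  also have "\<dots> \<le> dist ?c y + dist y (foot y)" by (rule dist_triangle)
  finally show ?thesis using foot(2)[of y] by (simp add: dist_norm norm_minus_commute)
qed

text \<open>The centre of the outer ball at \<open>foot x\<close> has distance at least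
  \<open>\<delta> x + \<kappa>\<close> from \<open>x\<close>, the most that the triangle inequality
  through \<open>foot x\<close> permits. Equality forces \<open>x\<close> onto the normal line, on
  its inner side.\<close>

lemma foot_eq:
  assumes x: "x \<in> \<Omega>"
  shows "x = foot x - \<delta> x *\<^sub>R nrm x"
proof -
  define u where "u = x - foot x"
  have nu: "norm u = \<delta> x" by (simp add: u_def foot(2) dist_norm)
  have "\<delta> x + \<kappa> \<le> norm (u - \<kappa> *\<^sub>R nrm x)"
    using in_\<Omega>_not_outer[OF x foot(1)[of x]] by (simp add: u_def nrm_def algebra_simps)
  then have "(\<delta> x + \<kappa>)^2 \<le> (norm (u - \<kappa> *\<^sub>R nrm x))^2"
    using \<kappa> by (intro power_mono) auto
  also have "\<dots> = (norm u)^2 - 2 * \<kappa> * (u \<bullet> nrm x) + \<kappa>^2"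
    unfolding power2_norm_eq_inner
    by (simp add: inner_diff_left inner_diff_right inner_commute power2_eq_square)
  finally have "\<kappa> * (u \<bullet> nrm x) \<le> \<kappa> * (- \<delta> x)"
    unfolding nu by (simp add: power2_eq_square algebra_simps)
  then have un: "u \<bullet> nrm x \<le> - \<delta> x" using \<kappa> by (simp only: mult_le_cancel_left_pos)
  have "(norm (u + \<delta> x *\<^sub>R nrm x))^2 = (norm u)^2 + 2 * (\<delta> x * (u \<bullet> nrm x)) + (\<delta> x)^2"
    unfolding power2_norm_eq_inner
    by (simp add: inner_add_left inner_add_right inner_commute power2_eq_square)
  also have "\<delta> x * (u \<bullet> nrm x) \<le> \<delta> x * (- \<delta> x)"
    using un by (intro mult_left_mono) auto
  finally have "(norm (u + \<delta> x *\<^sub>R nrm x))^2 \<le> 0"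
    unfolding nu by (simp add: power2_eq_square)
  then have "u + \<delta> x *\<^sub>R nrm x = 0" by simp
  then show ?thesis by (simp add: u_def algebra_simps eq_neg_iff_add_eq_0)
qed

text \<open>An inner ball at one point and an outer ball at the other are disjoint; adding the two
  resulting inequalities is the parallelogram law.\<close>

lemma nv_Lipschitz:
  assumes "\<eta> \<in> frontier \<Omega>" "\<eta>' \<in> frontier \<Omega>"
  shows "norm (nv \<eta> - nv \<eta>') \<le> norm (\<eta> - \<eta>') / \<kappa>"
proof -
  define d s where "d = \<eta> - \<eta>'" and "s = nv \<eta> + nv \<eta>'"
  have *: "(2 * \<kappa>)^2 \<le> (norm (\<eta> - \<eta>' - \<kappa> *\<^sub>R (nv \<eta> + nv \<eta>')))^2"
    if "\<eta> \<in> frontier \<Omega>" "\<eta>' \<in> frontier \<Omega>" for \<eta> \<eta>'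
  proof (rule power_mono)
    have "ball (\<eta> - \<kappa> *\<^sub>R nv \<eta>) \<kappa> \<inter> ball (\<eta>' + \<kappa> *\<^sub>R nv \<eta>') \<kappa> = {}"
      using inner_ball[OF that(1)] outer_ball[OF that(2)] by blast
    from ball_disjoint_dist[OF this \<kappa> \<kappa>]
    show "2 * \<kappa> \<le> norm (\<eta> - \<eta>' - \<kappa> *\<^sub>R (nv \<eta> + nv \<eta>'))" by (simp add: algebra_simps)
  qed (use \<kappa> in auto)
  have 1: "(2 * \<kappa>)^2 \<le> (norm (d - \<kappa> *\<^sub>R s))^2"
    using *[OF assms] by (simp add: d_def s_def)
  have "- d - \<kappa> *\<^sub>R s = \<eta>' - \<eta> - \<kappa> *\<^sub>R (nv \<eta>' + nv \<eta>)" by (simp add: d_def s_def algebra_simps)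
  then have 2: "(2 * \<kappa>)^2 \<le> (norm (- d - \<kappa> *\<^sub>R s))^2" using *[OF assms(2,1)] by simp
  have "(norm (d - \<kappa> *\<^sub>R s))^2 + (norm (- d - \<kappa> *\<^sub>R s))^2 = 2 * (norm d)^2 + 2 * (\<kappa>^2 * (s \<bullet> s))"
    unfolding power2_norm_eq_inner
    by (simp add: inner_diff_left inner_diff_right inner_commute power2_eq_square)
  with 1 2 have 3: "4 * \<kappa>^2 \<le> (norm d)^2 + \<kappa>^2 * (s \<bullet> s)" by (simp add: power2_eq_square)
  have "nv \<eta> \<bullet> nv \<eta> = 1" "nv \<eta>' \<bullet> nv \<eta>' = 1"
    using norm_nv[OF assms(1)] norm_nv[OF assms(2)] by (simp_all only: norm_eq_1)
  then have 4: "(norm (nv \<eta> - nv \<eta>'))^2 = 4 - s \<bullet> s"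
    unfolding s_def power2_norm_eq_inner
    by (simp add: inner_diff_left inner_diff_right inner_add_left inner_add_right inner_commute)
  have "(\<kappa> * norm (nv \<eta> - nv \<eta>'))^2 \<le> (norm d)^2"
    unfolding power_mult_distrib 4 using 3 by (simp add: algebra_simps)
  then have "\<kappa> * norm (nv \<eta> - nv \<eta>') \<le> norm d" by (rule power2_le_imp_le) simp
  then show ?thesis using \<kappa> by (simp add: d_def field_simps)
qed

section \<open>Room inside the domain near a given point\<close>

definition \<delta>' :: "'a \<Rightarrow> real" where "\<delta>' x = min (\<delta> x) \<kappa>"

lemma \<delta>': "0 \<le> \<delta>' x" "\<delta>' x \<le> \<kappa>" "\<delta>' x \<le> \<delta> x"
  using \<kappa> by (auto simp: \<delta>'_def)

text \<open>With the depth truncated at \<open>\<kappa>\<close> one formula covers two balls: the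
  inner ball at \<open>foot x\<close> if \<open>\<delta> x \<le> \<kappa>\<close>, and the ball
  centred at \<open>x\<close> itself otherwise.\<close>

lemma cball_subset:
  assumes x: "x \<in> \<Omega>"
  shows "cball (x + \<delta>' x *\<^sub>R nrm x - \<kappa> *\<^sub>R nrm x) \<kappa> \<subseteq> \<Omega>"
proof -
  have "ball (x + \<delta>' x *\<^sub>R nrm x - \<kappa> *\<^sub>R nrm x) \<kappa> \<subseteq> \<Omega>"
  proof (cases "\<delta> x \<le> \<kappa>")
    case True
    then have "x + \<delta>' x *\<^sub>R nrm x = foot x" using foot_eq[OF x] by (simp add: \<delta>'_def algebra_simps)
    then show ?thesis using inner_ball[OF foot(1)[of x]] by (simp add: nrm_def)
  next
    case False
    then have "x + \<delta>' x *\<^sub>R nrm x - \<kappa> *\<^sub>R nrm x = x" by (simp add: \<delta>'_def)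
    then show ?thesis using in_\<Omega>_if_near[OF x] False by fastforce
  qed
  then show ?thesis using closure_minimal[OF _ closed_\<Omega>] \<kappa> by (metis closure_ball)
qed

text \<open>A point at tangential offset \<open>Z\<close> and depth \<open>t\<close> below the top
  of a ball of radius \<open>\<kappa>\<close> lies in the closed ball iff
  \<open>(norm Z)^2 \<le> (2 * \<kappa> - t) * t\<close>; for
  \<open>t \<le> 7 / 4 * \<kappa>\<close> the first factor is at least
  \<open>\<kappa> / 4\<close>.\<close>

lemma region_in_\<Omega>:
  assumes x: "x \<in> \<Omega>" and Z: "Z \<bullet> nrm x = 0" "(norm Z)^2 \<le> \<kappa> / 4 * t" and t: "0 \<le> t" "t \<le> 7 / 4 * \<kappa>"
  shows "x + \<delta>' x *\<^sub>R nrm x + Z - t *\<^sub>R nrm x \<in> \<Omega>"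
proof -
  have "(norm (Z + (\<kappa> - t) *\<^sub>R nrm x))^2 = (norm Z)^2 + (\<kappa> - t)^2"
    unfolding power2_norm_eq_inner using Z(1)
    by (simp add: inner_add_left inner_add_right inner_commute power2_eq_square)
  also have "\<dots> \<le> \<kappa>^2"
  proof -
    have "\<kappa> / 4 * t \<le> (2 * \<kappa> - t) * t" using t by (intro mult_right_mono) auto
    with Z(2) show ?thesis by (simp add: power2_eq_square algebra_simps)
  qed
  finally have "norm (Z + (\<kappa> - t) *\<^sub>R nrm x) \<le> \<kappa>" by (rule power2_le_imp_le) (use \<kappa> in auto)
  then have "x + \<delta>' x *\<^sub>R nrm x + Z - t *\<^sub>R nrm x \<in> cball (x + \<delta>' x *\<^sub>R nrm x - \<kappa> *\<^sub>R nrm x) \<kappa>"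
    by (simp add: dist_norm norm_minus_commute algebra_simps)
  then show ?thesis using cball_subset[OF x] by blast
qed

text \<open>The depth of \<open>y\<close> below the tangent plane at \<open>foot x\<close> is
  compared with \<open>\<delta> y\<close>: the inner ball at \<open>foot x\<close> bounds
  \<open>\<delta> y\<close> from below and the outer ball from above, each with the quadratic error
  of a sphere against its tangent plane.\<close>

lemma depth_near:
  assumes x: "x \<in> \<Omega>" and y: "y \<in> \<Omega>" and d: "\<delta> x < \<kappa> / 2" and h: "norm (x - y) < \<kappa> / 4"
  shows "\<bar>\<delta> y - (\<delta> x + (x - y) \<bullet> nrm x)\<bar> \<le> 2 / \<kappa> * (norm (x - y))^2"
proof -
  define n where "n = nrm x"
  define h where "h = norm (x - y)"
  define w where "w = \<delta> x + (x - y) \<bullet> n"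
  define q where "q = y - foot x"
  have n1: "n \<bullet> n = 1" by (simp add: n_def)
  have q: "q = (y - x) - \<delta> x *\<^sub>R n" using foot_eq[OF x] by (simp add: q_def n_def algebra_simps)
  have qn: "q \<bullet> n = - w" unfolding q w_def by (simp add: inner_diff_left n1)
  have "\<bar>(x - y) \<bullet> n\<bar> \<le> norm (x - y) * norm n" by (rule Cauchy_Schwarz_ineq2)
  then have xn: "\<bar>(x - y) \<bullet> n\<bar> \<le> h" by (simp add: h_def n_def)
  have w: "- \<kappa> / 4 < w" "w < 3 / 4 * \<kappa>"
    using xn d assms(4) \<delta>_nonneg[of x] \<kappa> unfolding w_def h_def by linarith+
  have "q \<bullet> q = h^2 - ((x - y) \<bullet> n)^2 + w^2"
    unfolding q w_def h_def power2_norm_eq_inner using n1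
    by (simp add: inner_diff_left inner_diff_right inner_commute power2_eq_square algebra_simps)
  then have qq: "q \<bullet> q \<le> h^2 + w^2" by simp
  define e where "e = 2 * h^2 / \<kappa>"
  have e: "e \<ge> 0" "\<kappa> * e = 2 * h^2" using \<kappa> by (simp_all add: e_def)
  \<comment> \<open>\<open>\<sigma> = 1\<close> belongs to the inner centre,
    \<open>\<sigma> = - 1\<close> to the outer one. The size of \<open>e\<close> is such that
    \<open>2 * (\<kappa> / 4) * e = h^2\<close>, so the cross term in
    \<open>(\<kappa> - \<sigma> * w + e)^2\<close> absorbs \<open>h^2\<close>.\<close>
  have near: "norm (q + (\<sigma> * \<kappa>) *\<^sub>R n) \<le> \<kappa> - \<sigma> * w + e" if \<sigma>: "\<sigma> = 1 \<or> \<sigma> = - 1" for \<sigma>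
  proof (rule power2_le_imp_le)
    have \<sigma>w: "1 / 4 * \<kappa> \<le> \<kappa> - \<sigma> * w" using \<sigma> w by auto
    have "(norm (q + (\<sigma> * \<kappa>) *\<^sub>R n))^2 = q \<bullet> q + 2 * \<sigma> * \<kappa> * (q \<bullet> n) + \<kappa>^2"
      unfolding power2_norm_eq_inner using n1 \<sigma>
      by (auto simp: inner_add_left inner_add_right inner_commute power2_eq_square)
    also have "\<dots> \<le> (\<kappa> - \<sigma> * w)^2 + h^2" using qq qn \<sigma> by (auto simp: power2_eq_square algebra_simps)
    also have "\<dots> \<le> (\<kappa> - \<sigma> * w)^2 + 2 * (\<kappa> - \<sigma> * w) * e + e^2"
    proof -
      have "h^2 = 2 * (1 / 4 * \<kappa>) * e" using e by simp
      also have "\<dots> \<le> 2 * (\<kappa> - \<sigma> * w) * e"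
        using \<sigma>w e \<kappa> by (intro mult_right_mono mult_left_mono) auto
      finally show ?thesis using zero_le_power2[of e] by linarith
    qed
    also have "\<dots> = (\<kappa> - \<sigma> * w + e)^2" by (simp only: power2_sum)
    finally show "(norm (q + (\<sigma> * \<kappa>) *\<^sub>R n))^2 \<le> (\<kappa> - \<sigma> * w + e)^2" .
  qed (use \<sigma> w e \<kappa> in auto)
  have "\<kappa> - \<delta> y \<le> norm (q + \<kappa> *\<^sub>R n)"
    using inner_dist[OF foot(1)[of x], of y] by (simp add: q_def n_def nrm_def algebra_simps)
  moreover have "\<delta> y + \<kappa> \<le> norm (q - \<kappa> *\<^sub>R n)"
    using in_\<Omega>_not_outer[OF y foot(1)[of x]] by (simp add: q_def n_def nrm_def algebra_simps)
  ultimately have "\<bar>\<delta> y - w\<bar> \<le> 2 * h^2 / \<kappa>" using near[of 1] near[of "- 1"] unfolding e_def by simp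
  then show ?thesis by (simp add: w_def h_def n_def)
qed

text \<open>Polynomial substitute for \<open>\<delta> y\<close>: the depth of \<open>y\<close> below
  the tangent plane at \<open>foot x\<close>, plus a multiple of the squared distance that, for
  suitable \<open>a\<close>, makes it nonnegative on \<open>\<Omega>\<close>.\<close>

definition depth :: "real \<Rightarrow> 'a \<Rightarrow> 'a \<Rightarrow> real" where
  "depth a x y = \<delta> x + (x - y) \<bullet> nrm x + a * (norm (y - x))^2"

definition depth_comparable :: "real \<Rightarrow> real \<Rightarrow> real \<Rightarrow> bool" where
  "depth_comparable a A C \<longleftrightarrow> a > 0 \<and> A > 0 \<and> C > 0 \<and> (\<forall>x\<in>\<Omega>. \<forall>y\<in>\<Omega>.
      0 \<le> depth a x y \<and> depth a x y \<le> A \<and> norm (y - x) ^ 2 \<le> A \<and> \<delta> x \<le> A \<and>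
      \<bar>sqrt (depth a x y) - sqrt (\<delta> y)\<bar> \<le> C * norm (y - x))"

lemma depth_comparableD:
  assumes "depth_comparable a A C"
  shows "a > 0" "A > 0" "C > 0"
    "x \<in> \<Omega> \<Longrightarrow> y \<in> \<Omega> \<Longrightarrow> 0 \<le> depth a x y \<and> depth a x y \<le> A \<and> norm (y - x) ^ 2 \<le> A \<and> \<delta> x \<le> A"
    "x \<in> \<Omega> \<Longrightarrow> y \<in> \<Omega> \<Longrightarrow> \<bar>sqrt (depth a x y) - sqrt (\<delta> y)\<bar> \<le> C * norm (y - x)"
  using assms unfolding depth_comparable_def by blast+

text \<open>Three regimes in \<open>h = norm (y - x)\<close>. Near the boundary the error is
  \<open>O(h^2)\<close>, and square roots turn it into \<open>O(h)\<close>; deep inside both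
  quantities stay above \<open>\<kappa> / 4\<close>, where the square root is Lipschitz; for
  \<open>h \<ge> \<kappa> / 4\<close> boundedness is enough.\<close>

lemma depth_comparison: obtains a A C where "depth_comparable a A C"
proof -
  obtain D where D: "D > 0" "\<And>x y. x \<in> \<Omega> \<Longrightarrow> y \<in> \<Omega> \<Longrightarrow> norm (y - x) \<le> D"
  proof -
    obtain B where B: "B > 0" "\<And>x. x \<in> \<Omega> \<Longrightarrow> norm x \<le> B"
      using compact_imp_bounded[OF compact] by (meson bounded_pos)
    show ?thesis
    proof (rule that[of "2 * B"])
      fix x y assume "x \<in> \<Omega>" "y \<in> \<Omega>"
      then show "norm (y - x) \<le> 2 * B" using B(2)[of x] B(2)[of y] norm_triangle_ineq4[of y x] by linarith
    qed (use B in auto)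
  qed
  \<comment> \<open>The first summand absorbs the error of \<open>depth_near\<close>; the second
    gives \<open>a * h^2 \<ge> D\<close> once \<open>h \<ge> \<kappa> / 4\<close>. The summands of
    \<open>C\<close> below belong to the near, the deep and the far regime, in this order.\<close>
  define a where "a = 2 / \<kappa> + 16 * D / \<kappa>^2"
  define A where "A = 2 * D + (a + 1) * D^2"
  define C where "C = sqrt (2 / \<kappa> + a) + (2 + a * \<kappa>) / sqrt (\<kappa> / 4) + 4 * sqrt A / \<kappa>"
  have a: "a > 0" using D \<kappa> by (simp add: a_def add_pos_pos)
  have A: "A > 0" unfolding A_def using D a by (simp add: add_pos_pos)
  have C: "C > 0" unfolding C_def using a \<kappa> A by (intro add_pos_pos divide_pos_pos) (auto simp: add_pos_pos)
  have \<delta>D: "\<delta> x \<le> D" if "x \<in> \<Omega>" for x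
    using D(2)[of "foot x" x] that foot[of x] frontier_subset by (auto simp: dist_norm)
  have ip: "\<bar>(x - y) \<bullet> nrm x\<bar> \<le> norm (y - x)" for x y
    using Cauchy_Schwarz_ineq2[of "x - y" "nrm x"] by (simp add: norm_minus_commute)
  have leA: "depth a x y \<le> A" "norm (y - x) ^ 2 \<le> A" "\<delta> x \<le> A" if "x \<in> \<Omega>" "y \<in> \<Omega>" for x y
  proof -
    have 1: "norm (y - x) ^ 2 \<le> D^2" using D(2)[OF that] by (intro power_mono) auto
    then have "a * norm (y - x) ^ 2 \<le> a * D^2" using a by simp
    moreover have "(a + 1) * D^2 = a * D^2 + D^2" "D^2 \<ge> 0" "a * D^2 \<ge> 0" using a by (auto simp: algebra_simps)
    ultimately show "depth a x y \<le> A" "norm (y - x) ^ 2 \<le> A" "\<delta> x \<le> A"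
      using 1 ip[of x y] D(2)[OF that] \<delta>D[OF that(1)] D(1) unfolding depth_def A_def by linarith+
  qed
  have main: "0 \<le> depth a x y \<and> \<bar>sqrt (depth a x y) - sqrt (\<delta> y)\<bar> \<le> C * norm (y - x)"
    if x: "x \<in> \<Omega>" and y: "y \<in> \<Omega>" for x y
  proof -
    define h where "h = norm (y - x)"
    define w where "w = \<delta> x + (x - y) \<bullet> nrm x"
    have W: "depth a x y = w + a * h^2" by (simp add: depth_def w_def h_def)
    have h0: "h \<ge> 0" by (simp add: h_def)
    have Cterms: "sqrt (2 / \<kappa> + a) \<ge> 0" "(2 + a * \<kappa>) / sqrt (\<kappa> / 4) \<ge> 0" "4 * sqrt A / \<kappa> \<ge> 0"
      using a \<kappa> A by auto
    consider (far) "h \<ge> \<kappa> / 4" | (deep) "h < \<kappa> / 4" "\<delta> x \<ge> \<kappa> / 2" | (near) "h < \<kappa> / 4" "\<delta> x < \<kappa> / 2"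
      by linarith
    then show ?thesis
    proof cases
      case far
      have "D \<le> 16 * D / \<kappa>^2 * (\<kappa> / 4)^2" using \<kappa> by (simp add: power2_eq_square)
      also have "\<dots> \<le> a * h^2"
        unfolding a_def using far \<kappa> D(1) by (intro mult_mono power_mono) auto
      finally have W0: "0 \<le> depth a x y"
        using ip[of x y] D(2)[OF x y] \<delta>_nonneg[of x] unfolding W w_def by linarith
      have "sqrt (depth a x y) \<le> sqrt A" "sqrt (\<delta> y) \<le> sqrt A"
        using leA[OF x y] leA[OF y x] by auto
      then have "\<bar>sqrt (depth a x y) - sqrt (\<delta> y)\<bar> \<le> sqrt A"
        using W0 real_sqrt_ge_zero[OF \<delta>_nonneg[of y]] real_sqrt_ge_zero[OF W0] by linarith
      also have "\<dots> = 4 * sqrt A / \<kappa> * (\<kappa> / 4)" using \<kappa> by simp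
      also have "\<dots> \<le> C * h" unfolding C_def using far Cterms \<kappa> by (intro mult_mono) auto
      finally show ?thesis using W0 by (simp add: h_def)
    next
      case deep
      have w: "w \<ge> \<kappa> / 4" using deep ip[of x y] unfolding w_def h_def by linarith
      have d: "\<delta> y \<ge> \<kappa> / 4" using deep \<delta>_Lipschitz[of y x] unfolding h_def by linarith
      have W1: "depth a x y \<ge> \<kappa> / 4" unfolding W using w a by (simp add: add_increasing2)
      have "h * h \<le> \<kappa> * h" using deep h0 \<kappa> by (intro mult_right_mono) auto
      then have "a * h^2 \<le> a * \<kappa> * h" using a by (simp add: power2_eq_square)
      then have diff: "\<bar>depth a x y - \<delta> y\<bar> \<le> (2 + a * \<kappa>) * h"
      proof -
        have "a * h^2 \<ge> 0" "(2 + a * \<kappa>) * h = h + h + a * \<kappa> * h" using a by (simp_all add: algebra_simps)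
        then show ?thesis using ip[of x y] \<delta>_Lipschitz[of y x] \<open>a * h^2 \<le> a * \<kappa> * h\<close>
          unfolding W w_def h_def by linarith
      qed
      have s: "sqrt (\<kappa> / 4) > 0" "sqrt (\<kappa> / 4) \<le> sqrt (depth a x y)" "sqrt (\<delta> y) \<ge> 0"
        using W1 d \<kappa> by (auto simp del: real_sqrt_divide)
      have "\<bar>sqrt (depth a x y) - sqrt (\<delta> y)\<bar> * sqrt (\<kappa> / 4)
          \<le> \<bar>sqrt (depth a x y) - sqrt (\<delta> y)\<bar> * (sqrt (depth a x y) + sqrt (\<delta> y))"
        by (rule mult_left_mono) (use s in linarith, simp)
      also have "\<dots> = \<bar>(sqrt (depth a x y) - sqrt (\<delta> y)) * (sqrt (depth a x y) + sqrt (\<delta> y))\<bar>"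
        using s by (simp add: abs_mult)
      also have "(sqrt (depth a x y) - sqrt (\<delta> y)) * (sqrt (depth a x y) + sqrt (\<delta> y)) = depth a x y - \<delta> y"
        using W1 d \<kappa> by (simp add: algebra_simps real_sqrt_mult_self)
      finally have "\<bar>sqrt (depth a x y) - sqrt (\<delta> y)\<bar> * sqrt (\<kappa> / 4) \<le> (2 + a * \<kappa>) * h"
        using diff by linarith
      then have "\<bar>sqrt (depth a x y) - sqrt (\<delta> y)\<bar> \<le> (2 + a * \<kappa>) / sqrt (\<kappa> / 4) * h"
        using s(1) by (simp add: pos_le_divide_eq del: real_sqrt_divide)
      also have "\<dots> \<le> C * h" unfolding C_def using Cterms h0 by (intro mult_right_mono) auto
      finally show ?thesis using W1 \<kappa> by (simp add: h_def)
    next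
      case near
      have dn: "\<bar>\<delta> y - w\<bar> \<le> 2 / \<kappa> * h^2"
        using depth_near[OF x y near(2)] near(1) unfolding w_def h_def by (simp add: norm_minus_commute)
      have "2 / \<kappa> * h^2 \<le> a * h^2" unfolding a_def using \<kappa> D by (intro mult_right_mono) auto
      then have W0: "0 \<le> depth a x y" using dn \<delta>_nonneg[of y] unfolding W by linarith
      have "a * h^2 \<ge> 0" using a by simp
      then have "\<bar>depth a x y - \<delta> y\<bar> \<le> (2 / \<kappa> + a) * h^2"
        using dn unfolding W distrib_right by linarith
      then have "sqrt \<bar>depth a x y - \<delta> y\<bar> \<le> sqrt ((2 / \<kappa> + a) * h^2)" by simp
      also have "\<dots> = sqrt (2 / \<kappa> + a) * h" using h0 by (simp add: real_sqrt_mult)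
      finally have "\<bar>sqrt (depth a x y) - sqrt (\<delta> y)\<bar> \<le> sqrt (2 / \<kappa> + a) * h"
        using abs_sqrt_diff_le[OF W0 \<delta>_nonneg[of y]] by linarith
      also have "\<dots> \<le> C * h" unfolding C_def using Cterms h0 by (intro mult_right_mono) auto
      finally show ?thesis using W0 by (simp add: h_def)
    qed
  qed
  show ?thesis by (rule that[of a A C]) (use a A C leA main in \<open>auto simp: depth_comparable_def\<close>)
qed

end

section \<open>Polynomial growth in anisotropic complex polydiscs\<close>

locale ball_domain_vec = ball_domain \<Omega> \<kappa> nv
  for \<Omega> :: "(real^'d) set" and \<kappa> :: real and nv :: "real^'d \<Rightarrow> real^'d"
begin

definition \<phi> :: "nat \<Rightarrow> real^'d \<Rightarrow> real" where "\<phi> n x = sqrt (\<delta> x) + 1 / real n"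

definition cpt :: "real^'d \<Rightarrow> real^'d \<Rightarrow> real^'d \<Rightarrow> complex \<Rightarrow> complex \<Rightarrow> complex^'d" where
  "cpt x \<tau> \<nu> s w = (\<chi> i. of_real (x $ i) + s * of_real (\<tau> $ i) + w * of_real (\<nu> $ i))"

text \<open>The coefficient \<open>8 / \<kappa>\<close> is dictated by
  \<open>region_in_\<Omega>\<close>: the squared tangential offset is at most \<open>2 * (s^2 + w^2)
  = \<kappa> / 4 * (8 / \<kappa> * (s^2 + w^2))\<close>. For \<open>x\<close> in
  \<open>\<Omega>\<close> with \<open>\<delta> x \<le> \<kappa>\<close> the base point is
  \<open>foot x\<close>.\<close>

definition curved :: "real^'d \<Rightarrow> real^'d \<Rightarrow> real^'d \<Rightarrow> complex \<Rightarrow> complex \<Rightarrow> complex \<Rightarrow> complex^'d" where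
  "curved x \<tau> \<nu> s w v = (\<chi> i. of_real ((x + \<delta>' x *\<^sub>R nrm x) $ i) + s * of_real (\<tau> $ i) + w * of_real (\<nu> $ i)
     - (v^2 + of_real (8 / \<kappa>) * (s^2 + w^2)) * of_real (nrm x $ i))"

text \<open>\<open>\<nu>\<close> may be any vector of norm at most 1, so normals at neighbouring
  boundary points are included; the larger radius is reserved for directions whose normal component
  is \<open>O(\<phi>)\<close>.\<close>

definition polydisc :: "real \<Rightarrow> real \<Rightarrow> nat \<Rightarrow> real^'d \<Rightarrow> (complex^'d) set" where
  "polydisc L \<epsilon> n x = {cpt x \<tau> \<nu> s w | \<tau> \<nu> s w. norm \<tau> \<le> 1 \<and> norm \<nu> \<le> 1 \<and>
     \<bar>\<tau> \<bullet> nrm x\<bar> \<le> L * \<phi> n x \<and> norm s \<le> \<epsilon> / real n \<and> norm w \<le> \<epsilon> * \<phi> n x / real n}"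

lemma polydiscI:
  "norm \<tau> \<le> 1 \<Longrightarrow> norm \<nu> \<le> 1 \<Longrightarrow> \<bar>\<tau> \<bullet> nrm x\<bar> \<le> L * \<phi> n x \<Longrightarrow> norm s \<le> \<epsilon> / real n \<Longrightarrow>
    norm w \<le> \<epsilon> * \<phi> n x / real n \<Longrightarrow> cpt x \<tau> \<nu> s w \<in> polydisc L \<epsilon> n x"
  unfolding polydisc_def by blast

lemma curved_real_bound:
  assumes x: "x \<in> \<Omega>" and F: "complexifies N f F" and M: "\<And>y. y \<in> \<Omega> \<Longrightarrow> \<bar>f y\<bar> \<le> M"
    and \<tau>: "norm \<tau> \<le> 1" "\<tau> \<bullet> nrm x = 0" and \<nu>: "norm \<nu> \<le> 1" "\<nu> \<bullet> nrm x = 0"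
    and s: "\<bar>s\<bar> \<le> \<kappa> / 8" and w: "\<bar>w\<bar> \<le> \<kappa> / 8" and v: "\<bar>v\<bar> \<le> sqrt (3 / 2 * \<kappa>)"
  shows "norm (F (curved x \<tau> \<nu> (of_real s) (of_real w) (of_real v))) \<le> M"
proof -
  define Z where "Z = s *\<^sub>R \<tau> + w *\<^sub>R \<nu>"
  define t where "t = v^2 + 8 / \<kappa> * (s^2 + w^2)"
  \<comment> \<open>The ranges add up to the admissible depth: \<open>3 / 2 * \<kappa>\<close> from
    \<open>v\<close> and \<open>\<kappa> / 4\<close> from \<open>s\<close> and \<open>w\<close> make
    \<open>7 / 4 * \<kappa>\<close>.\<close>
  have sq: "s^2 \<le> (\<kappa> / 8)^2" "w^2 \<le> (\<kappa> / 8)^2" "v^2 \<le> 3 / 2 * \<kappa>"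
    using abs_le_square_iff[of s "\<kappa> / 8"] abs_le_square_iff[of w "\<kappa> / 8"]
      abs_le_square_iff[of v "sqrt (3 / 2 * \<kappa>)"] s w v \<kappa> by (auto simp: real_sqrt_pow2)
  have "8 / \<kappa> * (s^2 + w^2) \<le> 8 / \<kappa> * ((\<kappa> / 8)^2 + (\<kappa> / 8)^2)"
    using sq \<kappa> by (intro mult_left_mono add_mono) auto
  also have "\<dots> = \<kappa> / 4" using \<kappa> by (simp add: power2_eq_square)
  finally have t: "t \<le> 7 / 4 * \<kappa>" using sq by (simp add: t_def)
  have t0: "0 \<le> t" using \<kappa> by (simp add: t_def)
  have "norm Z \<le> norm (s *\<^sub>R \<tau>) + norm (w *\<^sub>R \<nu>)" unfolding Z_def by (rule norm_triangle_ineq)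
  also have "\<dots> \<le> \<bar>s\<bar> * 1 + \<bar>w\<bar> * 1"
    unfolding norm_scaleR using \<tau> \<nu> by (intro add_mono mult_left_mono) auto
  finally have "(norm Z)^2 \<le> (\<bar>s\<bar> + \<bar>w\<bar>)^2" by (intro power_mono) auto
  also have "\<dots> \<le> 2 * (s^2 + w^2)"
    using zero_le_power2[of "\<bar>s\<bar> - \<bar>w\<bar>"] by (simp add: power2_eq_square algebra_simps)
  also have "\<dots> = \<kappa> / 4 * (8 / \<kappa> * (s^2 + w^2))" using \<kappa> by simp
  also have "\<dots> \<le> \<kappa> / 4 * t" unfolding t_def using \<kappa> by (intro mult_left_mono) auto
  finally have Z2: "(norm Z)^2 \<le> \<kappa> / 4 * t" .
  have Zn: "Z \<bullet> nrm x = 0" using \<tau> \<nu> by (simp add: Z_def inner_add_left)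
  have "curved x \<tau> \<nu> (of_real s) (of_real w) (of_real v) = cvec (x + \<delta>' x *\<^sub>R nrm x + Z - t *\<^sub>R nrm x)"
    by (simp add: curved_def vec_eq_iff Z_def t_def algebra_simps)
  then show ?thesis
    using M[OF region_in_\<Omega>[OF x Zn Z2 t0 t]] by (simp add: complexifies_cvec[OF F])
qed

lemma curved_bound:
  assumes x: "x \<in> \<Omega>" and F: "complexifies N f F" and M: "\<And>y. y \<in> \<Omega> \<Longrightarrow> \<bar>f y\<bar> \<le> M"
    and \<tau>: "norm \<tau> \<le> 1" "\<tau> \<bullet> nrm x = 0" and \<nu>: "norm \<nu> \<le> 1" "\<nu> \<bullet> nrm x = 0"
    and s: "\<bar>Re s\<bar> \<le> 11 / 12 * (\<kappa> / 8)" and w: "\<bar>Re w\<bar> \<le> 11 / 12 * (\<kappa> / 8)"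
    and v: "\<bar>Re v\<bar> \<le> 11 / 12 * sqrt (3 / 2 * \<kappa>)"
  shows "norm (F (curved x \<tau> \<nu> s w v)) \<le>
    M * exp (3 * real (2 * N) * \<bar>Im v\<bar> / sqrt (3 / 2 * \<kappa>)) * exp (3 * real (2 * N) * \<bar>Im w\<bar> / (\<kappa> / 8))
      * exp (3 * real (2 * N) * \<bar>Im s\<bar> / (\<kappa> / 8))"
proof -
  let ?b = "\<lambda>i. complex_of_real ((x + \<delta>' x *\<^sub>R nrm x) $ i)"
  let ?n = "\<lambda>i. complex_of_real (nrm x $ i)"
  let ?a = "complex_of_real (8 / \<kappa>)"
  have A: "\<kappa> / 8 > 0" "sqrt (3 / 2 * \<kappa>) > 0" using \<kappa> by auto
  have 1: "norm (F (curved x \<tau> \<nu> (of_real s) (of_real w) v))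
      \<le> M * exp (3 * real (2 * N) * \<bar>Im v\<bar> / sqrt (3 / 2 * \<kappa>))"
    if sw: "\<bar>s\<bar> \<le> \<kappa> / 8" "\<bar>w\<bar> \<le> \<kappa> / 8" for s w
  proof -
    define a where "a = (\<chi> i. ?b i + of_real s * of_real (\<tau> $ i) + of_real w * of_real (\<nu> $ i)
        - ?a * ((of_real s)^2 + (of_real w)^2) * ?n i)"
    define c where "c = (\<chi> i. - ?n i)"
    obtain Q where Q: "degree Q \<le> 2 * N" "\<And>v. poly Q v = F (\<chi> i. a $ i + v * 0 $ i + v^2 * c $ i)"
      using complexifies_quadratic_slice[OF F] by metis
    have eq: "(\<chi> i. a $ i + v * 0 $ i + v^2 * c $ i) = curved x \<tau> \<nu> (of_real s) (of_real w) v" for v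
      by (simp add: curved_def vec_eq_iff a_def c_def algebra_simps)
    show ?thesis
      using Bernstein_Walsh_strip[OF Q(1) A(2) _ v, of M]
        curved_real_bound[OF x F M \<tau> \<nu> sw] unfolding Q(2) eq by blast
  qed
  \<comment> \<open>Uniform in real \<open>s\<close> and \<open>w\<close>, this bound now plays the
    part of \<open>M\<close> for the slice in \<open>w\<close>, with \<open>v\<close> fixed and
    complex; the slice in \<open>s\<close> repeats the step.\<close>
  let ?Mv = "M * exp (3 * real (2 * N) * \<bar>Im v\<bar> / sqrt (3 / 2 * \<kappa>))"
  have 2: "norm (F (curved x \<tau> \<nu> (of_real s) w v))
      \<le> ?Mv * exp (3 * real (2 * N) * \<bar>Im w\<bar> / (\<kappa> / 8))"
    if s: "\<bar>s\<bar> \<le> \<kappa> / 8" for s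
  proof -
    define a where "a = (\<chi> i. ?b i + of_real s * of_real (\<tau> $ i)
        - (v^2 + ?a * (of_real s)^2) * ?n i)"
    define b where "b = (\<chi> i. complex_of_real (\<nu> $ i))"
    define c where "c = (\<chi> i. - ?a * ?n i)"
    obtain Q where Q: "degree Q \<le> 2 * N" "\<And>w. poly Q w = F (\<chi> i. a $ i + w * b $ i + w^2 * c $ i)"
      using complexifies_quadratic_slice[OF F] by metis
    have eq: "(\<chi> i. a $ i + w * b $ i + w^2 * c $ i) = curved x \<tau> \<nu> (of_real s) w v" for w
      by (simp add: curved_def vec_eq_iff a_def b_def c_def algebra_simps)
    show ?thesis
      using Bernstein_Walsh_strip[OF Q(1) A(1) _ w, of ?Mv] 1[OF s] unfolding Q(2) eq by blast
  qed
  define a where "a = (\<chi> i. ?b i + w * of_real (\<nu> $ i) - (v^2 + ?a * w^2) * ?n i)"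
  define b where "b = (\<chi> i. complex_of_real (\<tau> $ i))"
  define c where "c = (\<chi> i. - ?a * ?n i)"
  obtain Q where Q: "degree Q \<le> 2 * N" "\<And>s. poly Q s = F (\<chi> i. a $ i + s * b $ i + s^2 * c $ i)"
    using complexifies_quadratic_slice[OF F] by metis
  have eq: "(\<chi> i. a $ i + s * b $ i + s^2 * c $ i) = curved x \<tau> \<nu> s w v" for s
    by (simp add: curved_def vec_eq_iff a_def b_def c_def algebra_simps)
  show ?thesis
    using Bernstein_Walsh_strip[OF Q(1) A(1) _ s, of "?Mv * exp (3 * real (2 * N) * \<bar>Im w\<bar> / (\<kappa> / 8))"] 2
    unfolding Q(2) eq by blast
qed

text \<open>For the root \<open>v\<close> closer to \<open>v0\<close>, the product of
  \<open>norm (v - v0)\<close> and \<open>norm (v + v0)\<close> is \<open>norm (t - v0^2)\<close>,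
  and the second factor is at least \<open>v0\<close> and at least the first. Dividing by
  \<open>v0\<close> settles \<open>v0 \<ge> k\<close>; otherwise the square of the first factor is
  at most the product.\<close>

lemma root_near:
  fixes t :: complex
  assumes "v0 \<ge> 0" "k > 0" "e \<ge> 0" "e \<le> 1"
    and t: "norm (t - of_real (v0^2)) \<le> e^2 / 2 * (v0 + k) * k"
  obtains v where "v^2 = t" "norm (v - of_real v0) \<le> e * k"
proof -
  obtain v where v: "v^2 = t" "norm (v - of_real v0) \<le> norm (v + of_real v0)"
  proof (cases "norm (csqrt t - of_real v0) \<le> norm (csqrt t + of_real v0)")
    case True
    then show ?thesis using that[of "csqrt t"] by simp
  next
    case False
    have "norm (- csqrt t - of_real v0) = norm (csqrt t + of_real v0)"
      "norm (- csqrt t + of_real v0) = norm (csqrt t - of_real v0)"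
      using norm_minus_cancel[of "csqrt t + of_real v0"] norm_minus_cancel[of "csqrt t - of_real v0"] by simp_all
    then show ?thesis using that[of "- csqrt t"] False by simp
  qed
  define X Y where "X = norm (v - of_real v0)" and "Y = norm (v + of_real v0)"
  have XY: "X * Y \<le> e^2 / 2 * (v0 + k) * k"
    using t unfolding X_def Y_def norm_mult[symmetric] v(1)[symmetric]
    by (simp add: power2_eq_square algebra_simps)
  have "2 * v0 = norm ((v + of_real v0) - (v - of_real v0))" using assms by simp
  also have "\<dots> \<le> Y + X" unfolding X_def Y_def by (rule norm_triangle_ineq4)
  finally have Yv: "v0 \<le> Y" using v(2) by (simp add: X_def Y_def)
  have X0: "X \<ge> 0" "X \<le> Y" using v(2) by (simp_all add: X_def Y_def)
  have e2: "e^2 \<le> e" using assms by (simp add: power2_eq_square mult_left_le)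
  have "X \<le> e * k"
  proof (cases "v0 \<ge> k")
    case True
    have "X * v0 \<le> X * Y" using X0 Yv by (intro mult_left_mono) auto
    also note XY
    also have "e^2 / 2 * (v0 + k) * k \<le> e / 2 * (v0 + v0) * k"
      using e2 True assms by (intro mult_right_mono mult_mono) auto
    finally have "X * v0 \<le> (e * k) * v0" by (simp add: algebra_simps)
    then show ?thesis using True assms by (simp add: mult_le_cancel_right)
  next
    case False
    have "X^2 \<le> X * Y" using X0 by (simp add: power2_eq_square mult_left_mono)
    also note XY
    also have "e^2 / 2 * (v0 + k) * k \<le> e^2 / 2 * (k + k) * k"
      using False assms by (intro mult_right_mono mult_left_mono) auto
    also have "\<dots> = (e * k)^2" by (simp add: power2_eq_square)
    finally show ?thesis by (rule power2_le_imp_le) (use assms in simp)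
  qed
  then show ?thesis using that[OF v(1)] by (simp add: X_def)
qed

section \<open>Sup-norm bounds on complex polydiscs\<close>

lemma \<phi>_ge: "1 / real n \<le> \<phi> n x"
  by (simp add: \<phi>_def)

lemma \<phi>_pos: "n \<ge> 1 \<Longrightarrow> \<phi> n x > 0"
  using \<phi>_ge[of n x] by (smt (verit) of_nat_0_less_iff zero_less_divide_1_iff less_le_trans zero_less_one)

lemma \<delta>_bounded: obtains A where "A > 0" "\<And>x. x \<in> \<Omega> \<Longrightarrow> \<delta> x \<le> A"
proof -
  obtain a A C where "depth_comparable a A C" by (rule depth_comparison)
  note A = depth_comparableD[OF this]
  show ?thesis by (rule that[OF A(2)]) (use A(4) in blast)
qed

lemma \<phi>_bounded: obtains \<Phi> where "\<Phi> \<ge> 1" "\<And>x n. x \<in> \<Omega> \<Longrightarrow> n \<ge> 1 \<Longrightarrow> \<phi> n x \<le> \<Phi>"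
proof -
  obtain A where A: "A > 0" "\<And>x. x \<in> \<Omega> \<Longrightarrow> \<delta> x \<le> A" by (rule \<delta>_bounded) blast
  show ?thesis
  proof (rule that[of "sqrt A + 1"])
    fix x and n :: nat assume "x \<in> \<Omega>" "n \<ge> 1"
    then have "sqrt (\<delta> x) \<le> sqrt A" "1 / real n \<le> 1" using A by auto
    then show "\<phi> n x \<le> sqrt A + 1" unfolding \<phi>_def by linarith
  qed (use A in simp)
qed

text \<open>A point of the polydisc is written as a point of the curved surface: the normal parts of
  \<open>\<tau>\<close> and \<open>\<nu>\<close> are moved into \<open>v^2\<close>, and
  \<open>root_near\<close> finds \<open>v\<close> within \<open>O(1 / n)\<close> of the real number
  \<open>sqrt (\<delta>' x)\<close>. Then \<open>curved_bound\<close> costs only a constant factor,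
  as degree times imaginary part is bounded.\<close>

lemma polydisc_bound:
  assumes L: "L \<ge> 0"
  obtains \<epsilon> C where "\<epsilon> > 0" "C \<ge> 1"
    "\<And>x n f F M z. x \<in> \<Omega> \<Longrightarrow> n \<ge> 1 \<Longrightarrow> complexifies (K * n) f F \<Longrightarrow> (\<And>y. y \<in> \<Omega> \<Longrightarrow> \<bar>f y\<bar> \<le> M) \<Longrightarrow>
      z \<in> polydisc L \<epsilon> n x \<Longrightarrow>
      norm (F z) \<le> C * M"
proof -
  obtain A where A: "A > 0" "\<And>x. x \<in> \<Omega> \<Longrightarrow> \<delta> x \<le> A" by (rule \<delta>_bounded) blast
  obtain \<Phi> where \<Phi>: "\<Phi> \<ge> 1" "\<And>x n. x \<in> \<Omega> \<Longrightarrow> n \<ge> 1 \<Longrightarrow> \<phi> n x \<le> \<Phi>" by (rule \<phi>_bounded) blast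
  \<comment> \<open>\<open>c1\<close> pays for truncating the depth:
    \<open>\<phi> n x \<le> c1 * (v0 + 1 / n)\<close>. In \<open>B\<close> the terms stem from the
    normal part of \<open>\<tau>\<close>, that of \<open>\<nu>\<close>, and the squares of
    \<open>s\<close> and \<open>w\<close>; \<open>e\<close> keeps \<open>Re v\<close> in the range
    that \<open>Bernstein_Walsh_strip\<close> allows.\<close>
  define c1 where "c1 = 1 + sqrt (A / \<kappa>)"
  define a where "a = 8 / \<kappa>"
  define B where "B = L + 1 + a + a * \<Phi>"
  define e where "e = min 1 (sqrt \<kappa> / 10)"
  define \<epsilon> where "\<epsilon> = min (min 1 (1 / \<Phi>)) (min (\<kappa> / (10 * \<Phi>)) (e^2 / 2 / (B * c1)))"
  define C where "C = exp (6 * K / sqrt (3 / 2 * \<kappa>)) * exp (6 * K / (\<kappa> / 8)) * exp (6 * K / (\<kappa> / 8))"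
  have a: "a > 0" using \<kappa> by (simp add: a_def)
  have B: "B > 0" unfolding B_def using L a \<Phi> by (simp add: add_nonneg_pos add_pos_nonneg)
  have c1: "c1 \<ge> 1" using A \<kappa> by (simp add: c1_def)
  have e: "e > 0" "e \<le> 1" "e \<le> sqrt \<kappa> / 10" using \<kappa> by (auto simp: e_def)
  have \<epsilon>0: "\<epsilon> > 0" unfolding \<epsilon>_def using \<Phi> e B c1 \<kappa> by auto
  have \<epsilon>: "\<epsilon> \<le> 1" "\<epsilon> * \<Phi> \<le> 1" "\<epsilon> * \<Phi> \<le> \<kappa> / 10" "\<epsilon> * (B * c1) \<le> e^2 / 2"
  proof -
    have "\<epsilon> \<le> 1 / \<Phi>" "\<epsilon> \<le> \<kappa> / (10 * \<Phi>)" "\<epsilon> \<le> e^2 / 2 / (B * c1)" by (auto simp: \<epsilon>_def)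
    moreover have "B * c1 > 0" "\<Phi> > 0" using B c1 \<Phi> by auto
    ultimately show "\<epsilon> * \<Phi> \<le> 1" "\<epsilon> * \<Phi> \<le> \<kappa> / 10" "\<epsilon> * (B * c1) \<le> e^2 / 2"
      by (simp_all add: pos_le_divide_eq mult_ac)
    show "\<epsilon> \<le> 1" by (simp add: \<epsilon>_def)
  qed
  have C: "C \<ge> 1"
  proof -
    have "exp (6 * K / sqrt (3 / 2 * \<kappa>)) \<ge> 1" "exp (6 * K / (\<kappa> / 8)) \<ge> 1"
      using \<kappa> by simp_all
    then show ?thesis unfolding C_def using mult_mono[of 1 _ 1] by (smt (verit) mult_le_cancel_left1)
  qed
  show ?thesis
  proof (rule that[OF \<epsilon>0 C])
    fix x :: "real^'d" and z n f F M
    assume x: "x \<in> \<Omega>" and n: "(n::nat) \<ge> 1" and F: "complexifies (K * n) f F"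
      and M: "\<And>y. y \<in> \<Omega> \<Longrightarrow> \<bar>f y\<bar> \<le> M" and "z \<in> polydisc L \<epsilon> n x"
    then obtain \<tau> \<nu> s w where z: "z = cpt x \<tau> \<nu> s w" and \<tau>: "norm \<tau> \<le> 1" and \<nu>: "norm \<nu> \<le> 1"
      and \<tau>n: "\<bar>\<tau> \<bullet> nrm x\<bar> \<le> L * \<phi> n x"
      and s: "norm s \<le> \<epsilon> / real n" and w: "norm w \<le> \<epsilon> * \<phi> n x / real n"
      unfolding polydisc_def by blast
    define k where "k = 1 / real n"
    have k: "k > 0" "k \<le> 1" "k \<le> \<phi> n x" using n \<phi>_ge[of n x] by (auto simp: k_def)
    define \<phi>x where "\<phi>x = \<phi> n x"
    have \<phi>x: "0 < \<phi>x" "k \<le> \<phi>x" "\<phi>x \<le> \<Phi>" using k \<Phi>(2)[OF x n] by (auto simp: \<phi>x_def)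
    have s: "norm s \<le> \<epsilon> * k" and w: "norm w \<le> \<epsilon> * \<phi>x * k"
      using s w by (simp_all add: k_def \<phi>x_def)
    have M0: "M \<ge> 0" using M[OF x] by linarith
    define nn where "nn = nrm x"
    define \<tau>' where "\<tau>' = \<tau> - (\<tau> \<bullet> nn) *\<^sub>R nn"
    define \<nu>' where "\<nu>' = \<nu> - (\<nu> \<bullet> nn) *\<^sub>R nn"
    have proj: "norm (u - (u \<bullet> nn) *\<^sub>R nn) \<le> 1 \<and> (u - (u \<bullet> nn) *\<^sub>R nn) \<bullet> nrm x = 0" if "norm u \<le> 1" for u
    proof
      have "(norm (u - (u \<bullet> nn) *\<^sub>R nn))^2 = (norm u)^2 - (u \<bullet> nn)^2"
        unfolding power2_norm_eq_inner
        by (simp add: inner_diff_left inner_diff_right inner_commute power2_eq_square nn_def)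
      also have "\<dots> \<le> (norm u)^2" by simp
      finally have "norm (u - (u \<bullet> nn) *\<^sub>R nn) \<le> norm u" by (rule power2_le_imp_le) simp
      then show "norm (u - (u \<bullet> nn) *\<^sub>R nn) \<le> 1" using that by linarith
      show "(u - (u \<bullet> nn) *\<^sub>R nn) \<bullet> nrm x = 0" by (simp add: inner_diff_left nn_def)
    qed
    \<comment> \<open>The value that \<open>v^2\<close> must take for
      \<open>curved x \<tau>' \<nu>' s w v\<close> to equal
      \<open>cpt x \<tau> \<nu> s w\<close>.\<close>
    define t where "t = of_real (\<delta>' x) - s * of_real (\<tau> \<bullet> nn) - w * of_real (\<nu> \<bullet> nn) - of_real a * (s^2 + w^2)"
    define v0 where "v0 = sqrt (\<delta>' x)"
    have v0: "v0 \<ge> 0" "v0^2 = \<delta>' x" "v0 \<le> sqrt \<kappa>" using \<delta>'[of x] by (auto simp: v0_def)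
    have "sqrt (\<delta> x) \<le> c1 * v0"
    proof (cases "\<delta> x \<le> \<kappa>")
      case True
      then have "v0 = sqrt (\<delta> x)" by (simp add: v0_def \<delta>'_def)
      moreover have "1 * v0 \<le> c1 * v0" using c1 v0 by (intro mult_right_mono) auto
      ultimately show ?thesis by simp
    next
      case False
      then have "v0 = sqrt \<kappa>" by (simp add: v0_def \<delta>'_def)
      then have "c1 * v0 = sqrt \<kappa> + sqrt A" using \<kappa> by (simp add: c1_def distrib_right real_sqrt_divide)
      moreover have "sqrt (\<delta> x) \<le> sqrt A" using A x by auto
      moreover have "sqrt \<kappa> \<ge> 0" using \<kappa> by simp
      ultimately show ?thesis by linarith
    qed
    moreover have "k \<le> c1 * k" using c1 k by simp
    ultimately have \<phi>v: "\<phi>x \<le> c1 * (v0 + k)" unfolding \<phi>x_def \<phi>_def k_def distrib_left by linarith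
    have "norm (t - of_real (v0^2)) \<le> \<epsilon> * k * \<phi>x * B"
    proof -
      have \<nu>n: "\<bar>\<nu> \<bullet> nn\<bar> \<le> 1"
        using Cauchy_Schwarz_ineq2[of \<nu> nn] \<nu> by (simp add: nn_def)
      have 1: "norm (s * of_real (\<tau> \<bullet> nn)) \<le> \<epsilon> * k * (L * \<phi>x)"
        unfolding norm_mult norm_of_real
        using s \<tau>n \<epsilon>0 k by (intro mult_mono) (auto simp: nn_def \<phi>x_def)
      have 2: "norm (w * of_real (\<nu> \<bullet> nn)) \<le> \<epsilon> * \<phi>x * k * 1"
        unfolding norm_mult norm_of_real
        using w \<nu>n \<epsilon>0 k \<phi>x by (intro mult_mono) auto
      have "norm (s^2) \<le> (\<epsilon> * k) * (1 * \<phi>x)"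
      proof -
        have "\<epsilon> * k \<le> 1 * \<phi>x" using \<epsilon> \<phi>x k \<epsilon>0 by (intro mult_mono) auto
        then have "norm s \<le> 1 * \<phi>x" using s by linarith
        then show ?thesis unfolding power2_eq_square norm_mult
          using s \<epsilon>0 k by (intro mult_mono) auto
      qed
      moreover have "norm (w^2) \<le> (\<epsilon> * \<phi>x * k) * \<Phi>"
      proof -
        have "\<epsilon> * \<phi>x * k \<le> 1 * \<Phi> * 1" using \<epsilon> \<phi>x k \<epsilon>0 by (intro mult_mono) auto
        then have "norm w \<le> \<Phi>" using w by linarith
        then show ?thesis unfolding power2_eq_square norm_mult
          using w \<epsilon>0 k \<phi>x by (intro mult_mono) auto
      qed
      ultimately have "norm (s^2 + w^2) \<le> \<epsilon> * k * \<phi>x * (1 + \<Phi>)"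
        using norm_triangle_ineq[of "s^2" "w^2"] by (simp add: algebra_simps)
      then have 3: "norm (of_real a * (s^2 + w^2)) \<le> a * (\<epsilon> * k * \<phi>x * (1 + \<Phi>))"
        unfolding norm_mult using a by simp
      have "t - of_real (v0^2) = - (s * of_real (\<tau> \<bullet> nn) + w * of_real (\<nu> \<bullet> nn) + of_real a * (s^2 + w^2))"
        unfolding v0 by (simp add: t_def)
      then have "norm (t - of_real (v0^2)) \<le> norm (s * of_real (\<tau> \<bullet> nn) + w * of_real (\<nu> \<bullet> nn) + of_real a * (s^2 + w^2))"
        by (simp only: norm_minus_cancel)
      also have "\<dots> \<le> norm (s * of_real (\<tau> \<bullet> nn)) + norm (w * of_real (\<nu> \<bullet> nn)) + norm (of_real a * (s^2 + w^2))"
        by (rule order_trans[OF norm_triangle_ineq add_right_mono[OF norm_triangle_ineq]])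
      also have "\<dots> \<le> \<epsilon> * k * (L * \<phi>x) + \<epsilon> * \<phi>x * k * 1 + a * (\<epsilon> * k * \<phi>x * (1 + \<Phi>))"
        using 1 2 3 by linarith
      also have "\<dots> = \<epsilon> * k * \<phi>x * B" by (simp add: B_def algebra_simps)
      finally show ?thesis .
    qed
    also have "\<dots> \<le> \<epsilon> * k * (c1 * (v0 + k)) * B"
      using \<phi>v \<epsilon>0 k B by (intro mult_right_mono mult_left_mono) auto
    also have "\<dots> = \<epsilon> * (B * c1) * ((v0 + k) * k)" by (simp add: algebra_simps)
    also have "\<dots> \<le> e^2 / 2 * ((v0 + k) * k)"
      using \<epsilon> v0 k by (intro mult_right_mono) auto
    finally have "norm (t - of_real (v0^2)) \<le> e^2 / 2 * (v0 + k) * k" by (simp add: mult.assoc)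
    then obtain v where v: "v^2 = t" "norm (v - of_real v0) \<le> e * k"
      using root_near[OF v0(1) k(1), of e t] e by auto
    have Rv: "\<bar>Re v\<bar> \<le> 11 / 12 * sqrt (3 / 2 * \<kappa>)"
    proof -
      have "\<bar>Re v - v0\<bar> \<le> e * k" using abs_Re_le_cmod[of "v - of_real v0"] v(2) by simp
      moreover have "e * k \<le> sqrt \<kappa> / 10 * 1" using e k \<kappa> by (intro mult_mono) auto
      ultimately have "\<bar>Re v\<bar> \<le> 11 / 10 * sqrt \<kappa>" using v0 by linarith
      also have "11 / 10 * sqrt \<kappa> \<le> 11 / 12 * sqrt (3 / 2 * \<kappa>)"
      proof -
        have "6 / 5 \<le> sqrt (3 / 2)" by (rule real_le_rsqrt) (simp add: power2_eq_square)
        then have "6 / 5 * sqrt \<kappa> \<le> sqrt (3 / 2) * sqrt \<kappa>" using \<kappa> by (intro mult_right_mono) auto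
        then show ?thesis using real_sqrt_mult[of "3 / 2" \<kappa>] by linarith
      qed
      finally show ?thesis .
    qed
    have Iv: "\<bar>Im v\<bar> \<le> k"
    proof -
      have "\<bar>Im v\<bar> \<le> e * k" using abs_Im_le_cmod[of "v - of_real v0"] v(2) by simp
      also have "\<dots> \<le> 1 * k" using e k by (intro mult_right_mono) auto
      finally show ?thesis by simp
    qed
    have \<epsilon>\<Phi>: "\<epsilon> \<le> \<epsilon> * \<Phi>" using \<epsilon>0 \<Phi> by simp
    have ns: "norm s \<le> \<epsilon> * \<Phi> * k"
    proof -
      have "\<epsilon> * k \<le> \<epsilon> * \<Phi> * k" using \<epsilon>\<Phi> k by (intro mult_right_mono) auto
      then show ?thesis using s by linarith
    qed
    have nw: "norm w \<le> \<epsilon> * \<Phi> * k"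
    proof -
      have "\<epsilon> * \<phi>x * k \<le> \<epsilon> * \<Phi> * k" using \<epsilon>0 \<phi>x k by (intro mult_right_mono mult_left_mono) auto
      then show ?thesis using w by linarith
    qed
    have small: "\<epsilon> * \<Phi> * k \<le> \<kappa> / 10" "\<epsilon> * \<Phi> * k \<le> k"
    proof -
      have "\<epsilon> * \<Phi> * k \<le> \<kappa> / 10 * 1" using \<epsilon> k \<kappa> by (intro mult_mono) auto
      then show "\<epsilon> * \<Phi> * k \<le> \<kappa> / 10" by simp
      have "\<epsilon> * \<Phi> * k \<le> 1 * k" using \<epsilon> k by (intro mult_right_mono) auto
      then show "\<epsilon> * \<Phi> * k \<le> k" by simp
    qed
    have Rsw: "\<bar>Re s\<bar> \<le> 11 / 12 * (\<kappa> / 8)" "\<bar>Re w\<bar> \<le> 11 / 12 * (\<kappa> / 8)" "\<bar>Im s\<bar> \<le> k" "\<bar>Im w\<bar> \<le> k"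
      using abs_Re_le_cmod[of s] abs_Re_le_cmod[of w] abs_Im_le_cmod[of s] abs_Im_le_cmod[of w]
        ns nw small \<kappa> by linarith+
    have "cpt x \<tau> \<nu> s w = curved x \<tau>' \<nu>' s w v"
      unfolding curved_def v(1)
      by (simp add: cpt_def vec_eq_iff t_def \<tau>'_def \<nu>'_def a_def nn_def algebra_simps)
    then have "norm (F (cpt x \<tau> \<nu> s w)) \<le>
      M * exp (3 * real (2 * (K * n)) * \<bar>Im v\<bar> / sqrt (3 / 2 * \<kappa>)) * exp (3 * real (2 * (K * n)) * \<bar>Im w\<bar> / (\<kappa> / 8))
      * exp (3 * real (2 * (K * n)) * \<bar>Im s\<bar> / (\<kappa> / 8))"
      using curved_bound[OF x F M, of \<tau>' \<nu>' s w v] proj[OF \<tau>] proj[OF \<nu>] Rsw Rv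
      unfolding \<tau>'_def \<nu>'_def by auto
    also have "\<dots> \<le> M * exp (6 * K / sqrt (3 / 2 * \<kappa>)) * exp (6 * K / (\<kappa> / 8)) * exp (6 * K / (\<kappa> / 8))"
    proof -
      have *: "exp (3 * real (2 * (K * n)) * \<bar>y\<bar> / A) \<le> exp (6 * K / A)" if "\<bar>y\<bar> \<le> k" "A > 0" for y A
      proof -
        have "3 * real (2 * (K * n)) * \<bar>y\<bar> \<le> 3 * real (2 * (K * n)) * k"
          using that by (intro mult_left_mono) auto
        also have "\<dots> = 6 * K" using n by (simp add: k_def)
        finally show ?thesis using that by (simp add: divide_right_mono)
      qed
      show ?thesis using Iv Rsw \<kappa> M0 by (intro mult_mono * mult_nonneg_nonneg) auto
    qed
    also have "\<dots> = C * M" by (simp add: C_def)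
    finally show "norm (F z) \<le> C * M" by (simp only: z)
  qed
qed

text \<open>Scaling both parameters by \<open>\<zeta>\<close> gives an entire function bounded by
  \<open>C * M\<close> for \<open>norm \<zeta> \<le> R\<close>. Cauchy's estimate bounds its
  derivative on the unit disc by \<open>C * M / (R - 1)\<close>, and
  \<open>R = 1 + C / \<theta>\<close> makes this \<open>\<theta> * M\<close>; the polydisc shrinks
  by the factor \<open>R\<close>.\<close>

lemma polydisc_oscillation:
  assumes L: "L \<ge> 0" and \<theta>: "\<theta> > 0"
  obtains \<epsilon> where "\<epsilon> > 0"
    "\<And>x n f F M z. x \<in> \<Omega> \<Longrightarrow> n \<ge> 1 \<Longrightarrow> complexifies (K * n) f F \<Longrightarrow> (\<And>y. y \<in> \<Omega> \<Longrightarrow> \<bar>f y\<bar> \<le> M) \<Longrightarrow>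
      z \<in> polydisc L \<epsilon> n x \<Longrightarrow>
      norm (F z - of_real (f x)) \<le> \<theta> * M"
proof -
  obtain \<epsilon> C where \<epsilon>: "\<epsilon> > 0" "C \<ge> 1" and bound:
    "\<And>x n f F M z. x \<in> \<Omega> \<Longrightarrow> n \<ge> 1 \<Longrightarrow> complexifies (K * n) f F \<Longrightarrow> (\<And>y. y \<in> \<Omega> \<Longrightarrow> \<bar>f y\<bar> \<le> M) \<Longrightarrow>
      z \<in> polydisc L \<epsilon> n x \<Longrightarrow>
      norm (F z) \<le> C * M"
    by (rule polydisc_bound[OF L, of K]) blast
  define R where "R = 1 + C / \<theta>"
  have R: "R > 1" "C / (R - 1) = \<theta>" using \<epsilon> \<theta> by (auto simp: R_def)
  show ?thesis
  proof (rule that[of "\<epsilon> / R"])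
    fix x :: "real^'d" and z n f F M
    assume x: "x \<in> \<Omega>" and n: "(n::nat) \<ge> 1" and F: "complexifies (K * n) f F"
      and M: "\<And>y. y \<in> \<Omega> \<Longrightarrow> \<bar>f y\<bar> \<le> M" and "z \<in> polydisc L (\<epsilon> / R) n x"
    then obtain \<tau> \<nu> s w where z: "z = cpt x \<tau> \<nu> s w" and \<tau>: "norm \<tau> \<le> 1" and \<nu>: "norm \<nu> \<le> 1"
      and \<tau>n: "\<bar>\<tau> \<bullet> nrm x\<bar> \<le> L * \<phi> n x"
      and s: "norm s \<le> \<epsilon> / R / real n" and w: "norm w \<le> \<epsilon> / R * \<phi> n x / real n"
      unfolding polydisc_def by blast
    define G where "G \<zeta> = F (cpt x \<tau> \<nu> (\<zeta> * s) (\<zeta> * w))" for \<zeta>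
    have holG: "G holomorphic_on S" for S
      using complexifies_holomorphic[OF F, of "cvec x" "\<chi> i. s * of_real (\<tau> $ i) + w * of_real (\<nu> $ i)" S]
      unfolding G_def cpt_def by (simp add: algebra_simps)
    have bG: "norm (G \<zeta>) \<le> C * M" if "norm \<zeta> \<le> R" for \<zeta>
      unfolding G_def
    proof (intro bound[OF x n F M] polydiscI \<tau> \<nu> \<tau>n)
      have "norm \<zeta> * norm s \<le> R * (\<epsilon> / R / real n)" using that s R by (intro mult_mono) auto
      then show "norm (\<zeta> * s) \<le> \<epsilon> / real n" using R by (simp add: norm_mult)
      have "norm \<zeta> * norm w \<le> R * (\<epsilon> / R * \<phi> n x / real n)" using that w R by (intro mult_mono) auto
      then show "norm (\<zeta> * w) \<le> \<epsilon> * \<phi> n x / real n" using R by (simp add: norm_mult)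
    qed
    have dG: "norm (deriv G \<zeta>) \<le> \<theta> * M" if "norm \<zeta> \<le> 1" for \<zeta>
    proof -
      have "norm ((deriv ^^ 1) G \<zeta>) \<le> fact 1 * (C * M) / (R - 1) ^ 1"
      proof (rule Cauchy_inequality[OF holG holomorphic_on_imp_continuous_on[OF holG]])
        fix u assume "norm (\<zeta> - u) = R - 1"
        then have "norm u \<le> R" using that norm_triangle_ineq4[of \<zeta> "\<zeta> - u"] by simp
        then show "norm (G u) \<le> C * M" by (rule bG)
      qed (use R in simp)
      also have "\<dots> = C / (R - 1) * M" by simp
      finally show ?thesis using R by simp
    qed
    have "norm (G 1 - G 0) \<le> (\<theta> * M) * norm (1 - 0 :: complex)"
      by (rule field_differentiable_bound[of "cball 0 1" G "deriv G"])
         (use dG holomorphic_derivI[OF holG[of UNIV]] in \<open>auto intro: has_field_derivative_at_within\<close>)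
    moreover have "G 0 = of_real (f x)"
    proof -
      have "cpt x \<tau> \<nu> 0 0 = cvec x" by (simp add: cpt_def cvec_def)
      then show ?thesis by (simp add: G_def complexifies_cvec[OF F])
    qed
    ultimately show "norm (F z - of_real (f x)) \<le> \<theta> * M" by (simp add: G_def z)
  qed (use \<epsilon> R in simp)
qed

end

section \<open>Peaked polynomials\<close>

text \<open>The Dirichlet kernel \<open>sin ((2 * k + 1) * t) / sin t\<close> as a polynomial in
  \<open>(sin t)^2\<close>; the recursion is
  \<open>sin (a + 2 * t) + sin (a - 2 * t) = 2 * cos (2 * t) * sin a\<close>.\<close>

fun odd_sin_poly :: "nat \<Rightarrow> real poly" where
  "odd_sin_poly 0 = 1"
| "odd_sin_poly (Suc 0) = [:3, -4:]"
| "odd_sin_poly (Suc (Suc k)) = [:2, -4:] * odd_sin_poly (Suc k) - odd_sin_poly k"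

lemma degree_odd_sin_poly: "degree (odd_sin_poly k) \<le> k"
proof (induction k rule: odd_sin_poly.induct)
  case (3 k)
  have "degree ([:2, -4:] * odd_sin_poly (Suc k)) \<le> degree [:2, -4::real:] + degree (odd_sin_poly (Suc k))"
    by (rule degree_mult_le)
  also have "\<dots> \<le> Suc (Suc k)" using 3 by simp
  finally show ?case unfolding odd_sin_poly.simps using 3 by (intro degree_diff_le) auto
qed auto

lemma sin_odd_multiple: "sin (real (2 * k + 1) * t) = sin t * poly (odd_sin_poly k) ((sin t)^2)"
proof (induction k rule: odd_sin_poly.induct)
  case 2
  have "sin (3 * t) = sin (2 * t + t)" by simp
  also have "\<dots> = sin t * (3 - 4 * (sin t)^2)"
    unfolding sin_add sin_double cos_double
    using sin_cos_squared_add[of t] by (simp add: power2_eq_square) algebra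
  finally show ?case by simp
next
  case (3 k)
  define a where "a = real (2 * Suc k + 1) * t"
  have e: "real (2 * Suc (Suc k) + 1) * t = a + 2 * t" "real (2 * k + 1) * t = a - 2 * t"
    by (simp_all add: a_def algebra_simps)
  have "sin (a + 2 * t) = (2 - 4 * (sin t)^2) * sin a - sin (a - 2 * t)"
    unfolding sin_add sin_diff cos_double_sin by (simp add: algebra_simps)
  then show ?case
    using 3 unfolding e a_def[symmetric] odd_sin_poly.simps by (simp add: algebra_simps)
qed auto

lemma abs_sin_multiple_le: "\<bar>sin (real m * t)\<bar> \<le> real m * \<bar>sin t\<bar>"
proof (induction m)
  case (Suc m)
  have eq: "real (Suc m) * t = real m * t + t" by (simp add: algebra_simps)
  have "\<bar>sin (real (Suc m) * t)\<bar> = \<bar>sin (real m * t) * cos t + cos (real m * t) * sin t\<bar>"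
    unfolding eq sin_add ..
  also have "\<dots> \<le> \<bar>sin (real m * t)\<bar> * \<bar>cos t\<bar> + \<bar>cos (real m * t)\<bar> * \<bar>sin t\<bar>"
    by (metis abs_mult abs_triangle_ineq)
  also have "\<dots> \<le> \<bar>sin (real m * t)\<bar> * 1 + 1 * \<bar>sin t\<bar>"
    by (intro add_mono mult_left_mono mult_right_mono) auto
  finally show ?case using Suc by (simp add: algebra_simps)
qed auto

text \<open>A kernel of Jackson type: normalised to 1 at 0, and an even power for nonnegativity and
  decay of any prescribed order.\<close>

definition peak_poly :: "nat \<Rightarrow> nat \<Rightarrow> real poly" where
  "peak_poly s n = (smult (1 / real (2 * n + 1)) (odd_sin_poly n)) ^ (2 * s)"

lemma degree_peak_poly: "degree (peak_poly s n) \<le> 2 * s * n"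
proof -
  have "degree (peak_poly s n) \<le> degree (smult (1 / real (2 * n + 1)) (odd_sin_poly n)) * (2 * s)"
    unfolding peak_poly_def by (rule degree_power_le)
  also have "\<dots> \<le> n * (2 * s)"
    using degree_smult_le[of "1 / real (2 * n + 1)" "odd_sin_poly n"] degree_odd_sin_poly[of n]
    by (intro mult_right_mono) auto
  finally show ?thesis by (simp add: mult_ac)
qed

lemma poly_odd_sin_poly_0: "poly (odd_sin_poly n) 0 = real (2 * n + 1)"
  by (induction n rule: odd_sin_poly.induct) auto

lemma poly_peak_poly_0 [simp]: "poly (peak_poly s n) 0 = 1"
  using poly_odd_sin_poly_0[of n] by (simp add: peak_poly_def poly_power)

lemma poly_peak_poly_nonneg [simp]: "poly (peak_poly s n) x \<ge> 0"
  by (simp add: peak_poly_def poly_power power_mult)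

text \<open>Two bounds for the normalised quotient \<open>q\<close>: at most 1, as
  \<open>\<bar>sin (m * t)\<bar> \<le> m * \<bar>sin t\<bar>\<close>, and at most
  \<open>1 / ((2 * n + 1) * \<bar>v\<bar>)\<close>, as the sine is at most 1. Adding them covers
  small and large \<open>n * \<bar>v\<bar>\<close> at once.\<close>

lemma poly_peak_poly_le:
  assumes "\<bar>v\<bar> \<le> 1" "n \<ge> 1"
  shows "poly (peak_poly s n) (v^2) \<le> (2 / (1 + real n * \<bar>v\<bar>)) ^ (2 * s)"
proof -
  define t where "t = arcsin v"
  have t: "sin t = v" using assms by (simp add: t_def)
  define q where "q = poly (odd_sin_poly n) (v^2) / real (2 * n + 1)"
  have q: "v * q * real (2 * n + 1) = sin (real (2 * n + 1) * t)"
    unfolding sin_odd_multiple t by (simp add: q_def)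
  have "\<bar>q\<bar> \<le> 2 / (1 + real n * \<bar>v\<bar>)"
  proof (cases "v = 0")
    case True
    then have "q = 1" using poly_odd_sin_poly_0[of n] by (simp add: q_def)
    then show ?thesis using True by simp
  next
    case False
    then have v: "\<bar>v\<bar> > 0" by simp
    have "\<bar>v\<bar> * \<bar>q\<bar> * real (2 * n + 1) = \<bar>sin (real (2 * n + 1) * t)\<bar>"
      using q by (metis abs_mult abs_of_nat)
    moreover have "\<dots> \<le> real (2 * n + 1) * \<bar>v\<bar>" using abs_sin_multiple_le[of "2 * n + 1" t] t by simp
    moreover have "\<bar>sin (real (2 * n + 1) * t)\<bar> \<le> 1" by simp
    ultimately have 1: "\<bar>v\<bar> * \<bar>q\<bar> * real (2 * n + 1) \<le> \<bar>v\<bar> * 1 * real (2 * n + 1)"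
      and 2: "\<bar>v\<bar> * \<bar>q\<bar> * real (2 * n + 1) \<le> 1" by (simp_all only: mult_ac mult_1)
    have q1: "\<bar>q\<bar> \<le> 1"
      using 1 v by (simp only: mult_le_cancel_right_pos[OF of_nat_0_less_iff[THEN iffD2]] mult_le_cancel_left_pos)
    have "\<bar>q\<bar> * (real n * \<bar>v\<bar>) \<le> \<bar>q\<bar> * (real (2 * n + 1) * \<bar>v\<bar>)"
      by (intro mult_left_mono mult_right_mono) auto
    then have "\<bar>q\<bar> * (real n * \<bar>v\<bar>) \<le> 1" using 2 by (simp add: mult_ac)
    then have "\<bar>q\<bar> * (1 + real n * \<bar>v\<bar>) \<le> 2" using q1 by (simp add: algebra_simps)
    moreover have "1 + real n * \<bar>v\<bar> > 0" by (simp add: add_pos_nonneg)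
    ultimately show ?thesis by (simp add: pos_le_divide_eq)
  qed
  then have "\<bar>q\<bar> ^ (2 * s) \<le> (2 / (1 + real n * \<bar>v\<bar>)) ^ (2 * s)" by (intro power_mono) auto
  moreover have "poly (peak_poly s n) (v^2) = q ^ (2 * s)"
    by (simp add: peak_poly_def poly_power q_def)
  then have "poly (peak_poly s n) (v^2) = \<bar>q\<bar> ^ (2 * s)"
    by (simp add: power_even_abs)
  ultimately show ?thesis by simp
qed

text \<open>The sum over both signs is even in \<open>v\<close>, hence a polynomial in
  \<open>v^2\<close>. Linearity reduces this to \<open>X ^ k + Y ^ k\<close> with
  \<open>X = (v - v0)^2\<close> and \<open>Y = (v + v0)^2\<close>, whose sum and product are
  polynomials in \<open>v^2\<close>.\<close>

lemma even_part_poly: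
  fixes p :: "real poly"
  obtains q where "degree q \<le> degree p"
    "\<And>v. poly q (v^2) = poly p ((v - v0)^2) + poly p ((v + v0)^2)"
proof -
  have S: "\<exists>q. degree q \<le> k \<and> (\<forall>v. poly q (v^2) = ((v - v0)^2) ^ k + ((v + v0)^2) ^ k)" for k
  \<comment> \<open>The induction rule of \<open>odd_sin_poly\<close> is borrowed for its two-step
    shape, which fits the recursion of power sums by \<open>X + Y\<close> and
    \<open>X * Y\<close>.\<close>
  proof (induction k rule: odd_sin_poly.induct)
    case 1
    show ?case by (intro exI[of _ "[:2:]"]) auto
  next
    case 2
    show ?case by (intro exI[of _ "[:2 * v0^2, 2:]"]) (auto simp: power2_eq_square algebra_simps)
  next
    case (3 k)
    then obtain q r where q: "degree q \<le> Suc k" "\<And>v. poly q (v^2) = ((v - v0)^2) ^ Suc k + ((v + v0)^2) ^ Suc k"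
      and r: "degree r \<le> k" "\<And>v. poly r (v^2) = ((v - v0)^2) ^ k + ((v + v0)^2) ^ k" by metis
    let ?t = "[:2 * v0^2, 2:] * q - [:- (v0^2), 1:]^2 * r"
    have "degree ([:2 * v0^2, 2:] * q) \<le> Suc (Suc k)"
      using degree_mult_le[of "[:2 * v0^2, 2:]" q] q(1) by simp
    moreover have "degree ([:- (v0^2), 1:]^2 * r) \<le> Suc (Suc k)"
      using degree_mult_le[of "[:- (v0^2), 1:]^2" r] r(1) degree_power_le[of "[:- (v0^2), 1:]" 2] by simp
    ultimately have "degree ?t \<le> Suc (Suc k)" by (rule degree_diff_le)
    moreover have "poly ?t (v^2) = ((v - v0)^2) ^ Suc (Suc k) + ((v + v0)^2) ^ Suc (Suc k)" for v
    proof -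
      define X Y where "X = (v - v0)^2" and "Y = (v + v0)^2"
      have "poly ?t (v^2) = (X + Y) * (X ^ Suc k + Y ^ Suc k) - X * Y * (X ^ k + Y ^ k)"
        unfolding poly_diff poly_mult poly_power q r X_def[symmetric] Y_def[symmetric]
        by (simp add: X_def Y_def power2_eq_square algebra_simps)
      also have "\<dots> = X ^ Suc (Suc k) + Y ^ Suc (Suc k)" by (simp add: algebra_simps)
      finally show ?thesis by (simp add: X_def Y_def)
    qed
    ultimately show ?case by blast
  qed
  then obtain Q where Q: "\<And>k. degree (Q k) \<le> k" "\<And>k v. poly (Q k) (v^2) = ((v - v0)^2) ^ k + ((v + v0)^2) ^ k"
    by metis
  show ?thesis
  proof (rule that[of "\<Sum>k\<le>degree p. smult (coeff p k) (Q k)"])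
    show "degree (\<Sum>k\<le>degree p. smult (coeff p k) (Q k)) \<le> degree p"
      by (intro degree_sum_le) (auto intro: order_trans[OF degree_smult_le] order_trans[OF Q(1)])
    fix v
    show "poly (\<Sum>k\<le>degree p. smult (coeff p k) (Q k)) (v^2) = poly p ((v - v0)^2) + poly p ((v + v0)^2)"
      unfolding poly_altdef[of p] by (simp add: poly_sum Q(2) sum.distrib[symmetric] algebra_simps)
  qed
qed

text \<open>A peak in \<open>sqrt u\<close> centred at \<open>sqrt u0\<close> must become a
  polynomial in \<open>u\<close>, so it is symmetrised. The mirror peak at \<open>- sqrt u0\<close>
  does no harm, as \<open>\<bar>v + v0\<bar> \<ge> \<bar>v - v0\<bar>\<close> for nonnegative
  \<open>v\<close>, \<open>v0\<close>. Scaling by \<open>R = 2 * sqrt A\<close> brings both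
  arguments into \<open>[-1, 1]\<close>, and dividing by \<open>N \<ge> 1\<close> restores the value
  1.\<close>

lemma peak_poly_sqrt:
  assumes A: "A > 0" and n: "n \<ge> 1" and u0: "0 \<le> u0" "u0 \<le> A"
  obtains q where "degree q \<le> 2 * s * n" "poly q u0 = (1::real)"
    "\<And>u. 0 \<le> u \<Longrightarrow> u \<le> A \<Longrightarrow> 0 \<le> poly q u \<and>
      poly q u \<le> 2 * (2 * (1 + 2 * sqrt A) / (1 + real n * \<bar>sqrt u - sqrt u0\<bar>)) ^ (2 * s)"
proof -
  define R v0 where "R = 2 * sqrt A" and "v0 = sqrt u0"
  have R: "R > 0" using A by (simp add: R_def)
  have v0: "0 \<le> v0" "v0^2 = u0" "v0 \<le> sqrt A" using u0 by (auto simp: v0_def)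
  define p where "p = pcompose (peak_poly s n) [:0, 1 / R^2:]"
  have p: "poly p (v^2) = poly (peak_poly s n) ((v / R)^2)" for v
    by (simp add: p_def poly_pcompose power_divide)
  have degp: "degree p \<le> 2 * s * n"
    using degree_pcompose_le[of "peak_poly s n" "[:0, 1 / R^2:]"] degree_peak_poly[of s n] R
    by (simp add: p_def)
  obtain q where q: "degree q \<le> degree p" "\<And>v. poly q (v^2) = poly p ((v - v0)^2) + poly p ((v + v0)^2)"
    by (rule even_part_poly) blast
  define N where "N = 1 + poly p ((2 * v0)^2)"
  have p0: "poly p (v^2) \<ge> 0" for v unfolding p by simp
  have N: "N \<ge> 1" using p0[of "2 * v0"] by (simp only: N_def)
  have pv0: "poly q u0 = N" using q(2)[of v0] p[of 0] by (simp add: v0 N_def)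
  show ?thesis
  proof (rule that[of "smult (1 / N) q"])
    show "degree (smult (1 / N) q) \<le> 2 * s * n" using q(1) degp degree_smult_le[of "1 / N" q] by linarith
    show "poly (smult (1 / N) q) u0 = 1" using pv0 N by simp
    fix u assume u: "0 \<le> u" "u \<le> A"
    define v where "v = sqrt u"
    have v: "0 \<le> v" "v^2 = u" "v \<le> sqrt A" using u by (auto simp: v_def)
    define d where "d = \<bar>v - v0\<bar>"
    define B where "B = (2 * (1 + 2 * sqrt A) / (1 + real n * d)) ^ (2 * s)"
    have d: "d \<ge> 0" by (simp add: d_def)
    have est: "poly p (y^2) \<le> B" if y: "d \<le> \<bar>y\<bar>" "\<bar>y\<bar> \<le> R" for y
    proof -
      have "poly p (y^2) \<le> (2 / (1 + real n * \<bar>y / R\<bar>)) ^ (2 * s)"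
        unfolding p using y R by (intro poly_peak_poly_le n) auto
      also have "\<dots> \<le> B" unfolding B_def
      proof (rule power_mono)
        have "real n * d \<le> real n * \<bar>y\<bar>" using y by (intro mult_left_mono) auto
        moreover have "0 \<le> real n * \<bar>y\<bar> / R" "0 \<le> real n * \<bar>y\<bar>" using R by auto
        moreover have "(1 + R) * (1 + real n * \<bar>y\<bar> / R) = 1 + R + real n * \<bar>y\<bar> / R + real n * \<bar>y\<bar>"
          using R by (simp add: field_simps)
        ultimately have "1 + real n * d \<le> (1 + R) * (1 + real n * \<bar>y\<bar> / R)" using R by linarith
        moreover have "1 + real n * d > 0" "1 + real n * \<bar>y\<bar> / R > 0" using d R by (auto intro: add_pos_nonneg)
        ultimately have "(1 + R) * 2 / ((1 + R) * (1 + real n * \<bar>y\<bar> / R)) \<le> (1 + R) * 2 / (1 + real n * d)"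
          using R by (intro divide_left_mono mult_pos_pos) auto
        moreover have "(1 + R) * 2 / ((1 + R) * (1 + real n * \<bar>y\<bar> / R)) = 2 / (1 + real n * \<bar>y\<bar> / R)"
          by (rule mult_divide_mult_cancel_left) (use R in auto)
        moreover have "real n * \<bar>y / R\<bar> = real n * \<bar>y\<bar> / R" using R by (simp add: abs_divide)
        ultimately show "2 / (1 + real n * \<bar>y / R\<bar>) \<le> 2 * (1 + 2 * sqrt A) / (1 + real n * d)"
          by (simp only: R_def[symmetric] mult.commute[of 2 "1 + R"])
      qed (use R in auto)
      finally show ?thesis .
    qed
    have "poly p ((v - v0)^2) \<le> B" by (rule est) (use v v0 in \<open>auto simp: d_def R_def\<close>)
    moreover have "poly p ((v + v0)^2) \<le> B" by (rule est) (use v v0 in \<open>auto simp: d_def R_def\<close>)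
    ultimately have 1: "poly q u \<le> 2 * B" using q(2)[of v] by (simp add: v)
    have 2: "poly q u \<ge> 0" using q(2)[of v] p0[of "v - v0"] p0[of "v + v0"] by (simp add: v)
    have "poly q u / N \<le> poly q u / 1" using 2 N by (intro divide_left_mono) auto
    then show "0 \<le> poly (smult (1 / N) q) u \<and> poly (smult (1 / N) q) u
        \<le> 2 * (2 * (1 + 2 * sqrt A) / (1 + real n * \<bar>sqrt u - sqrt u0\<bar>)) ^ (2 * s)"
      using 1 2 N unfolding B_def d_def v_def v0_def by simp
  qed
qed

section \<open>Multivariate peaks\<close>

lemma complexifies_poly:
  assumes "complexifies m f F"
  shows "\<exists>G. complexifies (degree q * m) (\<lambda>x. poly q (f x)) G"
proof -
  have "complexifies (degree q * m) (\<lambda>x. coeff q k * f x ^ k) (\<lambda>z. of_real (coeff q k) * F z ^ k)"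
    if "k \<le> degree q" for k
    using that by (intro complexifies_cmult complexifies_mono[OF complexifies_power[OF assms]]) simp
  then have "complexifies (degree q * m) (\<lambda>x. \<Sum>k\<le>degree q. coeff q k * f x ^ k)
      (\<lambda>z. \<Sum>k\<le>degree q. of_real (coeff q k) * F z ^ k)"
    by (intro complexifies_sum) auto
  then show ?thesis unfolding poly_altdef by blast
qed

lemma complexifies_norm_square: "\<exists>G. complexifies 2 (\<lambda>y::real^'d. (norm (y - x))^2) G"
proof -
  have "complexifies 1 (\<lambda>y::real^'d. y $ i + (- x $ i)) (\<lambda>z. z $ i + of_real (- x $ i))" for i
    by (intro complexifies.add complexifies_nth complexifies.const)
  then have "complexifies (2 * 1) (\<lambda>y::real^'d. \<Sum>i\<in>UNIV. (y $ i + (- x $ i))^2)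
      (\<lambda>z. \<Sum>i\<in>UNIV. (z $ i + of_real (- x $ i))^2)"
    by (intro complexifies_sum complexifies_power)
  then show ?thesis
    unfolding power2_norm_eq_inner inner_vec_def by (auto simp: power2_eq_square)
qed

lemma complexifies_inner: "\<exists>G. complexifies 1 (\<lambda>y::real^'d. y \<bullet> a) G"
proof -
  have "complexifies 1 (\<lambda>y::real^'d. \<Sum>i\<in>UNIV. a $ i * y $ i) (\<lambda>z. \<Sum>i\<in>UNIV. of_real (a $ i) * z $ i)"
    by (intro complexifies_sum complexifies_cmult complexifies_nth)
  then show ?thesis unfolding inner_vec_def by (auto simp: mult.commute)
qed

context ball_domain_vec
begin

definition \<rho> :: "real^'d \<Rightarrow> real^'d \<Rightarrow> real" where
  "\<rho> x y = norm (y - x) + \<bar>sqrt (\<delta> y) - sqrt (\<delta> x)\<bar>"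

lemma \<rho>_nonneg [simp]: "\<rho> x y \<ge> 0"
  by (simp add: \<rho>_def)

lemma complexifies_depth: "\<exists>G. complexifies 2 (depth a x) G"
proof -
  obtain G1 G2 where G: "complexifies 2 (\<lambda>y::real^'d. (norm (y - x))^2) G1" "complexifies 1 (\<lambda>y::real^'d. y \<bullet> (- nrm x)) G2"
    using complexifies_norm_square complexifies_inner by metis
  have "complexifies 2 (\<lambda>y. (\<delta> x + x \<bullet> nrm x + y \<bullet> (- nrm x)) + a * (norm (y - x))^2)
     (\<lambda>z. (of_real (\<delta> x + x \<bullet> nrm x) + G2 z) + of_real a * G1 z)"
    by (intro complexifies.add complexifies_cmult G complexifies.const complexifies_mono[OF G(2)]) auto
  moreover have "depth a x = (\<lambda>y. (\<delta> x + x \<bullet> nrm x + y \<bullet> (- nrm x)) + a * (norm (y - x))^2)"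
    by (auto simp: depth_def inner_diff_left)
  ultimately show ?thesis by metis
qed

text \<open>Product of two peaks, one in \<open>(norm (y - x))^2\<close> at 0 and one in
  \<open>depth a x y\<close> at \<open>depth a x x = \<delta> x\<close>. Up to a factor,
  \<open>1 + n * \<rho> x y\<close> is at most \<open>(1 + n * h) * (1 + n * e)\<close>, since the
  roots of \<open>depth a x y\<close> and \<open>\<delta> y\<close> differ by \<open>O(h)\<close>.
  \<open>K = 8 * s\<close> adds two degrees \<open>2 * s * n\<close>, each doubled by a quadratic
  argument.\<close>

lemma bump:
  obtains K C where "C > 0"
    "\<And>x n. x \<in> \<Omega> \<Longrightarrow> n \<ge> 1 \<Longrightarrow> \<exists>b B. complexifies (K * n) b B \<and> b x = 1 \<and>
      (\<forall>y\<in>\<Omega>. 0 \<le> b y \<and> b y \<le> C / (1 + real n * \<rho> x y) ^ (2 * s))"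
proof -
  obtain a A Cd where "depth_comparable a A Cd" by (rule depth_comparison)
  note aA = depth_comparableD[OF this]
  define c where "c = 2 * (1 + 2 * sqrt A)"
  have c: "c > 0" using aA by (simp add: c_def add_pos_nonneg)
  define C where "C = 4 * c ^ (4 * s) * (1 + Cd) ^ (2 * s)"
  show ?thesis
  proof (rule that[of C "8 * s"])
    show "C > 0" using c aA by (simp add: C_def)
    fix x and n :: nat assume x: "x \<in> \<Omega>" and n: "n \<ge> 1"
    obtain q1 where q1: "degree q1 \<le> 2 * s * n" "poly q1 0 = (1::real)"
      "\<And>u. 0 \<le> u \<Longrightarrow> u \<le> A \<Longrightarrow> 0 \<le> poly q1 u \<and>
        poly q1 u \<le> 2 * (c / (1 + real n * \<bar>sqrt u - sqrt 0\<bar>)) ^ (2 * s)"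
      unfolding c_def by (rule peak_poly_sqrt[of A n 0 s]) (use aA n in auto)
    obtain q2 where q2: "degree q2 \<le> 2 * s * n" "poly q2 (\<delta> x) = (1::real)"
      "\<And>u. 0 \<le> u \<Longrightarrow> u \<le> A \<Longrightarrow> 0 \<le> poly q2 u \<and>
        poly q2 u \<le> 2 * (c / (1 + real n * \<bar>sqrt u - sqrt (\<delta> x)\<bar>)) ^ (2 * s)"
      unfolding c_def by (rule peak_poly_sqrt[of A n "\<delta> x" s]) (use aA(2) aA(4)[OF x x] n in auto)
    define b where "b y = poly q1 ((norm (y - x))^2) * poly q2 (depth a x y)" for y
    obtain G1 G2 where G: "complexifies (degree q1 * 2) (\<lambda>y. poly q1 ((norm (y - x))^2)) G1"
      "complexifies (degree q2 * 2) (\<lambda>y. poly q2 (depth a x y)) G2"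
      using complexifies_poly complexifies_norm_square complexifies_depth by metis
    have "degree q1 * 2 + degree q2 * 2 \<le> 8 * s * n" using q1(1) q2(1) by simp
    then have "complexifies (8 * s * n) b (\<lambda>z. G1 z * G2 z)"
      unfolding b_def by (rule complexifies_mono[OF complexifies_mult[OF G]])
    moreover have "b x = 1" using q1 q2 by (simp add: b_def depth_def)
    moreover have "0 \<le> b y \<and> b y \<le> C / (1 + real n * \<rho> x y) ^ (2 * s)" if y: "y \<in> \<Omega>" for y
    proof -
      define h e where "h = norm (y - x)" and "e = \<bar>sqrt (depth a x y) - sqrt (\<delta> x)\<bar>"
      have he: "h \<ge> 0" "e \<ge> 0" by (auto simp: h_def e_def)
      have 1: "0 \<le> poly q1 (h^2)" "poly q1 (h^2) \<le> 2 * (c / (1 + real n * h)) ^ (2 * s)"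
        using q1(3)[of "h^2"] aA(4)[OF x y] by (auto simp: h_def)
      have 2: "0 \<le> poly q2 (depth a x y)" "poly q2 (depth a x y) \<le> 2 * (c / (1 + real n * e)) ^ (2 * s)"
        using q2(3)[of "depth a x y"] aA(4)[OF x y] by (auto simp: e_def)
      have pos: "1 + real n * h > 0" "1 + real n * e > 0" "1 + real n * \<rho> x y > 0"
        using he by (auto intro: add_pos_nonneg)
      have "\<rho> x y \<le> h + (e + Cd * h)"
        using aA(5)[OF x y] unfolding \<rho>_def h_def e_def by linarith
      then have "real n * \<rho> x y \<le> real n * (h + (e + Cd * h))" by (intro mult_left_mono) auto
      moreover have "(1 + Cd) * (1 + real n * h) * (1 + real n * e)
          = 1 + real n * (h + (e + Cd * h)) + (Cd + Cd * (real n * e) + real n * h * (real n * e) * (1 + Cd))"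
        by (simp add: algebra_simps)
      moreover have "Cd + Cd * (real n * e) + real n * h * (real n * e) * (1 + Cd) \<ge> 0"
        using aA he by simp
      ultimately have r: "1 + real n * \<rho> x y \<le> (1 + Cd) * (1 + real n * h) * (1 + real n * e)" by linarith
      have "b y \<le> (2 * (c / (1 + real n * h)) ^ (2 * s)) * (2 * (c / (1 + real n * e)) ^ (2 * s))"
        unfolding b_def h_def[symmetric] using 1 2 by (intro mult_mono) auto
      also have "\<dots> = 4 * c ^ (4 * s) / ((1 + real n * h) * (1 + real n * e)) ^ (2 * s)"
        by (simp add: power_divide power_mult_distrib power_add[symmetric])
      also have "\<dots> = C / ((1 + Cd) * (1 + real n * h) * (1 + real n * e)) ^ (2 * s)"
        using aA by (simp add: C_def power_mult_distrib)
      also have "\<dots> \<le> C / (1 + real n * \<rho> x y) ^ (2 * s)"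
        using r pos \<open>C > 0\<close> by (intro divide_left_mono power_mono mult_pos_pos zero_less_power) (auto simp: aA add_pos_pos)
      finally have "b y \<le> C / (1 + real n * \<rho> x y) ^ (2 * s)" .
      moreover have "0 \<le> b y" unfolding b_def h_def[symmetric] using 1 2 by simp
      ultimately show ?thesis by simp
    qed
    ultimately show "\<exists>b B. complexifies (8 * s * n) b B \<and> b x = 1 \<and>
      (\<forall>y\<in>\<Omega>. 0 \<le> b y \<and> b y \<le> C / (1 + real n * \<rho> x y) ^ (2 * s))" by blast
  qed
qed

end

section \<open>Integrals of decaying kernels\<close>

lemma nn_integral_lborel_coordinate:
  fixes F :: "'a::euclidean_space \<Rightarrow> ennreal"
  assumes b: "b \<in> Basis" and F[measurable]: "F \<in> borel_measurable borel"
  shows "(\<integral>\<^sup>+z. F z \<partial>lborel) =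
    (\<integral>\<^sup>+x. (\<integral>\<^sup>+t. F ((\<Sum>i\<in>Basis - {b}. x i *\<^sub>R i) + t *\<^sub>R b) \<partial>lborel) \<partial>PiM (Basis - {b}) (\<lambda>_. lborel))"
proof -
  interpret product_sigma_finite "\<lambda>_::'a. lborel :: real measure" by standard
  have eq: "(\<Sum>i\<in>Basis. (x(b := t)) i *\<^sub>R i) = (\<Sum>i\<in>Basis - {b}. x i *\<^sub>R i) + t *\<^sub>R b" for x t
  proof -
    have "(\<Sum>i\<in>Basis. (x(b := t)) i *\<^sub>R i) = (x(b := t)) b *\<^sub>R b + (\<Sum>i\<in>Basis - {b}. (x(b := t)) i *\<^sub>R i)"
      using b by (intro sum.remove) auto
    also have "(\<Sum>i\<in>Basis - {b}. (x(b := t)) i *\<^sub>R i) = (\<Sum>i\<in>Basis - {b}. x i *\<^sub>R i)"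
      by (intro sum.cong) auto
    finally show ?thesis by (simp add: add.commute)
  qed
  have ins: "insert b (Basis - {b}) = Basis" using b by blast
  have "(\<integral>\<^sup>+z. F z \<partial>lborel) = (\<integral>\<^sup>+f. F (\<Sum>i\<in>Basis. f i *\<^sub>R i) \<partial>PiM Basis (\<lambda>_. lborel))"
    by (subst lborel_eq) (simp add: nn_integral_distr)
  also have "\<dots> = (\<integral>\<^sup>+f. F (\<Sum>i\<in>Basis. f i *\<^sub>R i) \<partial>PiM (insert b (Basis - {b})) (\<lambda>_. lborel))"
    by (simp only: ins)
  also have "\<dots> = (\<integral>\<^sup>+x. (\<integral>\<^sup>+t. F (\<Sum>i\<in>Basis. (x(b := t)) i *\<^sub>R i) \<partial>lborel) \<partial>PiM (Basis - {b}) (\<lambda>_. lborel))"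
    by (rule product_nn_integral_insert) (auto simp: ins)
  finally show ?thesis unfolding eq .
qed

lemma nn_integral_lborel_split:
  fixes G :: "'a::euclidean_space \<Rightarrow> ennreal" and g :: "'a \<Rightarrow> real \<Rightarrow> ennreal"
  assumes b: "b \<in> Basis" and g[measurable]: "\<And>i. g i \<in> borel_measurable borel"
    and G[measurable]: "G \<in> borel_measurable borel"
  shows "(\<integral>\<^sup>+z. (\<Prod>i\<in>Basis - {b}. g i (z \<bullet> i)) * G z \<partial>lborel) =
    (\<integral>\<^sup>+x. (\<Prod>i\<in>Basis - {b}. g i (x i)) *
      (\<integral>\<^sup>+t. G ((\<Sum>i\<in>Basis - {b}. x i *\<^sub>R i) + t *\<^sub>R b) \<partial>lborel) \<partial>PiM (Basis - {b}) (\<lambda>_. lborel))"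
proof -
  have ip: "((\<Sum>i\<in>Basis - {b}. x i *\<^sub>R i) + t *\<^sub>R b) \<bullet> j = x j" if "j \<in> Basis - {b}" for x t j
  proof -
    have "(\<Sum>i\<in>Basis - {b}. x i *\<^sub>R i) \<bullet> j = (\<Sum>i\<in>Basis - {b}. if i = j then x j else 0)"
      unfolding inner_sum_left using that by (intro sum.cong) (auto simp: inner_Basis)
    then show ?thesis using that b by (auto simp: inner_add_left inner_Basis)
  qed
  have "(\<integral>\<^sup>+z. (\<Prod>i\<in>Basis - {b}. g i (z \<bullet> i)) * G z \<partial>lborel) =
    (\<integral>\<^sup>+x. (\<integral>\<^sup>+t. (\<Prod>i\<in>Basis - {b}. g i (((\<Sum>i\<in>Basis - {b}. x i *\<^sub>R i) + t *\<^sub>R b) \<bullet> i))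
      * G ((\<Sum>i\<in>Basis - {b}. x i *\<^sub>R i) + t *\<^sub>R b) \<partial>lborel) \<partial>PiM (Basis - {b}) (\<lambda>_. lborel))"
    by (rule nn_integral_lborel_coordinate[OF b]) measurable
  also have "\<dots> = (\<integral>\<^sup>+x. (\<integral>\<^sup>+t. (\<Prod>i\<in>Basis - {b}. g i (x i))
      * G ((\<Sum>i\<in>Basis - {b}. x i *\<^sub>R i) + t *\<^sub>R b) \<partial>lborel) \<partial>PiM (Basis - {b}) (\<lambda>_. lborel))"
    using ip by (intro nn_integral_cong arg_cong2[of _ _ _ _ "(*)"] prod.cong refl) simp
  also have "\<dots> = (\<integral>\<^sup>+x. (\<Prod>i\<in>Basis - {b}. g i (x i)) *
      (\<integral>\<^sup>+t. G ((\<Sum>i\<in>Basis - {b}. x i *\<^sub>R i) + t *\<^sub>R b) \<partial>lborel) \<partial>PiM (Basis - {b}) (\<lambda>_. lborel))"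
    by (intro nn_integral_cong nn_integral_cmult) measurable
  finally show ?thesis .
qed

text \<open>Tonelli with one distinguished coordinate: bounds for the integrals of \<open>G\<close>
  over lines in direction \<open>b\<close>, uniform over these lines, suffice. Used from above for
  the decaying kernel and from below for the volume of boxes.\<close>

lemma nn_integral_lborel_split_bounds:
  fixes G :: "'a::euclidean_space \<Rightarrow> ennreal" and g :: "'a \<Rightarrow> real \<Rightarrow> ennreal"
  assumes b: "b \<in> Basis" and g[measurable]: "\<And>i. g i \<in> borel_measurable borel"
    and G[measurable]: "G \<in> borel_measurable borel"
  shows "(\<And>z. (\<integral>\<^sup>+t. G (z + t *\<^sub>R b) \<partial>lborel) \<le> B) \<Longrightarrow>
      (\<integral>\<^sup>+z. (\<Prod>i\<in>Basis - {b}. g i (z \<bullet> i)) * G z \<partial>lborel) \<le> (\<Prod>i\<in>Basis - {b}. \<integral>\<^sup>+t. g i t \<partial>lborel) * B"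
    and "(\<And>z. B \<le> (\<integral>\<^sup>+t. G (z + t *\<^sub>R b) \<partial>lborel)) \<Longrightarrow>
      (\<Prod>i\<in>Basis - {b}. \<integral>\<^sup>+t. g i t \<partial>lborel) * B \<le> (\<integral>\<^sup>+z. (\<Prod>i\<in>Basis - {b}. g i (z \<bullet> i)) * G z \<partial>lborel)"
proof -
  interpret product_sigma_finite "\<lambda>_::'a. lborel :: real measure" by standard
  have c: "(\<integral>\<^sup>+x. (\<Prod>i\<in>Basis - {b}. g i (x i)) * B \<partial>PiM (Basis - {b}) (\<lambda>_. lborel))
      = (\<Prod>i\<in>Basis - {b}. \<integral>\<^sup>+t. g i t \<partial>lborel) * B"
    by (subst nn_integral_multc) (auto intro!: product_nn_integral_prod arg_cong2[of _ _ _ _ "(*)"])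
  show "(\<And>z. (\<integral>\<^sup>+t. G (z + t *\<^sub>R b) \<partial>lborel) \<le> B) \<Longrightarrow>
      (\<integral>\<^sup>+z. (\<Prod>i\<in>Basis - {b}. g i (z \<bullet> i)) * G z \<partial>lborel) \<le> (\<Prod>i\<in>Basis - {b}. \<integral>\<^sup>+t. g i t \<partial>lborel) * B"
    unfolding c[symmetric] nn_integral_lborel_split[OF b g G] by (intro nn_integral_mono mult_left_mono) auto
  show "(\<And>z. B \<le> (\<integral>\<^sup>+t. G (z + t *\<^sub>R b) \<partial>lborel)) \<Longrightarrow>
      (\<Prod>i\<in>Basis - {b}. \<integral>\<^sup>+t. g i t \<partial>lborel) * B \<le> (\<integral>\<^sup>+z. (\<Prod>i\<in>Basis - {b}. g i (z \<bullet> i)) * G z \<partial>lborel)"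
    unfolding c[symmetric] nn_integral_lborel_split[OF b g G] by (intro nn_integral_mono mult_left_mono) auto
qed

lemma suminf_inverse_squares: "(\<Sum>k. ennreal (V / (real (Suc k))^2)) = ennreal (pi^2 / 6 * V)" if "V \<ge> 0"
proof -
  have "(\<lambda>k. V * (1 / (real k + 1)^2)) sums (V * (pi^2 / 6))"
    using inverse_squares_sums by (intro sums_mult) (simp add: add.commute)
  then have "(\<lambda>k. V / (real (Suc k))^2) sums (pi^2 / 6 * V)" by (simp add: add.commute mult.commute)
  then show ?thesis using that by (intro sums_unique[symmetric] sums_ennreal[THEN iffD2]) (auto simp: )
qed

text \<open>Layers by the integer part of \<open>\<bar>h\<bar>\<close>: the set where
  \<open>\<bar>h\<bar> < k\<close> has length at most \<open>k^2 * V\<close>, on the layer from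
  \<open>k - 1\<close> to \<open>k\<close> the integrand is at most \<open>1 / k ^ 4\<close>, and
  \<open>V / k^2\<close> sums to \<open>pi^2 / 6 * V\<close>. The quadratic growth of lengths is
  what a square root in \<open>h\<close> produces.\<close>

lemma nn_integral_decay_le:
  fixes h :: "real \<Rightarrow> real"
  assumes h[measurable]: "h \<in> borel_measurable borel" and V: "V \<ge> 0"
    and len: "\<And>k. k \<ge> 1 \<Longrightarrow> \<exists>p. \<forall>t. \<bar>h t\<bar> < real k \<longrightarrow> \<bar>t - p\<bar> \<le> (real k)^2 * V / 2"
  shows "(\<integral>\<^sup>+t. ennreal (1 / (1 + \<bar>h t\<bar>) ^ 4) \<partial>lborel) \<le> ennreal (pi^2 / 6 * V)"
proof -
  let ?T = "\<lambda>k t. ennreal (1 / (real (Suc k)) ^ 4) * indicator {t. \<bar>h t\<bar> < real (Suc k)} t"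
  have pt: "ennreal (1 / (1 + \<bar>h t\<bar>) ^ 4) \<le> (\<Sum>k. ?T k t)" for t
  proof -
    define k where "k = nat \<lfloor>\<bar>h t\<bar>\<rfloor>"
    have k: "real k \<le> \<bar>h t\<bar>" "\<bar>h t\<bar> < real (Suc k)" unfolding k_def by linarith+
    have "1 / (1 + \<bar>h t\<bar>) ^ 4 \<le> 1 / (real (Suc k)) ^ 4"
      using k by (intro divide_left_mono power_mono mult_pos_pos zero_less_power) auto
    then have "ennreal (1 / (1 + \<bar>h t\<bar>) ^ 4) \<le> ?T k t" using k by (simp add: ennreal_leI)
    also have "\<dots> \<le> (\<Sum>k. ?T k t)"
    proof -
      define u where "u = (\<lambda>k. ?T k t)"
      have "sum u {k} \<le> suminf u" by (rule sum_le_suminf) auto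
      then have "u k \<le> suminf u" by simp
      then show ?thesis unfolding u_def .
    qed
    finally show ?thesis .
  qed
  have "(\<integral>\<^sup>+t. ennreal (1 / (1 + \<bar>h t\<bar>) ^ 4) \<partial>lborel) \<le> (\<integral>\<^sup>+t. (\<Sum>k. ?T k t) \<partial>lborel)"
    using pt by (intro nn_integral_mono)
  also have "\<dots> = (\<Sum>k. \<integral>\<^sup>+t. ?T k t \<partial>lborel)" by (rule nn_integral_suminf) measurable
  also have "\<dots> \<le> (\<Sum>k. ennreal (V / (real (Suc k))^2))"
  proof (intro suminf_le)
    fix k
    obtain p where p: "\<And>t. \<bar>h t\<bar> < real (Suc k) \<Longrightarrow> \<bar>t - p\<bar> \<le> (real (Suc k))^2 * V / 2"
      using len[of "Suc k"] by auto
    let ?r = "(real (Suc k))^2 * V / 2"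
    have "emeasure lborel {t. \<bar>h t\<bar> < real (Suc k)} \<le> emeasure lborel {p - ?r .. p + ?r}"
    proof (rule emeasure_mono)
      show "{t. \<bar>h t\<bar> < real (Suc k)} \<subseteq> {p - ?r .. p + ?r}"
      proof
        fix t assume "t \<in> {t. \<bar>h t\<bar> < real (Suc k)}"
        then have "\<bar>t - p\<bar> \<le> ?r" by (intro p) blast
        then show "t \<in> {p - ?r .. p + ?r}" unfolding atLeastAtMost_iff by linarith
      qed
    qed simp
    also have "\<dots> = ennreal ((real (Suc k))^2 * V)" using V by (subst emeasure_lborel_Icc) (auto simp del: of_nat_Suc)
    finally have e: "emeasure lborel {t. \<bar>h t\<bar> < real (Suc k)} \<le> ennreal ((real (Suc k))^2 * V)" .
    have "(\<integral>\<^sup>+t. ?T k t \<partial>lborel) = ennreal (1 / (real (Suc k)) ^ 4) * emeasure lborel {t. \<bar>h t\<bar> < real (Suc k)}"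
      by (rule nn_integral_cmult_indicator) measurable
    also have "\<dots> \<le> ennreal (1 / (real (Suc k)) ^ 4) * ennreal ((real (Suc k))^2 * V)"
      by (rule mult_left_mono[OF e]) simp
    also have "\<dots> = ennreal (1 / (real (Suc k)) ^ 4 * ((real (Suc k))^2 * V))"
      using V by (subst ennreal_mult) auto
    also have "1 / (real (Suc k)) ^ 4 * ((real (Suc k))^2 * V) = V / (real (Suc k))^2"
      by (simp add: power2_eq_square power4_eq_xxxx field_simps del: of_nat_Suc)
    finally show "(\<integral>\<^sup>+t. ?T k t \<partial>lborel) \<le> ennreal (V / (real (Suc k))^2)" .
  qed auto
  also have "\<dots> = ennreal (pi^2 / 6 * V)" by (rule suminf_inverse_squares[OF V])
  finally show ?thesis .
qed

lemma nn_integral_decay_linear: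
  assumes "n \<ge> 1"
  shows "(\<integral>\<^sup>+t. ennreal (1 / (1 + real n * \<bar>t - p\<bar>) ^ 4) \<partial>lborel) \<le> ennreal (pi^2 / 6 * (2 / real n))"
proof -
  have "(\<integral>\<^sup>+t. ennreal (1 / (1 + \<bar>real n * (t - p)\<bar>) ^ 4) \<partial>lborel) \<le> ennreal (pi^2 / 6 * (2 / real n))"
  proof (rule nn_integral_decay_le)
    fix k :: nat assume k: "k \<ge> 1"
    show "\<exists>p'. \<forall>t. \<bar>real n * (t - p)\<bar> < real k \<longrightarrow> \<bar>t - p'\<bar> \<le> (real k)^2 * (2 / real n) / 2"
    proof (intro exI[of _ p] allI impI)
      fix t assume "\<bar>real n * (t - p)\<bar> < real k"
      then have "\<bar>t - p\<bar> * real n \<le> real k" by (simp add: abs_mult mult.commute)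
      also have "real k \<le> (real k)^2" using k by (simp add: power2_eq_square)
      finally show "\<bar>t - p\<bar> \<le> (real k)^2 * (2 / real n) / 2" using assms by (simp add: field_simps)
    qed
  qed auto
  then show ?thesis by (simp add: abs_mult)
qed

text \<open>\<open>sqrt\<close> is odd on the reals, so
  \<open>x = sqrt x * \<bar>sqrt x\<bar>\<close> for all \<open>x\<close>, and
  \<open>\<bar>sqrt y - v0\<bar> \<le> r\<close> confines \<open>y\<close> to the interval from
  \<open>L\<close> to \<open>U\<close>. Its length is \<open>O((v0 + r) * r)\<close>, which becomes
  the factor \<open>v0 + 1 / n\<close>, that is \<open>\<phi>\<close> in the application.\<close>

lemma nn_integral_decay_sqrt:
  assumes n: "n \<ge> 1" and v0: "v0 \<ge> 0" and m: "\<bar>m\<bar> \<ge> m0" "m0 > 0"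
  shows "(\<integral>\<^sup>+t. ennreal (1 / (1 + real n * \<bar>sqrt (c - t * m) - v0\<bar>) ^ 4) \<partial>lborel)
    \<le> ennreal (pi^2 / 6 * (4 / m0 * (v0 + 1 / real n) / real n))"
proof -
  have "(\<integral>\<^sup>+t. ennreal (1 / (1 + \<bar>real n * (sqrt (c - t * m) - v0)\<bar>) ^ 4) \<partial>lborel)
      \<le> ennreal (pi^2 / 6 * (4 / m0 * (v0 + 1 / real n) / real n))"
  proof (rule nn_integral_decay_le)
    fix k :: nat assume k: "k \<ge> 1"
    define r where "r = real k / real n"
    have r: "r > 0" using k n by (simp add: r_def)
    define U L where "U = (v0 + r)^2" and "L = (v0 - r) * \<bar>v0 - r\<bar>"
    have UL: "U - L \<le> 4 * v0 * r + 4 * r^2"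
    proof (cases "v0 \<ge> r")
      case True
      then show ?thesis using r by (simp add: U_def L_def power2_eq_square algebra_simps)
    next
      case False
      then have "U - L = 2 * v0^2 + 2 * r^2" by (simp add: U_def L_def power2_eq_square algebra_simps)
      moreover have "v0 * v0 \<le> v0 * r" using False v0 by (intro mult_left_mono) auto
      moreover have "0 \<le> v0 * r" "0 \<le> r * r" using v0 r by auto
      ultimately show ?thesis unfolding power2_eq_square by linarith
    qed
    have "4 * v0 * r + 4 * r^2 \<le> (real k)^2 * (4 * (v0 + 1 / real n) / real n)"
    proof -
      have "real k \<le> (real k)^2" using k by (simp add: power2_eq_square)
      then have "4 * v0 / real n * real k \<le> 4 * v0 / real n * (real k)^2" using v0 by (intro mult_left_mono) auto
      moreover have "(real k)^2 * (4 * (v0 + 1 / real n) / real n) = 4 * v0 / real n * (real k)^2 + 4 * r^2"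
        using n by (simp add: r_def power2_eq_square field_simps)
      ultimately show ?thesis by (simp add: r_def)
    qed
    with UL have UL': "U - L \<le> (real k)^2 * (4 * (v0 + 1 / real n) / real n)" by linarith
    have m0: "m \<noteq> 0" using m by auto
    have sq: "x = sqrt x * \<bar>sqrt x\<bar>" for x :: real
    proof (cases "x \<ge> 0")
      case False
      then have "sqrt (- x) * sqrt (- x) = - x" by (intro real_sqrt_mult_self[THEN trans]) auto
      then show ?thesis using False by (simp add: real_sqrt_minus)
    qed auto
    have mono: "x * \<bar>x\<bar> \<le> y * \<bar>y\<bar>" if "x \<le> y" for x y :: real
    proof -
      consider "0 \<le> x" | "x < 0" "0 \<le> y" | "y < 0" by linarith
      then show ?thesis
      proof cases
        case 1 then show ?thesis using that by (intro mult_mono) auto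
      next
        case 2 then show ?thesis by (smt (verit) abs_ge_zero mult_nonneg_nonneg mult_nonpos_nonneg)
      next
        case 3 then show ?thesis using that mult_mono[of "- y" "- x" "- y" "- x"] by simp
      qed
    qed
    have shift: "(t - P / m) * m = m * t - P" for t P using m0 by (simp add: field_simps)
    show "\<exists>p. \<forall>t. \<bar>real n * (sqrt (c - t * m) - v0)\<bar> < real k \<longrightarrow>
        \<bar>t - p\<bar> \<le> (real k)^2 * (4 / m0 * (v0 + 1 / real n) / real n) / 2"
    proof (intro exI[of _ "(c - (U + L) / 2) / m"] allI impI)
      fix t assume "\<bar>real n * (sqrt (c - t * m) - v0)\<bar> < real k"
      then have "real n * \<bar>sqrt (c - t * m) - v0\<bar> < real k" by (simp add: abs_mult)
      then have "\<bar>sqrt (c - t * m) - v0\<bar> \<le> r" using n by (simp add: r_def pos_le_divide_eq mult.commute)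
      then have "v0 - r \<le> sqrt (c - t * m)" "sqrt (c - t * m) \<le> v0 + r" by linarith+
      from this[THEN mono] have "L \<le> c - t * m" "c - t * m \<le> U"
        unfolding sq[symmetric] L_def U_def using v0 r by (simp_all add: power2_eq_square)
      then have b: "\<bar>m * t - (c - (U + L) / 2)\<bar> \<le> (U - L) / 2" by (simp add: abs_le_iff mult.commute field_simps)
      have "\<bar>t - (c - (U + L) / 2) / m\<bar> * m0 \<le> \<bar>t - (c - (U + L) / 2) / m\<bar> * \<bar>m\<bar>"
        using m by (intro mult_left_mono) auto
      also have "\<dots> = \<bar>(t - (c - (U + L) / 2) / m) * m\<bar>" by (simp add: abs_mult)
      also have "(t - (c - (U + L) / 2) / m) * m = m * t - (c - (U + L) / 2)"
        using shift .
      also note b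
      also have "(U - L) / 2 \<le> (real k)^2 * (4 * (v0 + 1 / real n) / real n) / 2"
        using UL' by (rule divide_right_mono) simp
      finally have "\<bar>t - (c - (U + L) / 2) / m\<bar> * m0 \<le> (real k)^2 * (4 * (v0 + 1 / real n) / real n) / 2" .
      then have "\<bar>t - (c - (U + L) / 2) / m\<bar> \<le> (real k)^2 * (4 * (v0 + 1 / real n) / real n) / 2 / m0"
        using m by (simp only: pos_le_divide_eq)
      also have "\<dots> = (real k)^2 * (4 / m0 * (v0 + 1 / real n) / real n) / 2" by simp
      finally show "\<bar>t - (c - (U + L) / 2) / m\<bar> \<le> (real k)^2 * (4 / m0 * (v0 + 1 / real n) / real n) / 2" .
    qed
  qed (use v0 m n in auto)
  then show ?thesis by (simp add: abs_mult)
qed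

section \<open>Integrating out a coordinate transversal to the boundary\<close>

lemma Basis_inner_large:
  fixes v :: "'a::euclidean_space"
  assumes "norm v = 1"
  obtains b where "b \<in> Basis" "\<bar>v \<bullet> b\<bar> \<ge> 1 / DIM('a)"
proof -
  have "\<exists>b\<in>Basis. \<bar>v \<bullet> b\<bar> \<ge> 1 / DIM('a)"
  proof (rule ccontr)
    assume "\<not> ?thesis"
    then have "(\<Sum>b\<in>Basis. \<bar>v \<bullet> b\<bar>) < (\<Sum>b\<in>(Basis::'a set). 1 / DIM('a))"
      by (intro sum_strict_mono) auto
    moreover have "norm v \<le> (\<Sum>b\<in>Basis. \<bar>v \<bullet> b\<bar>)" by (rule norm_le_l1)
    ultimately show False using assms by simp
  qed
  then show ?thesis using that by blast
qed

text \<open>Arguments may be negative here; \<open>sqrt\<close> is odd, and for opposite signs each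
  of the two roots has modulus at most \<open>sqrt \<bar>u - v\<bar>\<close>, whence the factor
  2.\<close>

lemma abs_sqrt_diff_le':
  fixes u v :: real
  shows "\<bar>sqrt u - sqrt v\<bar> \<le> 2 * sqrt \<bar>u - v\<bar>"
proof -
  have *: "sqrt u \<le> sqrt v + 2 * sqrt \<bar>u - v\<bar>" if "v \<le> u" for u v :: real
  proof -
    consider "0 \<le> v" | "v < 0" "0 \<le> u" | "u < 0" by linarith
    then show ?thesis
    proof cases
      case 1
      then show ?thesis using abs_sqrt_diff_le[of u v] that by (smt (verit) real_sqrt_ge_zero)
    next
      case 2
      then have "sqrt u \<le> sqrt \<bar>u - v\<bar>" "sqrt (- v) \<le> sqrt \<bar>u - v\<bar>" by (auto intro!: real_sqrt_le_mono)
      then have "- sqrt v \<le> sqrt \<bar>u - v\<bar>" by (simp only: real_sqrt_minus)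
      then show ?thesis using \<open>sqrt u \<le> sqrt \<bar>u - v\<bar>\<close> by linarith
    next
      case 3
      then show ?thesis using abs_sqrt_diff_le[of "- v" "- u"] that
        by (simp add: real_sqrt_minus) (smt (verit) real_sqrt_ge_zero)
    qed
  qed
  show ?thesis
  proof (cases "v \<le> u")
    case True
    then have "sqrt v \<le> sqrt u" by simp
    then show ?thesis using *[OF True] by linarith
  next
    case False
    then have "sqrt u \<le> sqrt v" "u \<le> v" by auto
    then show ?thesis using *[OF \<open>u \<le> v\<close>] by (simp only: abs_minus_commute[of u v])
  qed
qed

context ball_domain_vec
begin

text \<open>The exponent is shared out, 4 to each coordinate. Along \<open>b\<close>, where the
  normal at \<open>y\<close> has a component of modulus at least \<open>1 / D\<close>, the change of
  \<open>sqrt \<delta>\<close> integrates to \<open>O(\<phi> / n)\<close>; each other coordinate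
  integrates to \<open>O(1 / n)\<close>.\<close>

lemma kernel_integral:
  obtains C where "C > 0"
    "\<And>y n. y \<in> \<Omega> \<Longrightarrow> n \<ge> 1 \<Longrightarrow>
      (\<integral>\<^sup>+x\<in>\<Omega>. ennreal (1 / (1 + real n * \<rho> x y) ^ (4 * CARD('d))) \<partial>lborel) \<le> ennreal (C * \<phi> n y / real n ^ CARD('d))"
proof -
  obtain a A Cd where "depth_comparable a A Cd" by (rule depth_comparison)
  note aA = depth_comparableD[OF this]
  define D where "D = CARD('d)"
  have D: "D \<ge> 1" "DIM(real^'d) = D" by (simp_all add: D_def Suc_leI)
  define C3 where "C3 = 1 + 2 * sqrt a + Cd"
  have C3: "C3 \<ge> 1" using aA by (simp add: C3_def)
  define C where "C = C3 ^ 4 * (pi^2 / 6 * 2) ^ (D - 1) * (pi^2 / 6 * (4 * D))"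
  show ?thesis
  proof (rule that[of C])
    show "C > 0" using C3 D by (simp add: C_def)
    fix y :: "real^'d" and n :: nat assume y: "y \<in> \<Omega>" and n: "n \<ge> 1"
    obtain b where b: "b \<in> Basis" "\<bar>nrm y \<bullet> b\<bar> \<ge> 1 / D"
      using Basis_inner_large[OF norm_nrm[of y]] D by metis
    have cardB: "card (Basis - {b}) = D - 1" using b D by (simp add: card_Diff_singleton)
    \<comment> \<open>\<open>depth a y\<close> without the square in direction \<open>b\<close>:
      along \<open>b\<close> it is affine, as \<open>nn_integral_decay_sqrt\<close> requires. The
      omitted term is at most \<open>a * (norm (x - y))^2\<close> and costs
      \<open>2 * sqrt a\<close> in \<open>C3\<close>.\<close>
    define W where "W x = \<delta> y + (y - x) \<bullet> nrm y + a * (\<Sum>i\<in>Basis - {b}. ((x - y) \<bullet> i)^2)" for x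
    define G where "G x = ennreal (C3 ^ 4 * (1 / (1 + real n * \<bar>sqrt (W x) - sqrt (\<delta> y)\<bar>) ^ 4))" for x
    define g where "g i t = ennreal (1 / (1 + real n * \<bar>t - y \<bullet> i\<bar>) ^ 4)" for i t
    have [measurable]: "W \<in> borel_measurable borel" unfolding W_def by measurable
    have Gm[measurable]: "G \<in> borel_measurable borel" unfolding G_def by measurable
    have gm[measurable]: "g i \<in> borel_measurable borel" for i unfolding g_def by measurable
    have pos: "1 + real n * u > 0" if "u \<ge> 0" for u using that by (simp add: add_pos_nonneg)
    have pt: "ennreal (1 / (1 + real n * \<rho> x y) ^ (4 * D)) \<le> (\<Prod>i\<in>Basis - {b}. g i (x \<bullet> i)) * G x"
      if x: "x \<in> \<Omega>" for x
    proof -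
      define r where "r = 1 + real n * \<rho> x y"
      have r: "r \<ge> 1" by (simp add: r_def)
      have rn: "norm (x - y) \<le> \<rho> x y" by (simp add: \<rho>_def norm_minus_commute)
      have 1: "1 / r ^ 4 \<le> 1 / (1 + real n * \<bar>x \<bullet> i - y \<bullet> i\<bar>) ^ 4" if "i \<in> Basis" for i
      proof -
        have "\<bar>x \<bullet> i - y \<bullet> i\<bar> \<le> \<rho> x y"
          using Basis_le_norm[OF that, of "x - y"] rn by (simp add: inner_diff_left)
        then have "1 + real n * \<bar>x \<bullet> i - y \<bullet> i\<bar> \<le> r" unfolding r_def by (simp add: mult_left_mono)
        then show ?thesis using r pos[of "\<bar>x \<bullet> i - y \<bullet> i\<bar>"]
          by (intro divide_left_mono power_mono mult_pos_pos zero_less_power) auto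
      qed
      have 2: "1 / r ^ 4 \<le> C3 ^ 4 * (1 / (1 + real n * \<bar>sqrt (W x) - sqrt (\<delta> y)\<bar>) ^ 4)"
      proof -
        have "(norm (x - y))^2 = (\<Sum>i\<in>Basis. ((x - y) \<bullet> i)^2)"
          unfolding power2_norm_eq_inner by (subst euclidean_inner) (simp add: power2_eq_square)
        also have "\<dots> = ((x - y) \<bullet> b)^2 + (\<Sum>i\<in>Basis - {b}. ((x - y) \<bullet> i)^2)"
          using b by (intro sum.remove) auto
        finally have "depth a y x - W x = a * ((x - y) \<bullet> b)^2" by (simp add: depth_def W_def algebra_simps)
        moreover have "((x - y) \<bullet> b)^2 \<le> (norm (x - y))^2"
          using Basis_le_norm[OF b(1), of "x - y"] by (metis abs_ge_zero power2_abs power_mono)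
        then have "a * ((x - y) \<bullet> b)^2 \<le> a * (norm (x - y))^2" using aA(1) by (intro mult_left_mono) auto
        moreover have "0 \<le> a * ((x - y) \<bullet> b)^2" using aA(1) by simp
        ultimately have "\<bar>W x - depth a y x\<bar> \<le> a * (norm (x - y))^2" by linarith
        then have "sqrt \<bar>W x - depth a y x\<bar> \<le> sqrt (a * (norm (x - y))^2)" by (rule real_sqrt_le_mono)
        also have "\<dots> = sqrt a * norm (x - y)" by (simp add: real_sqrt_mult)
        finally have "sqrt \<bar>W x - depth a y x\<bar> \<le> sqrt a * norm (x - y)" .
        then have "\<bar>sqrt (W x) - sqrt (depth a y x)\<bar> \<le> 2 * sqrt a * norm (x - y)"
          using abs_sqrt_diff_le'[of "W x" "depth a y x"] by linarith
        then have "\<bar>sqrt (W x) - sqrt (\<delta> y)\<bar> \<le> 2 * sqrt a * norm (x - y) + Cd * norm (x - y) + \<bar>sqrt (\<delta> y) - sqrt (\<delta> x)\<bar>"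
          using aA(5)[OF y x] by linarith
        also have "\<dots> \<le> 2 * sqrt a * \<rho> x y + Cd * \<rho> x y + \<rho> x y"
          using rn aA by (intro add_mono mult_left_mono) (auto simp: \<rho>_def)
        also have "\<dots> = C3 * \<rho> x y" by (simp add: C3_def algebra_simps)
        finally have "real n * \<bar>sqrt (W x) - sqrt (\<delta> y)\<bar> \<le> real n * (C3 * \<rho> x y)" by (intro mult_left_mono) auto
        then have le: "1 + real n * \<bar>sqrt (W x) - sqrt (\<delta> y)\<bar> \<le> C3 * r"
          using C3 by (simp add: r_def algebra_simps)
        have "1 / r ^ 4 = C3 ^ 4 * (1 / (C3 * r) ^ 4)" using C3 by (simp add: power_mult_distrib)
        also have "\<dots> \<le> C3 ^ 4 * (1 / (1 + real n * \<bar>sqrt (W x) - sqrt (\<delta> y)\<bar>) ^ 4)"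
          using le C3 r pos[of "\<bar>sqrt (W x) - sqrt (\<delta> y)\<bar>"]
          by (intro mult_left_mono divide_left_mono power_mono mult_pos_pos zero_less_power) auto
        finally show ?thesis .
      qed
      have "1 / r ^ (4 * D) = (\<Prod>i\<in>Basis - {b}. 1 / r ^ 4) * (1 / r ^ 4)"
      proof -
        have "r ^ (4 * D) = (r ^ 4) ^ (D - 1) * r ^ 4"
          using D by (simp only: power_mult[symmetric] power_add[symmetric]) (simp add: algebra_simps)
        then show ?thesis using cardB by (simp add: power_one_over)
      qed
      also have "ennreal \<dots> = (\<Prod>i\<in>Basis - {b}. ennreal (1 / r ^ 4)) * ennreal (1 / r ^ 4)"
        using r by (subst ennreal_mult) (auto simp: prod_ennreal prod_nonneg simp del: prod_constant)
      also have "\<dots> \<le> (\<Prod>i\<in>Basis - {b}. g i (x \<bullet> i)) * G x"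
        unfolding g_def G_def using 1 2 by (intro mult_mono prod_mono_ennreal) (auto intro: ennreal_leI)
      finally show ?thesis by (simp add: r_def)
    qed
    have GB: "(\<integral>\<^sup>+t. G (z + t *\<^sub>R b) \<partial>lborel) \<le> ennreal (C3 ^ 4 * (pi^2 / 6 * (4 * D * \<phi> n y / real n)))" for z
    proof -
      have W: "W (z + t *\<^sub>R b) = W z - t * (nrm y \<bullet> b)" for t
      proof -
        have "(\<Sum>i\<in>Basis - {b}. ((z + t *\<^sub>R b - y) \<bullet> i)^2) = (\<Sum>i\<in>Basis - {b}. ((z - y) \<bullet> i)^2)"
          using b by (intro sum.cong refl) (auto simp: inner_diff_left inner_add_left inner_Basis)
        then show ?thesis by (simp add: W_def inner_diff_left inner_add_left inner_commute[of b])
      qed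
      have "(\<integral>\<^sup>+t. G (z + t *\<^sub>R b) \<partial>lborel) =
        (\<integral>\<^sup>+t. ennreal (C3 ^ 4) * ennreal (1 / (1 + real n * \<bar>sqrt (W z - t * (nrm y \<bullet> b)) - sqrt (\<delta> y)\<bar>) ^ 4) \<partial>lborel)"
        unfolding G_def W using C3 by (intro nn_integral_cong ennreal_mult) auto
      also have "\<dots> = ennreal (C3 ^ 4) * (\<integral>\<^sup>+t. ennreal (1 / (1 + real n * \<bar>sqrt (W z - t * (nrm y \<bullet> b)) - sqrt (\<delta> y)\<bar>) ^ 4) \<partial>lborel)"
        by (rule nn_integral_cmult) measurable
      also have "\<dots> \<le> ennreal (C3 ^ 4) * ennreal (pi^2 / 6 * (4 / (1 / D) * (sqrt (\<delta> y) + 1 / real n) / real n))"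
        using D by (intro mult_left_mono nn_integral_decay_sqrt n b) auto
      also have "\<dots> = ennreal (C3 ^ 4 * (pi^2 / 6 * (4 * D * \<phi> n y / real n)))"
        using C3 by (subst ennreal_mult[symmetric]) (auto simp: \<phi>_def)
      finally show ?thesis .
    qed
    have "(\<integral>\<^sup>+x\<in>\<Omega>. ennreal (1 / (1 + real n * \<rho> x y) ^ (4 * CARD('d))) \<partial>lborel)
        \<le> (\<integral>\<^sup>+x. (\<Prod>i\<in>Basis - {b}. g i (x \<bullet> i)) * G x \<partial>lborel)"
      using pt unfolding D_def by (intro nn_integral_mono) (auto simp: indicator_def)
    also have "\<dots> \<le> (\<Prod>i\<in>Basis - {b}. \<integral>\<^sup>+t. g i t \<partial>lborel) * ennreal (C3 ^ 4 * (pi^2 / 6 * (4 * D * \<phi> n y / real n)))"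
      by (rule nn_integral_lborel_split_bounds(1)[OF b(1) gm Gm GB])
    also have "\<dots> \<le> (\<Prod>i\<in>Basis - {b}. ennreal (pi^2 / 6 * (2 / real n))) * ennreal (C3 ^ 4 * (pi^2 / 6 * (4 * D * \<phi> n y / real n)))"
      unfolding g_def using nn_integral_decay_linear[OF n] by (intro mult_right_mono prod_mono_ennreal) auto
    also have "\<dots> = ennreal ((pi^2 / 6 * (2 / real n)) ^ (D - 1) * (C3 ^ 4 * (pi^2 / 6 * (4 * D * \<phi> n y / real n))))"
    proof -
      show ?thesis using cardB \<phi>_pos[OF n, of y] C3
        by (subst ennreal_mult) (auto simp: ennreal_power)
    qed
    also have "(pi^2 / 6 * (2 / real n)) ^ (D - 1) * (C3 ^ 4 * (pi^2 / 6 * (4 * D * \<phi> n y / real n))) = C * \<phi> n y / real n ^ CARD('d)"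
    proof -
      have "real n ^ D = real n ^ (D - 1) * real n" using power_minus_mult[of D "real n"] D by simp
      moreover have "(pi^2 / 6 * (2 / real n)) ^ (D - 1) = (pi^2 / 6 * 2) ^ (D - 1) / real n ^ (D - 1)"
        unfolding times_divide_eq_right power_divide ..
      moreover define X A where "X = (pi^2 / 6 * 2) ^ (D - 1)" and "A = pi^2 / 6"
      ultimately show ?thesis unfolding D_def[symmetric] C_def X_def[symmetric] A_def[symmetric]
        by (simp only: X_def[symmetric] A_def[symmetric] times_divide_eq_right times_divide_eq_left divide_divide_eq_left mult_ac)
    qed
    finally show "(\<integral>\<^sup>+x\<in>\<Omega>. ennreal (1 / (1 + real n * \<rho> x y) ^ (4 * CARD('d))) \<partial>lborel)
      \<le> ennreal (C * \<phi> n y / real n ^ CARD('d))" .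
  qed
qed

text \<open>Displacements go inwards, \<open>0 \<le> u\<close>, so that a box at a boundary point
  can stay in \<open>\<Omega>\<close>; exact tangency of \<open>Z\<close> makes
  \<open>polydisc\<close> with \<open>L = 0\<close> applicable.\<close>

definition anisotropic_box :: "real \<Rightarrow> real \<Rightarrow> real \<Rightarrow> nat \<Rightarrow> real^'d \<Rightarrow> (real^'d) set \<Rightarrow> bool" where
  "anisotropic_box \<epsilon> c C n x E \<longleftrightarrow> E \<in> sets borel \<and> E \<subseteq> \<Omega> \<and>
     ennreal (c * \<phi> n x / real n ^ CARD('d)) \<le> emeasure lborel E \<and>
     (\<forall>y\<in>E. \<phi> n y \<le> C * \<phi> n x \<and> (\<exists>Z u. y = x + Z - u *\<^sub>R nrm x \<and> Z \<bullet> nrm x = 0 \<and>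
       norm Z \<le> \<epsilon> / real n \<and> 0 \<le> u \<and> u \<le> \<epsilon> * \<phi> n x / real n))"

lemma anisotropic_box_exists:
  assumes \<epsilon>: "0 < \<epsilon>" "\<epsilon> \<le> 1"
  obtains c C where "c > 0" "C > 0"
    "\<And>x n. x \<in> \<Omega> \<Longrightarrow> n \<ge> 1 \<Longrightarrow> \<exists>E. anisotropic_box \<epsilon> c C n x E"
proof -
  obtain a A Cd where "depth_comparable a A Cd" by (rule depth_comparison)
  note aA = depth_comparableD[OF this]
  obtain \<Phi> where \<Phi>: "\<Phi> \<ge> 1" "\<And>x n. x \<in> \<Omega> \<Longrightarrow> n \<ge> 1 \<Longrightarrow> \<phi> n x \<le> \<Phi>" by (rule \<phi>_bounded) blast
  define D where "D = CARD('d)"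
  have D: "D \<ge> 1" "DIM(real^'d) = D" by (simp_all add: D_def Suc_leI)
  define H where "H = 2 * (real D)^2 * (1 + 2 * \<Phi>)"
  have H: "H > 0" unfolding H_def using D \<Phi> by (intro mult_pos_pos) auto
  \<comment> \<open>The first two bounds keep \<open>u\<close> and \<open>Z\<close> within the sizes
    set by \<open>\<epsilon>\<close>, the third keeps the depth below
    \<open>7 / 4 * \<kappa>\<close>, and the last is the condition on \<open>norm Z\<close> in
    \<open>region_in_\<Omega>\<close>, where \<open>H * c1 / n\<close> bounds
    \<open>norm Z\<close>.\<close>
  define c1 where "c1 = min (min (\<epsilon> / 2) (\<epsilon> / H)) (min (3 * \<kappa> / (8 * \<Phi>)) (\<kappa> / (4 * H^2)))"
  have c1: "c1 > 0" unfolding c1_def using \<epsilon> H \<Phi> \<kappa> by auto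
  have c1': "2 * c1 \<le> \<epsilon>" "H * c1 \<le> \<epsilon>" "2 * c1 * \<Phi> \<le> 3 / 4 * \<kappa>" "(H * c1)^2 \<le> \<kappa> / 4 * c1"
  proof -
    have *: "c1 \<le> \<epsilon> / 2" "c1 \<le> \<epsilon> / H" "c1 \<le> 3 * \<kappa> / (8 * \<Phi>)" "c1 \<le> \<kappa> / (4 * H^2)"
      unfolding c1_def by linarith+
    show "2 * c1 \<le> \<epsilon>" using *(1) by simp
    show "H * c1 \<le> \<epsilon>" using *(2) H by (simp add: pos_le_divide_eq mult.commute)
    show "2 * c1 * \<Phi> \<le> 3 / 4 * \<kappa>" using *(3) \<Phi>(1) by (simp add: pos_le_divide_eq mult_ac)
    have "c1 * (4 * H^2) \<le> \<kappa>" using *(4) H by (simp add: pos_le_divide_eq)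
    then have "c1 * (4 * H^2) * c1 \<le> \<kappa> * c1" using c1 by (intro mult_right_mono) auto
    then show "(H * c1)^2 \<le> \<kappa> / 4 * c1" by (simp add: power2_eq_square mult_ac)
  qed
  define C where "C = 2 + (sqrt a + Cd) * (1 + \<Phi>)"
  show ?thesis
  proof (rule that[of "(2 * c1) ^ (D - 1) * c1" C])
    show "(2 * c1) ^ (D - 1) * c1 > 0" using c1 by simp
    show "C > 0" unfolding C_def using aA \<Phi> by (intro add_pos_nonneg mult_nonneg_nonneg) auto
    fix x :: "real^'d" and n :: nat assume x: "x \<in> \<Omega>" and n: "n \<ge> 1"
    define \<phi>x where "\<phi>x = \<phi> n x"
    define k where "k = 1 / real n"
    have k: "k > 0" "k \<le> 1" "k \<le> \<phi>x" "\<phi>x \<le> \<Phi>" "\<phi>x > 0"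
      using n \<phi>_ge[of n x] \<Phi>(2)[OF x n] \<phi>_pos[OF n, of x] by (auto simp: k_def \<phi>x_def)
    obtain b where b: "b \<in> Basis" "\<bar>nrm x \<bullet> b\<bar> \<ge> 1 / D"
      using Basis_inner_large[OF norm_nrm[of x]] D by metis
    have cardB: "card (Basis - {b}) = D - 1" using b D by (simp add: card_Diff_singleton)
    define U where "U y = (x - y) \<bullet> nrm x" for y
    define P where "P = c1 * \<phi>x * k"
    have P: "P > 0" using c1 k by (simp add: P_def)
    \<comment> \<open>The slab starts at \<open>P\<close> and not at 0: a positive depth is what
      leaves room for the tangential offset \<open>Z\<close> when \<open>x\<close> lies on the
      boundary.\<close>
    define E where "E = {y. (\<forall>i\<in>Basis - {b}. \<bar>y \<bullet> i - x \<bullet> i\<bar> \<le> c1 * k) \<and> P \<le> U y \<and> U y \<le> 2 * P}"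
    have Eprop: "\<phi> n y \<le> C * \<phi> n x" "y \<in> \<Omega>"
      "\<exists>Z u. y = x + Z - u *\<^sub>R nrm x \<and> Z \<bullet> nrm x = 0 \<and> norm Z \<le> \<epsilon> / real n \<and> 0 \<le> u \<and> u \<le> \<epsilon> * \<phi> n x / real n"
      if "y \<in> E" for y
    proof -
      have yi: "\<bar>y \<bullet> i - x \<bullet> i\<bar> \<le> c1 * k" if "i \<in> Basis - {b}" for i using \<open>y \<in> E\<close> that by (auto simp: E_def)
      define u where "u = U y"
      have u: "P \<le> u" "u \<le> 2 * P" using \<open>y \<in> E\<close> by (auto simp: E_def u_def)
      define Z where "Z = y - x + u *\<^sub>R nrm x"
      have yZ: "y = x + Z - u *\<^sub>R nrm x" by (simp add: Z_def)
      have Zn: "Z \<bullet> nrm x = 0" by (simp add: Z_def u_def U_def inner_diff_left inner_add_left)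
      have nb: "\<bar>nrm x \<bullet> i\<bar> \<le> 1" if "i \<in> Basis" for i using Basis_le_norm[OF that, of "nrm x"] by simp
      define q where "q = c1 * (1 + 2 * \<Phi>) * k"
      have q: "q > 0" unfolding q_def using c1 k \<Phi> by (intro mult_pos_pos) auto
      have Zi: "\<bar>Z \<bullet> i\<bar> \<le> q" if i: "i \<in> Basis - {b}" for i
      proof -
        have "Z \<bullet> i = (y \<bullet> i - x \<bullet> i) + u * (nrm x \<bullet> i)" by (simp add: Z_def inner_diff_left inner_add_left)
        moreover have "\<bar>u * (nrm x \<bullet> i)\<bar> \<le> 2 * P * 1"
          unfolding abs_mult using u P nb[of i] i by (intro mult_mono) auto
        moreover have "2 * P \<le> 2 * (c1 * \<Phi> * k)" unfolding P_def using k c1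
          by (intro mult_left_mono mult_right_mono) auto
        ultimately have "\<bar>Z \<bullet> i\<bar> \<le> c1 * k + 2 * (c1 * \<Phi> * k)" using yi[OF i] by linarith
        then show ?thesis by (simp add: q_def algebra_simps)
      qed
      have sumZ: "(\<Sum>i\<in>Basis - {b}. \<bar>Z \<bullet> i\<bar>) \<le> D * q"
      proof -
        have "(\<Sum>i\<in>Basis - {b}. \<bar>Z \<bullet> i\<bar>) \<le> real (card (Basis - {b})) * q"
          using Zi by (intro sum_bounded_above) auto
        also have "\<dots> \<le> D * q" using cardB D q by (intro mult_right_mono) auto
        finally show ?thesis .
      qed
      \<comment> \<open>The \<open>b\<close> coordinate is not restricted directly in
        \<open>E\<close>; it is recovered from \<open>Z \<bullet> nrm x = 0\<close> by dividing by
        \<open>nrm x \<bullet> b\<close>.\<close>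
      have Zb: "\<bar>Z \<bullet> b\<bar> \<le> D * (D * q)"
      proof -
        have "0 = (\<Sum>i\<in>Basis. (Z \<bullet> i) * (nrm x \<bullet> i))" using Zn euclidean_inner[of Z "nrm x"] by simp
        also have "\<dots> = (Z \<bullet> b) * (nrm x \<bullet> b) + (\<Sum>i\<in>Basis - {b}. (Z \<bullet> i) * (nrm x \<bullet> i))"
          using b by (intro sum.remove) auto
        finally have "\<bar>(Z \<bullet> b) * (nrm x \<bullet> b)\<bar> = \<bar>\<Sum>i\<in>Basis - {b}. (Z \<bullet> i) * (nrm x \<bullet> i)\<bar>" by linarith
        also have "\<dots> \<le> (\<Sum>i\<in>Basis - {b}. \<bar>(Z \<bullet> i) * (nrm x \<bullet> i)\<bar>)" by (rule sum_abs)
        also have "\<dots> \<le> (\<Sum>i\<in>Basis - {b}. \<bar>Z \<bullet> i\<bar> * 1)"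
          unfolding abs_mult using nb by (intro sum_mono mult_left_mono) auto
        also have "\<dots> \<le> D * q" using sumZ by simp
        finally have 1: "\<bar>Z \<bullet> b\<bar> * \<bar>nrm x \<bullet> b\<bar> \<le> D * q" by (simp add: abs_mult)
        have "\<bar>Z \<bullet> b\<bar> * (1 / D) \<le> \<bar>Z \<bullet> b\<bar> * \<bar>nrm x \<bullet> b\<bar>" using b(2) by (rule mult_left_mono) simp
        with 1 have "\<bar>Z \<bullet> b\<bar> * (1 / D) \<le> D * q" by linarith
        then show ?thesis using D by (simp add: field_simps)
      qed
      have nZ: "norm Z \<le> H * c1 * k"
      proof -
        have "norm Z \<le> (\<Sum>i\<in>Basis. \<bar>Z \<bullet> i\<bar>)" by (rule norm_le_l1)
        also have "\<dots> = \<bar>Z \<bullet> b\<bar> + (\<Sum>i\<in>Basis - {b}. \<bar>Z \<bullet> i\<bar>)" using b by (intro sum.remove) auto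
        also have "\<dots> \<le> D * (D * q) + D * q" using Zb sumZ by linarith
        also have "\<dots> \<le> D * (D * q) + D * (D * q)" using D q by (intro add_mono mult_left_mono) auto
        also have "\<dots> = H * c1 * k" by (simp add: H_def q_def power2_eq_square algebra_simps)
        finally show ?thesis .
      qed
      have Z\<epsilon>: "norm Z \<le> \<epsilon> * k"
        using nZ mult_right_mono[OF c1'(2), of k] k by linarith
      have u\<epsilon>: "u \<le> \<epsilon> * \<phi>x * k"
      proof -
        have "2 * c1 * (\<phi>x * k) \<le> \<epsilon> * (\<phi>x * k)" using c1'(1) k by (intro mult_right_mono) auto
        then show ?thesis using u unfolding P_def by (simp add: mult_ac)
      qed
      have u0: "u \<ge> 0" using u P by linarith
      show "\<exists>Z u. y = x + Z - u *\<^sub>R nrm x \<and> Z \<bullet> nrm x = 0 \<and> norm Z \<le> \<epsilon> / real n \<and> 0 \<le> u \<and> u \<le> \<epsilon> * \<phi> n x / real n"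
        using yZ Zn Z\<epsilon> u\<epsilon> u0 unfolding \<phi>x_def k_def by (intro exI[of _ Z] exI[of _ u]) auto
      show y: "y \<in> \<Omega>"
      proof -
        have "(norm Z)^2 \<le> (H * c1 * k)^2" using nZ by (intro power_mono) auto
        also have "\<dots> = (H * c1)^2 * (k * k)" by (simp add: power_mult_distrib power2_eq_square)
        also have "\<dots> \<le> \<kappa> / 4 * c1 * (\<phi>x * k)" using c1' k c1 \<kappa> by (intro mult_mono) auto
        also have "\<dots> = \<kappa> / 4 * P" by (simp add: P_def)
        also have "\<dots> \<le> \<kappa> / 4 * (\<delta>' x + u)" using u \<delta>'[of x] \<kappa> by (intro mult_left_mono) auto
        finally have Z2: "(norm Z)^2 \<le> \<kappa> / 4 * (\<delta>' x + u)" .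
        have "P \<le> c1 * \<Phi> * 1" unfolding P_def using k c1 by (intro mult_mono) auto
        then have "2 * P \<le> 2 * c1 * \<Phi>" by simp
        then have "\<delta>' x + u \<le> 7 / 4 * \<kappa>" using u c1'(3) \<delta>'[of x] by linarith
        then have "x + \<delta>' x *\<^sub>R nrm x + Z - (\<delta>' x + u) *\<^sub>R nrm x \<in> \<Omega>"
          using u0 \<delta>'[of x] by (intro region_in_\<Omega> x Zn Z2) auto
        then show ?thesis by (simp add: yZ algebra_simps)
      qed
      show "\<phi> n y \<le> C * \<phi> n x"
      proof -
        define h where "h = norm (y - x)"
        have "y - x = Z - u *\<^sub>R nrm x" by (simp add: yZ)
        then have "h \<le> norm Z + u" unfolding h_def using norm_triangle_ineq4[of Z "u *\<^sub>R nrm x"] u0 by simp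
        also have "\<dots> \<le> \<epsilon> * k + \<epsilon> * \<phi>x * k" using Z\<epsilon> u\<epsilon> by linarith
        also have "\<dots> \<le> 1 * k + 1 * \<Phi> * k" using \<epsilon> k by (intro add_mono mult_mono) auto
        finally have h: "h \<le> (1 + \<Phi>) * k" by (simp add: algebra_simps)
        have h0: "h \<ge> 0" by (simp add: h_def)
        have dW: "depth a x y = \<delta> x + u + a * h^2" by (simp add: depth_def u_def U_def h_def)
        have "u \<le> \<phi>x * \<phi>x"
        proof -
          have "\<epsilon> * \<phi>x * k \<le> 1 * \<phi>x * \<phi>x" using \<epsilon> k by (intro mult_mono) auto
          then show ?thesis using u\<epsilon> by simp
        qed
        then have su: "sqrt u \<le> \<phi>x" using k by (intro real_le_lsqrt) (auto simp: power2_eq_square u0)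
        have "sqrt (depth a x y) \<le> sqrt (\<delta> x) + sqrt u + sqrt (a * h^2)"
          unfolding dW using sqrt_add_le_add_sqrt[of "\<delta> x + u" "a * h^2"] sqrt_add_le_add_sqrt[of "\<delta> x" u] u0 aA by simp
        also have "sqrt (a * h^2) = sqrt a * h" using h0 by (simp add: real_sqrt_mult)
        finally have "sqrt (\<delta> y) \<le> sqrt (\<delta> x) + \<phi>x + sqrt a * h + Cd * h"
          using aA(5)[OF x y] su unfolding h_def by linarith
        also have "\<dots> = sqrt (\<delta> x) + \<phi>x + (sqrt a + Cd) * h" by (simp add: algebra_simps)
        also have "\<dots> \<le> sqrt (\<delta> x) + \<phi>x + (sqrt a + Cd) * ((1 + \<Phi>) * k)"
          using h aA by (intro add_left_mono mult_left_mono) auto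
        finally have "\<phi> n y \<le> 2 * \<phi>x + (sqrt a + Cd) * (1 + \<Phi>) * k"
          unfolding \<phi>_def \<phi>x_def k_def by (simp add: mult.assoc)
        also have "\<dots> \<le> 2 * \<phi>x + (sqrt a + Cd) * (1 + \<Phi>) * \<phi>x"
          using k aA \<Phi> by (intro add_left_mono mult_left_mono) auto
        finally show ?thesis by (simp add: C_def \<phi>x_def algebra_simps)
      qed
    qed
    have Um[measurable]: "U \<in> borel_measurable borel" unfolding U_def by measurable
    have Eb: "E \<in> sets borel"
    proof -
      have "closed E"
      proof -
        have "E = (\<Inter>i\<in>Basis - {b}. {y. \<bar>y \<bullet> i - x \<bullet> i\<bar> \<le> c1 * k}) \<inter> {y. P \<le> U y} \<inter> {y. U y \<le> 2 * P}"
          by (auto simp: E_def)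
        also have "closed \<dots>" unfolding U_def
          by (intro closed_Int closed_INT ballI closed_Collect_le continuous_intros)
        finally show ?thesis .
      qed
      then show ?thesis by simp
    qed
    have vol: "ennreal ((2 * c1) ^ (D - 1) * c1 * \<phi> n x / real n ^ CARD('d)) \<le> emeasure lborel E"
    proof -
      define g where "g i t = (indicator {x \<bullet> i - c1 * k .. x \<bullet> i + c1 * k} t :: ennreal)" for i t
      define G where "G z = (indicator {P .. 2 * P} (U z) :: ennreal)" for z
      have [measurable]: "g i \<in> borel_measurable borel" for i unfolding g_def by measurable
      have [measurable]: "G \<in> borel_measurable borel" unfolding G_def by measurable
      have GB: "ennreal P \<le> (\<integral>\<^sup>+t. G (z + t *\<^sub>R b) \<partial>lborel)" for z
      proof -
        define m where "m = nrm x \<bullet> b"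
        have m: "m \<noteq> 0" "\<bar>m\<bar> \<le> 1" using b D Basis_le_norm[OF b(1), of "nrm x"] by (auto simp: m_def)
        define s where "s = (U z - 3 / 2 * P) / m"
        have Uz: "U (z + t *\<^sub>R b) = U z - t * m" for t
          by (simp add: U_def m_def inner_diff_left inner_add_left inner_commute[of b])
        have "ennreal P = emeasure lborel {s - P / 2 .. s + P / 2}" using P by (subst emeasure_lborel_Icc) auto
        also have "\<dots> = (\<integral>\<^sup>+t. indicator {s - P / 2 .. s + P / 2} t \<partial>lborel)" by simp
        also have "\<dots> \<le> (\<integral>\<^sup>+t. G (z + t *\<^sub>R b) \<partial>lborel)"
        proof (rule nn_integral_mono)
          fix t
          have "U z - t * m \<in> {P .. 2 * P}" if "t \<in> {s - P / 2 .. s + P / 2}"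
          proof -
            have "\<bar>t - s\<bar> \<le> P / 2" using that unfolding atLeastAtMost_iff by linarith
            then have "\<bar>t - s\<bar> * \<bar>m\<bar> \<le> P / 2 * 1" using m P by (intro mult_mono) auto
            then have "\<bar>(t - s) * m\<bar> \<le> P / 2" by (simp add: abs_mult)
            moreover have "s * m = U z - 3 / 2 * P" using m by (simp add: s_def)
            ultimately show ?thesis unfolding atLeastAtMost_iff left_diff_distrib by linarith
          qed
          then show "indicator {s - P / 2 .. s + P / 2} t \<le> G (z + t *\<^sub>R b)"
            unfolding G_def Uz by (auto simp: indicator_def)
        qed
        finally show ?thesis .
      qed
      have "ennreal ((2 * c1) ^ (D - 1) * c1 * \<phi> n x / real n ^ CARD('d)) = ennreal ((2 * (c1 * k)) ^ (D - 1) * P)"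
      proof -
        have "real n ^ D = real n ^ (D - 1) * real n" using power_minus_mult[of D "real n"] D by simp
        then show ?thesis unfolding D_def[symmetric] P_def k_def \<phi>x_def by (simp add: power_divide power_mult_distrib mult.assoc)
      qed
      also have "\<dots> = (\<Prod>i\<in>Basis - {b}. \<integral>\<^sup>+t. g i t \<partial>lborel) * ennreal P"
      proof -
        have "(\<integral>\<^sup>+t. g i t \<partial>lborel) = ennreal (2 * (c1 * k))" for i
          unfolding g_def using c1 k by (subst nn_integral_indicator) auto
        then show ?thesis using cardB P c1 k by (subst ennreal_mult) (auto simp: ennreal_power)
      qed
      also have "\<dots> \<le> (\<integral>\<^sup>+z. (\<Prod>i\<in>Basis - {b}. g i (z \<bullet> i)) * G z \<partial>lborel)"
        by (rule nn_integral_lborel_split_bounds(2)[OF b(1) _ _ GB]) measurable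
      also have "\<dots> \<le> (\<integral>\<^sup>+z. indicator E z \<partial>lborel)"
      proof (rule nn_integral_mono)
        fix z
        show "(\<Prod>i\<in>Basis - {b}. g i (z \<bullet> i)) * G z \<le> indicator E z"
        proof (cases "z \<in> E")
          case True
          have "(\<Prod>i\<in>Basis - {b}. g i (z \<bullet> i)) \<le> (\<Prod>i\<in>Basis - {b}. 1)"
            by (intro prod_mono_ennreal) (auto simp: g_def indicator_def)
          moreover have "G z \<le> 1" by (auto simp: G_def indicator_def)
          ultimately have "(\<Prod>i\<in>Basis - {b}. g i (z \<bullet> i)) * G z \<le> 1 * 1" by (intro mult_mono) auto
          then show ?thesis using True by simp
        next
          case False
          then consider "U z \<notin> {P .. 2 * P}" | i where "i \<in> Basis - {b}" "\<not> \<bar>z \<bullet> i - x \<bullet> i\<bar> \<le> c1 * k"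
            by (auto simp: E_def)
          then show ?thesis
          proof cases
            case 1
            then show ?thesis by (simp add: G_def)
          next
            case 2
            then have "g i (z \<bullet> i) = 0" by (auto simp: g_def indicator_def abs_le_iff)
            then have "(\<Prod>i\<in>Basis - {b}. g i (z \<bullet> i)) = 0" using 2 by (intro prod_zero) auto
            then show ?thesis by (simp only: mult_zero_left zero_le)
          qed
        qed
      qed
      also have "\<dots> = emeasure lborel E" using Eb by simp
      finally show ?thesis .
    qed
    show "\<exists>E. anisotropic_box \<epsilon> ((2 * c1) ^ (D - 1) * c1) C n x E"
      using Eb Eprop vol unfolding anisotropic_box_def by (intro exI[of _ E]) auto
  qed
qed

end

section \<open>Pointwise bounds for the derivatives\<close>

locale normal_domain = ball_domain_vec \<Omega> \<kappa> "unit_outer_normal \<Omega>"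
  for \<Omega> :: "(real^'d) set" and \<kappa> :: real +
  fixes \<mu> :: real
  assumes dim: "CARD('d) \<ge> 2" and \<mu>: "\<mu> \<ge> sqrt (diameter \<Omega>) + 1"
begin

lemma \<mu>_pos: "\<mu> > 0"
  using \<mu> diameter_ge_0[OF compact_imp_bounded[OF compact]] by (smt (verit) real_sqrt_ge_zero)

lemma bdry_weight_eq: "bdry_weight (frontier \<Omega>) n x = \<phi> n x"
  by (simp add: bdry_weight_def \<phi>_def \<delta>_def)

lemma unit_orthogonal_exists: "\<exists>\<tau>::real^'d. norm \<tau> = 1 \<and> \<tau> \<bullet> v = 0"
proof -
  obtain \<tau> :: "real^'d" where "\<tau> \<noteq> 0" "orthogonal v \<tau>"
    using orthogonal_to_vector_exists[of v] dim by auto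
  then show ?thesis
    by (intro exI[of _ "\<tau> /\<^sub>R norm \<tau>"]) (auto simp: orthogonal_def inner_commute)
qed

text \<open>Makes the index set of the supremum over \<open>\<eta>\<close> nonempty: the hypothesis
  on \<open>\<mu>\<close> gives \<open>sqrt (\<delta> x) \<le> \<mu>\<close>, hence
  \<open>\<delta> x \<le> \<mu> * \<phi> n x\<close>.\<close>

lemma foot_near: "x \<in> \<Omega> \<Longrightarrow> norm (foot x - x) \<le> \<mu> * \<phi> n x"
proof -
  assume x: "x \<in> \<Omega>"
  have "\<delta> x \<le> diameter \<Omega>"
    using diameter_bounded_bound[OF compact_imp_bounded[OF compact] x, of "foot x"] foot[of x] frontier_subset by auto
  then have "sqrt (\<delta> x) \<le> \<mu>" using \<mu> real_sqrt_le_mono[of "\<delta> x" "diameter \<Omega>"] by linarith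
  then have "sqrt (\<delta> x) * sqrt (\<delta> x) \<le> \<mu> * \<phi> n x"
    using \<mu>_pos by (intro mult_mono) (auto simp: \<phi>_def)
  then show ?thesis using foot(2)[of x] by (simp add: dist_norm norm_minus_commute)
qed

text \<open>Both \<open>foot x\<close> and \<open>\<eta>\<close> are within \<open>O(\<phi>)\<close>
  of \<open>x\<close>, the former because \<open>\<delta> x\<close> is at most the supremum of
  \<open>sqrt \<delta>\<close> times \<open>\<phi>\<close>; the Lipschitz constant
  \<open>1 / \<kappa>\<close> of the normals turns this into the tilt allowed in
  \<open>polydisc\<close>.\<close>

definition L :: real where "L = (SUP x\<in>\<Omega>. sqrt (\<delta> x)) / \<kappa> + \<mu> / \<kappa>"

lemma sqrt_\<delta>_le_Sup: "x \<in> \<Omega> \<Longrightarrow> sqrt (\<delta> x) \<le> (SUP x\<in>\<Omega>. sqrt (\<delta> x))"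
proof -
  obtain A where "A > 0" "\<And>x. x \<in> \<Omega> \<Longrightarrow> \<delta> x \<le> A" by (rule \<delta>_bounded) blast
  then have "bdd_above ((\<lambda>x. sqrt (\<delta> x)) ` \<Omega>)" by (intro bdd_aboveI[of _ "sqrt A"]) auto
  then show "x \<in> \<Omega> \<Longrightarrow> sqrt (\<delta> x) \<le> (SUP x\<in>\<Omega>. sqrt (\<delta> x))" by (rule cSUP_upper[rotated])
qed

lemma L_nonneg: "L \<ge> 0"
proof -
  obtain x where "x \<in> \<Omega>" using nonempty by blast
  then have "0 \<le> (SUP x\<in>\<Omega>. sqrt (\<delta> x))"
    using sqrt_\<delta>_le_Sup[of x] real_sqrt_ge_zero[OF \<delta>_nonneg[of x]] by linarith
  then show ?thesis using \<kappa> \<mu>_pos by (simp add: L_def)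
qed

lemma tangent_nearly_tangent:
  assumes x: "x \<in> \<Omega>" and \<eta>: "\<eta> \<in> frontier \<Omega>" "norm (\<eta> - x) \<le> \<mu> * \<phi> n x"
    and \<tau>: "norm \<tau> = 1" "\<tau> \<bullet> unit_outer_normal \<Omega> \<eta> = 0"
  shows "\<bar>\<tau> \<bullet> nrm x\<bar> \<le> L * \<phi> n x"
proof -
  let ?S = "SUP x\<in>\<Omega>. sqrt (\<delta> x)"
  have "\<tau> \<bullet> nrm x = \<tau> \<bullet> (nrm x - unit_outer_normal \<Omega> \<eta>)" using \<tau> by (simp add: inner_diff_right)
  then have "\<bar>\<tau> \<bullet> nrm x\<bar> \<le> norm \<tau> * norm (nrm x - unit_outer_normal \<Omega> \<eta>)"
    by (simp only: Cauchy_Schwarz_ineq2)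
  also have "\<dots> \<le> norm (foot x - \<eta>) / \<kappa>"
    using nv_Lipschitz[OF foot(1)[of x] \<eta>(1)] \<tau> by (simp add: nrm_def)
  also have "\<dots> \<le> (?S * \<phi> n x + \<mu> * \<phi> n x) / \<kappa>"
  proof (rule divide_right_mono)
    have "sqrt (\<delta> x) * sqrt (\<delta> x) \<le> ?S * \<phi> n x"
      using sqrt_\<delta>_le_Sup[OF x] by (intro mult_mono) (auto simp: \<phi>_def intro: order_trans[rotated])
    then have "norm (x - foot x) \<le> ?S * \<phi> n x" using foot(2)[of x] by (simp add: dist_norm)
    moreover have "norm (foot x - \<eta>) \<le> norm (x - foot x) + norm (\<eta> - x)"
      using norm_triangle_ineq4[of "foot x - x" "\<eta> - x"] by (simp add: norm_minus_commute)
    ultimately show "norm (foot x - \<eta>) \<le> ?S * \<phi> n x + \<mu> * \<phi> n x" using \<eta>(2) by linarith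
  qed (use \<kappa> in simp)
  also have "\<dots> = L * \<phi> n x" using \<kappa> by (simp add: L_def field_simps)
  finally show ?thesis .
qed

definition weighted_deriv :: "nat \<Rightarrow> nat \<Rightarrow> nat \<Rightarrow> nat \<Rightarrow> (real^'d \<Rightarrow> real) \<Rightarrow> real^'d \<Rightarrow> real" where
  "weighted_deriv r j l n f = (\<lambda>x. \<phi> n x ^ j * boundary_deriv_max \<Omega> \<mu> n r (j + l) f x)"

text \<open>Cauchy radii \<open>\<epsilon> / n\<close> and \<open>\<epsilon> * \<phi> / n\<close>
  produce \<open>n ^ (r + j + l) / \<phi> ^ (j + l)\<close>; the weight cancels
  \<open>\<phi> ^ j\<close>, and \<open>1 / \<phi> \<le> n\<close> turns the remaining
  \<open>1 / \<phi> ^ l\<close> into \<open>n ^ l\<close>. The bound \<open>B\<close> concerns the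
  polydisc at \<open>x\<close> alone, so that the localised argument for finite \<open>p\<close> can
  supply it too.\<close>

lemma weighted_deriv_le:
  assumes x: "x \<in> \<Omega>" and n: "n \<ge> 1" and F: "complexifies m f F" and \<epsilon>: "\<epsilon> > 0"
    and B: "\<And>z. z \<in> polydisc L \<epsilon> n x \<Longrightarrow> norm (F z) \<le> B"
  shows "\<bar>weighted_deriv r j l n f x\<bar>
    \<le> fact r * fact (j + l) / \<epsilon> ^ (r + j + l) * real n ^ (r + j + 2 * l) * B"
proof -
  define D where "D = fact r * (fact (j + l) * B / (\<epsilon> * \<phi> n x / real n) ^ (j + l)) / (\<epsilon> / real n) ^ r"
  have pos: "\<phi> n x > 0" "real n > 0" using \<phi>_pos[OF n] n by auto
  have "norm (F (cpt x 0 0 0 0)) \<le> B" using \<epsilon> pos L_nonneg by (intro B polydiscI) auto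
  then have B0: "B \<ge> 0" by (meson norm_ge_zero order_trans)
  let ?N = "unit_outer_normal \<Omega>"
  let ?E = "{\<eta> \<in> frontier \<Omega>. norm (\<eta> - x) \<le> \<mu> * bdry_weight (frontier \<Omega>) n x}"
  have ptw: "\<bar>(dir_deriv \<tau> ^^ r) ((dir_deriv (?N \<eta>) ^^ (j + l)) f) x\<bar> \<le> D"
    if \<eta>: "\<eta> \<in> ?E" and \<tau>: "norm \<tau> = 1" "\<tau> \<bullet> ?N \<eta> = 0" for \<eta> \<tau>
    unfolding D_def
  proof (rule complexifies_Cauchy[OF F])
    fix s w :: complex assume s: "norm s \<le> \<epsilon> / real n" and w: "norm w \<le> \<epsilon> * \<phi> n x / real n"
    have "norm (F (cpt x \<tau> (?N \<eta>) s w)) \<le> B"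
      using tangent_nearly_tangent[OF x _ _ \<tau>, of n] \<eta> \<tau> s w norm_nv[of \<eta>] by (intro B polydiscI) (auto simp: bdry_weight_eq)
    then show "norm (F (\<chi> i. of_real (x $ i) + s * of_real (\<tau> $ i) + w * of_real (?N \<eta> $ i))) \<le> B"
      by (simp add: cpt_def)
  qed (use \<epsilon> pos in auto)
  \<comment> \<open>Real suprema are meaningful only over nonempty bounded sets:
    \<open>unit_orthogonal_exists\<close> here and \<open>foot_near\<close> below provide members,
    \<open>D\<close> the bound.\<close>
  have nt: "0 \<le> normal_tangential_deriv \<Omega> r (j + l) f \<eta> x \<and> normal_tangential_deriv \<Omega> r (j + l) f \<eta> x \<le> D"
    if \<eta>: "\<eta> \<in> ?E" for \<eta>
  proof
    obtain \<tau>0 :: "real^'d" where \<tau>0: "norm \<tau>0 = 1" "\<tau>0 \<bullet> ?N \<eta> = 0" using unit_orthogonal_exists by blast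
    then show "normal_tangential_deriv \<Omega> r (j + l) f \<eta> x \<le> D"
      unfolding normal_tangential_deriv_def using ptw[OF \<eta>] by (intro cSUP_least) auto
    have "0 \<le> \<bar>(dir_deriv \<tau>0 ^^ r) ((dir_deriv (?N \<eta>) ^^ (j + l)) f) x\<bar>" by simp
    also have "\<dots> \<le> normal_tangential_deriv \<Omega> r (j + l) f \<eta> x"
      unfolding normal_tangential_deriv_def
      by (rule cSUP_upper[OF _ bdd_aboveI[of _ D]]) (use \<tau>0 ptw[OF \<eta>] in auto)
    finally show "0 \<le> normal_tangential_deriv \<Omega> r (j + l) f \<eta> x" .
  qed
  have fx: "foot x \<in> ?E" using foot(1)[of x] foot_near[OF x] by (simp add: bdry_weight_eq)
  have up: "boundary_deriv_max \<Omega> \<mu> n r (j + l) f x \<le> D"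
    unfolding boundary_deriv_max_def using nt fx by (intro cSUP_least) auto
  have "normal_tangential_deriv \<Omega> r (j + l) f (foot x) x \<le> boundary_deriv_max \<Omega> \<mu> n r (j + l) f x"
    unfolding boundary_deriv_max_def
    by (rule cSUP_upper[OF fx bdd_aboveI[of _ D]]) (use nt in auto)
  then have lo: "0 \<le> boundary_deriv_max \<Omega> \<mu> n r (j + l) f x" using nt[OF fx] by linarith
  have "\<bar>weighted_deriv r j l n f x\<bar> \<le> \<phi> n x ^ j * D"
    using up lo pos by (simp add: abs_mult weighted_deriv_def)
  also have "\<dots> = fact r * fact (j + l) / \<epsilon> ^ (r + j + l) * B * real n ^ (r + j + l) * (1 / \<phi> n x) ^ l"
    unfolding D_def using pos \<epsilon> by (simp add: power_add power_divide power_mult_distrib field_simps)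
  also have "\<dots> \<le> fact r * fact (j + l) / \<epsilon> ^ (r + j + l) * B * real n ^ (r + j + l) * real n ^ l"
  proof (intro mult_left_mono power_mono)
    show "1 / \<phi> n x \<le> real n" using \<phi>_ge[of n x] pos by (simp add: field_simps)
  qed (use pos \<epsilon> B0 in auto)
  also have "\<dots> = fact r * fact (j + l) / \<epsilon> ^ (r + j + l) * real n ^ (r + j + 2 * l) * B"
  proof -
    have "real n ^ (r + j + 2 * l) = real n ^ (r + j + l) * real n ^ l"
      unfolding power_add[symmetric] by (rule arg_cong[of _ _ "power (real n)"]) simp
    then show ?thesis by (simp only: mult_ac)
  qed
  finally show ?thesis .
qed

lemma max_attained:
  assumes "complexifies m f F"
  obtains y where "y \<in> \<Omega>" "\<And>z. z \<in> \<Omega> \<Longrightarrow> \<bar>f z\<bar> \<le> \<bar>f y\<bar>"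
  using continuous_attains_sup[OF compact nonempty, of "\<lambda>z. \<bar>f z\<bar>"]
    continuous_on_rabs[OF complexifies_continuous[OF assms]] by blast

lemma uniform_bound:
  obtains C where "C > 0"
    "\<And>x n f F M. x \<in> \<Omega> \<Longrightarrow> n \<ge> 1 \<Longrightarrow> complexifies n f F \<Longrightarrow> (\<And>y. y \<in> \<Omega> \<Longrightarrow> \<bar>f y\<bar> \<le> M) \<Longrightarrow>
      \<bar>weighted_deriv r j l n f x\<bar> \<le> C * real n ^ (r + j + 2 * l) * M"
proof -
  obtain \<epsilon> C where \<epsilon>: "\<epsilon> > 0" "C \<ge> 1" and bound:
    "\<And>x n f F M z. x \<in> \<Omega> \<Longrightarrow> n \<ge> 1 \<Longrightarrow> complexifies (1 * n) f F \<Longrightarrow> (\<And>y. y \<in> \<Omega> \<Longrightarrow> \<bar>f y\<bar> \<le> M) \<Longrightarrow>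
      z \<in> polydisc L \<epsilon> n x \<Longrightarrow>
      norm (F z) \<le> C * M"
    by (rule polydisc_bound[OF L_nonneg, of 1]) blast
  define C' where "C' = fact r * fact (j + l) / \<epsilon> ^ (r + j + l) * C"
  show ?thesis
  proof (rule that[of C'])
    show "C' > 0" using \<epsilon> by (simp add: C'_def)
    fix x n f F M
    assume *: "x \<in> \<Omega>" "(n::nat) \<ge> 1" "complexifies n f F" "\<And>y. y \<in> \<Omega> \<Longrightarrow> \<bar>f y\<bar> \<le> M"
    have "\<bar>weighted_deriv r j l n f x\<bar>
      \<le> fact r * fact (j + l) / \<epsilon> ^ (r + j + l) * real n ^ (r + j + 2 * l) * (C * M)"
      using * by (intro weighted_deriv_le[OF *(1,2,3) \<epsilon>(1)] bound) auto
    then show "\<bar>weighted_deriv r j l n f x\<bar> \<le> C' * real n ^ (r + j + 2 * l) * M"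
      by (simp add: C'_def mult_ac)
  qed
qed

text \<open>The maximum point \<open>ym\<close> of the product may lie anywhere: the box around it
  carries a lower bound for the product, and the decay of \<open>b\<close> there becomes the kernel
  in \<open>\<rho> x y\<close>. Up to constants, the power of \<open>n\<close> over
  \<open>\<phi>\<close> is the reciprocal volume of the box; \<open>\<phi>\<close> is moved from
  \<open>ym\<close> to \<open>y\<close> by \<open>\<phi> n y \<le> C4 * \<phi> n ym\<close>, so that
  it later cancels against the kernel integral.\<close>

lemma pointwise_bound:
  assumes p0: "p0 > 0"
  obtains C where "C \<ge> 1"
    "\<And>x n f F q. x \<in> \<Omega> \<Longrightarrow> n \<ge> 1 \<Longrightarrow> complexifies n f F \<Longrightarrow> q \<ge> p0 \<Longrightarrow>
      ennreal (\<bar>weighted_deriv r j l n f x\<bar> powr q) \<le>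
      ennreal ((C * real n ^ (r + j + 2 * l)) powr q * C * real n ^ CARD('d)) *
        (\<integral>\<^sup>+y\<in>\<Omega>. ennreal (\<bar>f y\<bar> powr q * (1 / (1 + real n * \<rho> x y) ^ (4 * CARD('d))) / \<phi> n y) \<partial>lborel)"
proof -
  define d where "d = CARD('d)"
  \<comment> \<open>Decay of order \<open>2 * S\<close>, raised to a power
    \<open>q \<ge> p0\<close>, has order at least \<open>4 * d\<close>.\<close>
  define S where "S = nat \<lceil>2 * real d / p0\<rceil>"
  have S: "real (2 * S) * p0 \<ge> real (4 * d)"
  proof -
    have "2 * real d / p0 \<le> real S" unfolding S_def by linarith
    then show ?thesis using p0 by (simp add: field_simps)
  qed
  obtain K Cb where Cb: "Cb > 0" and bump:
    "\<And>x n. x \<in> \<Omega> \<Longrightarrow> n \<ge> 1 \<Longrightarrow> \<exists>b B. complexifies (K * n) b B \<and> b x = 1 \<and>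
      (\<forall>y\<in>\<Omega>. 0 \<le> b y \<and> b y \<le> Cb / (1 + real n * \<rho> x y) ^ (2 * S))"
    by (rule bump[of S]) blast
  obtain \<epsilon>1 C1 where \<epsilon>1: "\<epsilon>1 > 0" "C1 \<ge> 1" and bound:
    "\<And>x n f F M z. x \<in> \<Omega> \<Longrightarrow> n \<ge> 1 \<Longrightarrow> complexifies (Suc K * n) f F \<Longrightarrow> (\<And>y. y \<in> \<Omega> \<Longrightarrow> \<bar>f y\<bar> \<le> M) \<Longrightarrow>
      z \<in> polydisc L \<epsilon>1 n x \<Longrightarrow>
      norm (F z) \<le> C1 * M"
    by (rule polydisc_bound[OF L_nonneg, of "Suc K"]) blast
  \<comment> \<open>Since \<open>\<bar>b\<bar> \<le> Cb\<close> on \<open>\<Omega>\<close> and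
    \<open>b x = 1\<close>, this oscillation keeps the extension of \<open>b\<close> at modulus at
    least \<open>1 / 2\<close> on the polydisc, so a bound for the product yields one for
    \<open>F\<close>.\<close>
  have "1 / (2 * Cb) > 0" using Cb by simp
  then obtain \<epsilon>2 where \<epsilon>2: "\<epsilon>2 > 0" and osc_b:
    "\<And>x n f F M z. x \<in> \<Omega> \<Longrightarrow> n \<ge> 1 \<Longrightarrow> complexifies (K * n) f F \<Longrightarrow> (\<And>y. y \<in> \<Omega> \<Longrightarrow> \<bar>f y\<bar> \<le> M) \<Longrightarrow>
      z \<in> polydisc L \<epsilon>2 n x \<Longrightarrow>
      norm (F z - of_real (f x)) \<le> 1 / (2 * Cb) * M"
    by (rule polydisc_oscillation[OF L_nonneg, of _ K]) blast
  have half: "(0::real) < 1 / 2" by simp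
  obtain \<epsilon>3 where \<epsilon>3: "\<epsilon>3 > 0" and osc_g:
    "\<And>x n f F M z. x \<in> \<Omega> \<Longrightarrow> n \<ge> 1 \<Longrightarrow> complexifies (Suc K * n) f F \<Longrightarrow> (\<And>y. y \<in> \<Omega> \<Longrightarrow> \<bar>f y\<bar> \<le> M) \<Longrightarrow>
      z \<in> polydisc 0 \<epsilon>3 n x \<Longrightarrow>
      norm (F z - of_real (f x)) \<le> 1 / 2 * M"
    by (rule polydisc_oscillation[of 0 "1 / 2" "Suc K", OF order_refl half]) blast
  define \<epsilon>3' where "\<epsilon>3' = min \<epsilon>3 1"
  have "0 < \<epsilon>3'" "\<epsilon>3' \<le> 1" using \<epsilon>3 by (auto simp: \<epsilon>3'_def)
  then obtain c C4 where c: "c > 0" "C4 > 0" and box: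
    "\<And>x n. x \<in> \<Omega> \<Longrightarrow> n \<ge> 1 \<Longrightarrow> \<exists>E. anisotropic_box \<epsilon>3' c C4 n x E"
    by (rule anisotropic_box_exists) blast
  define \<epsilon> where "\<epsilon> = min \<epsilon>1 \<epsilon>2"
  have \<epsilon>: "\<epsilon> > 0" "\<epsilon> \<le> \<epsilon>1" "\<epsilon> \<le> \<epsilon>2" using \<epsilon>1 \<epsilon>2 by (auto simp: \<epsilon>_def)
  define C5 where "C5 = fact r * fact (j + l) / \<epsilon> ^ (r + j + l) * (2 * C1) * (2 * Cb)"
  define C where "C = max 1 (max C5 (C4 / c))"
  show ?thesis
  proof (rule that[of C])
    show "C \<ge> 1" by (simp add: C_def)
    fix x :: "real^'d" and n and f :: "real^'d \<Rightarrow> real" and F q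
    assume x: "x \<in> \<Omega>" and n: "(n::nat) \<ge> 1" and F: "complexifies n f F" and q: "q \<ge> p0"
    obtain b Bc where b: "complexifies (K * n) b Bc" "b x = 1"
      "\<And>y. y \<in> \<Omega> \<Longrightarrow> 0 \<le> b y" "\<And>y. y \<in> \<Omega> \<Longrightarrow> b y \<le> Cb / (1 + real n * \<rho> x y) ^ (2 * S)"
      using bump[OF x n] by blast
    define g where "g y = f y * b y" for y
    define G where "G z = F z * Bc z" for z
    have G: "complexifies (Suc K * n) g G"
      using complexifies_mult[OF F b(1)] by (simp add: g_def[abs_def] G_def[abs_def])
    obtain ym where ym: "ym \<in> \<Omega>" "\<And>z. z \<in> \<Omega> \<Longrightarrow> \<bar>g z\<bar> \<le> \<bar>g ym\<bar>"
      by (rule max_attained[OF G]) blast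
    define M where "M = \<bar>g ym\<bar>"
    have M0: "M \<ge> 0" by (simp add: M_def)
    have q0: "q > 0" using p0 q by linarith
    have bCb: "\<bar>b y\<bar> \<le> Cb" if "y \<in> \<Omega>" for y
    proof -
      define X where "X = (1 + real n * \<rho> x y) ^ (2 * S)"
      have "1 \<le> X" unfolding X_def by (rule one_le_power) simp
      then have "Cb / X \<le> Cb / 1" using Cb by (intro divide_left_mono) auto
      then have "Cb / (1 + real n * \<rho> x y) ^ (2 * S) \<le> Cb" by (simp add: X_def)
      then show ?thesis using b(3,4)[OF that] by simp
    qed
    have "\<bar>weighted_deriv r j l n f x\<bar>
        \<le> fact r * fact (j + l) / \<epsilon> ^ (r + j + l) * real n ^ (r + j + 2 * l) * (2 * C1 * M)"
    proof (rule weighted_deriv_le[OF x n F \<epsilon>(1)])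
      fix z assume z: "z \<in> polydisc L \<epsilon> n x"
      have mono: "z \<in> polydisc L e n x" if "\<epsilon> \<le> e" for e
      proof -
        have "\<epsilon> / real n \<le> e / real n" "\<epsilon> * \<phi> n x / real n \<le> e * \<phi> n x / real n"
          using that \<phi>_pos[OF n, of x] by (auto intro!: divide_right_mono mult_right_mono)
        with z show ?thesis unfolding polydisc_def by (blast intro: order_trans)
      qed
      have "norm (Bc z - of_real (b x)) \<le> 1 / (2 * Cb) * Cb"
        by (rule osc_b[OF x n b(1) bCb mono]) (use \<epsilon> in auto)
      then have "norm (Bc z - 1) \<le> 1 / 2" using Cb b(2) by simp
      then have Bc: "norm (Bc z) \<ge> 1 / 2"
        using norm_triangle_ineq2[of 1 "1 - Bc z"] by (simp add: norm_minus_commute)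
      have "norm (G z) \<le> C1 * M"
        by (rule bound[OF x n G _ mono]) (use \<epsilon> ym in \<open>auto simp: M_def\<close>)
      moreover have "norm (F z) * (1 / 2) \<le> norm (G z)"
        unfolding G_def norm_mult using Bc by (intro mult_left_mono) auto
      ultimately show "norm (F z) \<le> 2 * C1 * M" by linarith
    qed
    \<comment> \<open>\<open>M / (2 * Cb)\<close> is split off because on the box it is at most
      \<open>\<bar>f y\<bar>\<close> times the decay factor.\<close>
    also have "\<dots> = C5 * real n ^ (r + j + 2 * l) * (M / (2 * Cb))"
      using Cb by (simp add: C5_def)
    also have "\<dots> \<le> C * real n ^ (r + j + 2 * l) * (M / (2 * Cb))"
      using M0 Cb by (intro mult_right_mono) (auto simp: C_def)
    finally have "\<bar>weighted_deriv r j l n f x\<bar> powr q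
        \<le> (C * real n ^ (r + j + 2 * l) * (M / (2 * Cb))) powr q"
      using q0 by (intro powr_mono2) auto
    also have "\<dots> = (C * real n ^ (r + j + 2 * l)) powr q * (M / (2 * Cb)) powr q"
      by (rule powr_mult)
    finally have T: "ennreal (\<bar>weighted_deriv r j l n f x\<bar> powr q)
        \<le> ennreal ((C * real n ^ (r + j + 2 * l)) powr q) * ennreal ((M / (2 * Cb)) powr q)"
      by (subst ennreal_mult[symmetric]) (auto intro: ennreal_leI)
    obtain E where E: "E \<in> sets borel" "E \<subseteq> \<Omega>" "ennreal (c * \<phi> n ym / real n ^ CARD('d)) \<le> emeasure lborel E"
      "\<And>y. y \<in> E \<Longrightarrow> \<phi> n y \<le> C4 * \<phi> n ym"
      "\<And>y. y \<in> E \<Longrightarrow> \<exists>Z u. y = ym + Z - u *\<^sub>R nrm ym \<and> Z \<bullet> nrm ym = 0 \<and> norm Z \<le> \<epsilon>3' / real n \<and> 0 \<le> u \<and> u \<le> \<epsilon>3' * \<phi> n ym / real n"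
      using box[OF ym(1) n] unfolding anisotropic_box_def by blast
    \<comment> \<open>The box lies in the oscillation polydisc at \<open>ym\<close>, where the
      product changes by at most half of its maximum. For \<open>Z = 0\<close> the direction
      \<open>sgn Z\<close> is 0, which \<open>polydisc\<close> admits.\<close>
    have gE: "M / 2 \<le> \<bar>g y\<bar>" if y: "y \<in> E" for y
    proof -
      obtain Z u where Z: "y = ym + Z - u *\<^sub>R nrm ym" "Z \<bullet> nrm ym = 0" "norm Z \<le> \<epsilon>3' / real n"
        "0 \<le> u" "u \<le> \<epsilon>3' * \<phi> n ym / real n" using E(5)[OF y] by blast
      have e3: "\<epsilon>3' / real n \<le> \<epsilon>3 / real n" "\<epsilon>3' * \<phi> n ym / real n \<le> \<epsilon>3 * \<phi> n ym / real n"
        using \<phi>_pos[OF n, of ym] by (auto intro!: divide_right_mono mult_right_mono simp: \<epsilon>3'_def)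
      have "norm (G (cpt ym (sgn Z) (- nrm ym) (of_real (norm Z)) (of_real u)) - of_real (g ym)) \<le> 1 / 2 * M"
      proof (rule osc_g[OF ym(1) n G _ polydiscI])
        show "\<bar>sgn Z \<bullet> nrm ym\<bar> \<le> 0 * \<phi> n ym" using Z(2) by (simp add: sgn_div_norm)
      qed (use ym Z e3 in \<open>auto simp: M_def norm_sgn\<close>)
      moreover have "cpt ym (sgn Z) (- nrm ym) (of_real (norm Z)) (of_real u) = cvec y"
      proof -
        have "norm Z *\<^sub>R sgn Z = Z" by (cases "Z = 0") (auto simp: sgn_div_norm)
        then have "norm Z * sgn Z $ i = Z $ i" for i by (metis real_scaleR_def vector_scaleR_component)
        then have "complex_of_real (norm Z) * complex_of_real (sgn Z $ i) = complex_of_real (Z $ i)" for i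
          by (simp flip: of_real_mult)
        then show ?thesis by (simp add: cpt_def vec_eq_iff Z(1))
      qed
      ultimately have "norm (complex_of_real (g y) - of_real (g ym)) \<le> 1 / 2 * M"
        by (simp only: complexifies_cvec[OF G])
      then have "\<bar>g y - g ym\<bar> \<le> 1 / 2 * M" by (simp only: of_real_diff[symmetric] norm_of_real real_norm_def)
      then show ?thesis unfolding M_def by linarith
    qed
    define k where "k y = \<bar>f y\<bar> powr q * (1 / (1 + real n * \<rho> x y) ^ (4 * d)) / \<phi> n y" for y
    have \<phi>m: "\<phi> n ym > 0" by (rule \<phi>_pos[OF n])
    have kE: "(M / (2 * Cb)) powr q \<le> C4 * \<phi> n ym * k y" if y: "y \<in> E" for y
    proof -
      have y\<Omega>: "y \<in> \<Omega>" using y E(2) by blast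
      define t where "t = 1 + real n * \<rho> x y"
      have t: "t \<ge> 1" by (simp add: t_def)
      define T where "T = t ^ (2 * S)"
      have "M / 2 \<le> \<bar>f y\<bar> * b y" using gE[OF y] b(3)[OF y\<Omega>] by (simp add: g_def abs_mult)
      also have "\<dots> \<le> \<bar>f y\<bar> * (Cb / T)"
        using b(4)[OF y\<Omega>] unfolding T_def t_def by (rule mult_left_mono) simp
      finally have "M / 2 / Cb \<le> \<bar>f y\<bar> * (Cb / T) / Cb" using Cb by (intro divide_right_mono) auto
      then have "M / (2 * Cb) \<le> \<bar>f y\<bar> * (1 / t ^ (2 * S))" using Cb by (simp add: T_def)
      then have "(M / (2 * Cb)) powr q \<le> (\<bar>f y\<bar> * (1 / t ^ (2 * S))) powr q"
        using M0 Cb q0 by (intro powr_mono2) auto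
      also have "\<dots> = \<bar>f y\<bar> powr q * (1 / t ^ (2 * S)) powr q" by (rule powr_mult)
      also have "\<dots> \<le> \<bar>f y\<bar> powr q * (1 / t ^ (4 * d))"
      proof (rule mult_left_mono)
        have "t ^ (4 * d) = t powr real (4 * d)" by (rule powr_realpow[symmetric]) (use t in simp)
        also have "\<dots> \<le> t powr (real (2 * S) * q)"
        proof (rule powr_mono)
          have "real (2 * S) * p0 \<le> real (2 * S) * q" using q by (intro mult_left_mono) auto
          then show "real (4 * d) \<le> real (2 * S) * q" using S by linarith
        qed (rule t)
        also have "\<dots> = (t ^ (2 * S)) powr q"
          unfolding powr_powr[symmetric] by (subst powr_realpow) (use t in auto)
        finally have "1 / (t ^ (2 * S)) powr q \<le> 1 / t ^ (4 * d)"
          using t by (intro divide_left_mono mult_pos_pos) auto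
        then show "(1 / t ^ (2 * S)) powr q \<le> 1 / t ^ (4 * d)" using t by (simp add: powr_divide)
      qed simp
      also have "\<dots> = \<phi> n y * k y" using \<phi>_pos[OF n, of y] by (simp add: k_def t_def)
      also have "\<dots> \<le> C4 * \<phi> n ym * k y"
        using E(4)[OF y] \<phi>_pos[OF n, of y] t by (intro mult_right_mono) (auto simp: k_def t_def)
      finally show ?thesis .
    qed
    have km[measurable]: "k \<in> borel_measurable borel"
    proof -
      have [measurable]: "f \<in> borel_measurable borel" "\<delta> \<in> borel_measurable borel"
        using complexifies_continuous[OF F] continuous_\<delta> by (auto intro: borel_measurable_continuous_onI)
      show ?thesis unfolding k_def \<rho>_def \<phi>_def by measurable
    qed
    have Em[measurable]: "E \<in> sets lborel" using E(1) by simp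
    define I where "I = (\<integral>\<^sup>+y\<in>\<Omega>. ennreal (k y) \<partial>lborel)"
    have "ennreal ((M / (2 * Cb)) powr q) * ennreal (c * \<phi> n ym / real n ^ d) \<le> ennreal ((M / (2 * Cb)) powr q) * emeasure lborel E"
      using E(3) by (intro mult_left_mono) (auto simp: d_def)
    also have "\<dots> = (\<integral>\<^sup>+y. ennreal ((M / (2 * Cb)) powr q) * indicator E y \<partial>lborel)"
      by (rule nn_integral_cmult_indicator[symmetric]) measurable
    also have "\<dots> \<le> (\<integral>\<^sup>+y. ennreal (C4 * \<phi> n ym) * (ennreal (k y) * indicator \<Omega> y) \<partial>lborel)"
    proof (rule nn_integral_mono)
      fix y
      have k0: "k y \<ge> 0" using \<phi>_pos[OF n, of y] by (simp add: k_def)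
      show "ennreal ((M / (2 * Cb)) powr q) * indicator E y \<le> ennreal (C4 * \<phi> n ym) * (ennreal (k y) * indicator \<Omega> y)"
      proof (cases "y \<in> E")
        case True
        then have "ennreal ((M / (2 * Cb)) powr q) \<le> ennreal (C4 * \<phi> n ym * k y)" by (intro ennreal_leI kE)
        also have "\<dots> = ennreal (C4 * \<phi> n ym) * ennreal (k y)" using c \<phi>m k0 by (intro ennreal_mult) auto
        finally show ?thesis using True E(2) by (auto simp: subset_iff)
      qed auto
    qed
    also have "\<dots> = ennreal (C4 * \<phi> n ym) * I"
      unfolding I_def using closed_\<Omega> by (intro nn_integral_cmult) measurable
    finally have main: "ennreal ((M / (2 * Cb)) powr q) * ennreal (c * \<phi> n ym / real n ^ d) \<le> ennreal (C4 * \<phi> n ym) * I" .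
    have "ennreal ((M / (2 * Cb)) powr q) \<le> ennreal (C * real n ^ d) * I"
    proof -
      \<comment> \<open>\<open>I\<close> may be infinite, so the finite positive factor is removed
        by multiplying with its real reciprocal.\<close>
      define h where "h = real n ^ d / (c * \<phi> n ym)"
      have h: "h > 0" "c * \<phi> n ym / real n ^ d * h = 1" using n c \<phi>m by (auto simp: h_def)
      have "ennreal ((M / (2 * Cb)) powr q) = ennreal ((M / (2 * Cb)) powr q * (c * \<phi> n ym / real n ^ d)) * ennreal h"
        using h c \<phi>m by (subst ennreal_mult[symmetric]) (auto simp: mult.assoc)
      also have "\<dots> = ennreal ((M / (2 * Cb)) powr q) * ennreal (c * \<phi> n ym / real n ^ d) * ennreal h"
        using c \<phi>m by (subst ennreal_mult) auto
      also have "\<dots> \<le> ennreal (C4 * \<phi> n ym) * I * ennreal h" using main by (rule mult_right_mono) simp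
      also have "\<dots> = ennreal (C4 * \<phi> n ym * h) * I"
        using c \<phi>m h by (subst ennreal_mult) (auto simp: mult_ac)
      also have "C4 * \<phi> n ym * h = C4 / c * real n ^ d" using c \<phi>m by (simp add: h_def)
      also have "ennreal (C4 / c * real n ^ d) * I \<le> ennreal (C * real n ^ d) * I"
        by (intro mult_right_mono ennreal_leI) (auto simp: C_def)
      finally show ?thesis .
    qed
    then have "ennreal (\<bar>weighted_deriv r j l n f x\<bar> powr q)
        \<le> ennreal ((C * real n ^ (r + j + 2 * l)) powr q) * (ennreal (C * real n ^ d) * I)"
      by (intro order_trans[OF T] mult_left_mono) auto
    also have "\<dots> = ennreal ((C * real n ^ (r + j + 2 * l)) powr q * C * real n ^ d) * I"
      unfolding mult.assoc[symmetric] by (subst ennreal_mult[symmetric]) (auto simp: C_def mult.assoc)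
    finally show "ennreal (\<bar>weighted_deriv r j l n f x\<bar> powr q) \<le>
      ennreal ((C * real n ^ (r + j + 2 * l)) powr q * C * real n ^ CARD('d)) *
        (\<integral>\<^sup>+y\<in>\<Omega>. ennreal (\<bar>f y\<bar> powr q * (1 / (1 + real n * \<rho> x y) ^ (4 * CARD('d))) / \<phi> n y) \<partial>lborel)"
      by (simp only: I_def k_def d_def)
  qed
qed

end

section \<open>The norm inequality\<close>

context normal_domain
begin

text \<open>When the pointwise bound is integrated in \<open>x\<close> first, the kernel gives
  \<open>C2 * \<phi> n y\<close> over a power of \<open>n\<close>, and both cancel against the
  weight \<open>1 / \<phi> n y\<close> and the power of \<open>n\<close> in that bound.\<close>

lemma integral_bound:
  assumes p0: "p0 > 0"
  obtains C where "C \<ge> 1"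
    "\<And>n f F q. n \<ge> 1 \<Longrightarrow> complexifies n f F \<Longrightarrow> q \<ge> p0 \<Longrightarrow>
      (\<integral>\<^sup>+x\<in>\<Omega>. ennreal (\<bar>weighted_deriv r j l n f x\<bar> powr q) \<partial>lebesgue) \<le>
      ennreal ((C * real n ^ (r + j + 2 * l)) powr q * C) * (\<integral>\<^sup>+x\<in>\<Omega>. ennreal (\<bar>f x\<bar> powr q) \<partial>lebesgue)"
proof -
  obtain C1 where C1: "C1 \<ge> 1" and pointwise:
    "\<And>x n f F q. x \<in> \<Omega> \<Longrightarrow> n \<ge> 1 \<Longrightarrow> complexifies n f F \<Longrightarrow> q \<ge> p0 \<Longrightarrow>
      ennreal (\<bar>weighted_deriv r j l n f x\<bar> powr q) \<le>
      ennreal ((C1 * real n ^ (r + j + 2 * l)) powr q * C1 * real n ^ CARD('d)) *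
        (\<integral>\<^sup>+y\<in>\<Omega>. ennreal (\<bar>f y\<bar> powr q * (1 / (1 + real n * \<rho> x y) ^ (4 * CARD('d))) / \<phi> n y) \<partial>lborel)"
    by (rule pointwise_bound[OF p0, of r j l]) blast
  obtain C2 where C2: "C2 > 0" and kernel:
    "\<And>y n. y \<in> \<Omega> \<Longrightarrow> n \<ge> 1 \<Longrightarrow>
      (\<integral>\<^sup>+x\<in>\<Omega>. ennreal (1 / (1 + real n * \<rho> x y) ^ (4 * CARD('d))) \<partial>lborel) \<le> ennreal (C2 * \<phi> n y / real n ^ CARD('d))"
    by (rule kernel_integral) blast
  define C where "C = max C1 (C1 * C2)"
  show ?thesis
  proof (rule that[of C])
    show "C \<ge> 1" using C1 by (simp add: C_def)
    fix n and f :: "real^'d \<Rightarrow> real" and F q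
    assume n: "(n::nat) \<ge> 1" and F: "complexifies n f F" and q: "q \<ge> p0"
    define A where "A = (C1 * real n ^ (r + j + 2 * l)) powr q * C1 * real n ^ CARD('d)"
    define w where "w x y = 1 / (1 + real n * \<rho> x y) ^ (4 * CARD('d))" for x y
    define g where "g y = \<bar>f y\<bar> powr q / \<phi> n y" for y
    have [measurable]: "f \<in> borel_measurable borel" "\<delta> \<in> borel_measurable borel" "\<Omega> \<in> sets borel"
      using complexifies_continuous[OF F] continuous_\<delta> closed_\<Omega> by (auto intro: borel_measurable_continuous_onI)
    have A0: "A \<ge> 0" using C1 by (simp add: A_def)
    have w0: "w x y \<ge> 0" for x y by (simp add: w_def)
    have g0: "g y \<ge> 0" for y using \<phi>_pos[OF n, of y] by (simp add: g_def)
    have gm[measurable]: "g \<in> borel_measurable borel" unfolding g_def \<phi>_def by measurable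
    have wm[measurable]: "(\<lambda>(x, y). w x y) \<in> borel_measurable (borel \<Otimes>\<^sub>M borel)" unfolding w_def \<rho>_def by measurable
    have "(\<integral>\<^sup>+x\<in>\<Omega>. ennreal (\<bar>weighted_deriv r j l n f x\<bar> powr q) \<partial>lebesgue)
        \<le> (\<integral>\<^sup>+x. ennreal A * (\<integral>\<^sup>+y. ennreal (g y) * ennreal (w x y) * indicator \<Omega> y * indicator \<Omega> x \<partial>lborel) \<partial>lebesgue)"
    \<comment> \<open>The integrand on the left contains a supremum of unknown measurability; the
      pointwise comparison replaces it by a Borel function before Tonelli's theorem is used.\<close>
    proof (rule nn_integral_mono)
      fix x
      show "ennreal (\<bar>weighted_deriv r j l n f x\<bar> powr q) * indicator \<Omega> x
        \<le> ennreal A * (\<integral>\<^sup>+y. ennreal (g y) * ennreal (w x y) * indicator \<Omega> y * indicator \<Omega> x \<partial>lborel)"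
      proof (cases "x \<in> \<Omega>")
        case True
        have "(\<integral>\<^sup>+y\<in>\<Omega>. ennreal (\<bar>f y\<bar> powr q * w x y / \<phi> n y) \<partial>lborel)
          = (\<integral>\<^sup>+y. ennreal (g y) * ennreal (w x y) * indicator \<Omega> y * indicator \<Omega> x \<partial>lborel)"
          using True w0 g0 by (intro nn_integral_cong) (simp add: ennreal_mult[symmetric] g_def mult_ac)
        then show ?thesis using pointwise[OF True n F q] True by (simp add: A_def w_def)
      qed simp
    qed
    also have "\<dots> = (\<integral>\<^sup>+x. ennreal A * (\<integral>\<^sup>+y. ennreal (g y) * ennreal (w x y) * indicator \<Omega> y * indicator \<Omega> x \<partial>lborel) \<partial>lborel)"
      by (rule nn_integral_completion)
    also have "\<dots> = ennreal A * (\<integral>\<^sup>+x. (\<integral>\<^sup>+y. ennreal (g y) * ennreal (w x y) * indicator \<Omega> y * indicator \<Omega> x \<partial>lborel) \<partial>lborel)"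
      by (rule nn_integral_cmult) measurable
    also have "(\<integral>\<^sup>+x. (\<integral>\<^sup>+y. ennreal (g y) * ennreal (w x y) * indicator \<Omega> y * indicator \<Omega> x \<partial>lborel) \<partial>lborel)
       = (\<integral>\<^sup>+y. (\<integral>\<^sup>+x. ennreal (g y) * ennreal (w x y) * indicator \<Omega> y * indicator \<Omega> x \<partial>lborel) \<partial>lborel)"
      by (rule lborel_pair.Fubini'[symmetric]) measurable
    also have "ennreal A * \<dots> \<le> ennreal A * (\<integral>\<^sup>+y. ennreal (C2 / real n ^ CARD('d)) * (ennreal (\<bar>f y\<bar> powr q) * indicator \<Omega> y) \<partial>lborel)"
    proof (intro mult_left_mono nn_integral_mono)
      fix y
      show "(\<integral>\<^sup>+x. ennreal (g y) * ennreal (w x y) * indicator \<Omega> y * indicator \<Omega> x \<partial>lborel)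
        \<le> ennreal (C2 / real n ^ CARD('d)) * (ennreal (\<bar>f y\<bar> powr q) * indicator \<Omega> y)"
      proof (cases "y \<in> \<Omega>")
        case True
        have "(\<integral>\<^sup>+x. ennreal (g y) * ennreal (w x y) * indicator \<Omega> y * indicator \<Omega> x \<partial>lborel)
          = (\<integral>\<^sup>+x. ennreal (g y) * (ennreal (w x y) * indicator \<Omega> x) \<partial>lborel)"
          using True by (simp add: mult.assoc)
        also have "\<dots> = ennreal (g y) * (\<integral>\<^sup>+x\<in>\<Omega>. ennreal (w x y) \<partial>lborel)"
          by (rule nn_integral_cmult) measurable
        also have "\<dots> \<le> ennreal (g y) * ennreal (C2 * \<phi> n y / real n ^ CARD('d))"
          unfolding w_def by (intro mult_left_mono kernel True n) simp
        also have "\<dots> = ennreal (g y * (C2 * \<phi> n y / real n ^ CARD('d)))"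
          using g0 C2 \<phi>_pos[OF n, of y] by (intro ennreal_mult[symmetric]) auto
        also have "g y * (C2 * \<phi> n y / real n ^ CARD('d)) = C2 / real n ^ CARD('d) * \<bar>f y\<bar> powr q"
          using \<phi>_pos[OF n, of y] by (simp add: g_def)
        also have "ennreal \<dots> = ennreal (C2 / real n ^ CARD('d)) * ennreal (\<bar>f y\<bar> powr q)"
          using C2 by (intro ennreal_mult) auto
        finally show ?thesis using True by simp
      qed simp
    qed simp
    also have "\<dots> = ennreal A * (ennreal (C2 / real n ^ CARD('d)) * (\<integral>\<^sup>+y\<in>\<Omega>. ennreal (\<bar>f y\<bar> powr q) \<partial>lborel))"
      by (subst nn_integral_cmult) (auto intro!: borel_measurable_times_ennreal)
    also have "\<dots> = ennreal (A * (C2 / real n ^ CARD('d))) * (\<integral>\<^sup>+y\<in>\<Omega>. ennreal (\<bar>f y\<bar> powr q) \<partial>lborel)"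
      unfolding mult.assoc[symmetric] using A0 C2 by (subst ennreal_mult[symmetric]) auto
    also have "A * (C2 / real n ^ CARD('d)) = (C1 * real n ^ (r + j + 2 * l)) powr q * (C1 * C2)"
      using n by (simp add: A_def)
    also have "ennreal \<dots> * (\<integral>\<^sup>+y\<in>\<Omega>. ennreal (\<bar>f y\<bar> powr q) \<partial>lborel)
      \<le> ennreal ((C * real n ^ (r + j + 2 * l)) powr q * C) * (\<integral>\<^sup>+y\<in>\<Omega>. ennreal (\<bar>f y\<bar> powr q) \<partial>lborel)"
      using C1 C2 p0 q by (intro mult_right_mono ennreal_leI mult_mono powr_mono2) (auto simp: C_def)
    also have "(\<integral>\<^sup>+y\<in>\<Omega>. ennreal (\<bar>f y\<bar> powr q) \<partial>lborel) = (\<integral>\<^sup>+y\<in>\<Omega>. ennreal (\<bar>f y\<bar> powr q) \<partial>lebesgue)"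
      by (rule nn_integral_completion[symmetric])
    finally show "(\<integral>\<^sup>+x\<in>\<Omega>. ennreal (\<bar>weighted_deriv r j l n f x\<bar> powr q) \<partial>lebesgue) \<le>
      ennreal ((C * real n ^ (r + j + 2 * l)) powr q * C) * (\<integral>\<^sup>+x\<in>\<Omega>. ennreal (\<bar>f x\<bar> powr q) \<partial>lebesgue)" .
  qed
qed

end

section \<open>Passage to the quasi-norms\<close>

lemma le_enn2real: "p \<noteq> \<infinity> \<Longrightarrow> ennreal a \<le> p \<Longrightarrow> a \<le> enn2real p"
  by (cases p) (auto simp: ennreal_le_iff2)

text \<open>The \<open>q\<close>-th root keeps \<open>K\<close> and turns \<open>C\<close> into
  \<open>C powr (1 / q)\<close>, which \<open>C \<ge> 1\<close> and \<open>q \<ge> p0\<close> bound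
  by \<open>C powr (1 / p0)\<close>: hence a constant uniform in \<open>p\<close>. If the integral
  of \<open>f\<close> is infinite, so is the right side.\<close>

lemma Lp_norm_le_of_integral_le:
  fixes \<Omega> :: "'a::euclidean_space set"
  assumes p: "p \<noteq> \<infinity>" "p \<ge> ennreal p0" "p0 > 0" and C: "C \<ge> 1" and K: "K > 0"
    and le: "(\<integral>\<^sup>+x\<in>\<Omega>. ennreal (\<bar>g x\<bar> powr enn2real p) \<partial>lebesgue) \<le>
      ennreal (K powr enn2real p * C) * (\<integral>\<^sup>+x\<in>\<Omega>. ennreal (\<bar>f x\<bar> powr enn2real p) \<partial>lebesgue)"
  shows "Lp_norm p \<Omega> g \<le> ennreal (C powr (1 / p0) * K) * Lp_norm p \<Omega> f"
proof -
  define q where "q = enn2real p"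
  have q: "q \<ge> p0" "q > 0" using le_enn2real[OF p(1,2)] p(3) by (simp_all add: q_def)
  define I J where "I = (\<integral>\<^sup>+x\<in>\<Omega>. ennreal (\<bar>g x\<bar> powr q) \<partial>lebesgue)"
    and "J = (\<integral>\<^sup>+x\<in>\<Omega>. ennreal (\<bar>f x\<bar> powr q) \<partial>lebesgue)"
  have IJ: "I \<le> ennreal (K powr q * C) * J" using le by (simp add: I_def J_def q_def)
  have c: "C powr (1 / p0) * K > 0" using C K by simp
  show ?thesis
  proof (cases "J = \<infinity>")
    case True
    then have "Lp_norm p \<Omega> f = \<infinity>" using p by (simp add: Lp_norm_def J_def q_def Let_def)
    then show ?thesis using C K by (simp add: ennreal_mult_top)
  next
    case False
    then have fin: "ennreal (K powr q * C) * J < \<infinity>" by (simp add: ennreal_mult_less_top less_top)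
    then have I: "I \<noteq> \<infinity>" using IJ by auto
    have "enn2real I \<le> enn2real (ennreal (K powr q * C) * J)" using IJ fin by (intro enn2real_mono) auto
    also have "\<dots> = K powr q * C * enn2real J" using C by (simp add: enn2real_mult)
    finally have "enn2real I powr (1 / q) \<le> (K powr q * C * enn2real J) powr (1 / q)"
      using q by (intro powr_mono2) auto
    also have "\<dots> = K * C powr (1 / q) * enn2real J powr (1 / q)"
      using q K by (simp add: powr_mult powr_powr)
    also have "\<dots> \<le> K * C powr (1 / p0) * enn2real J powr (1 / q)"
      using q p C K by (intro mult_right_mono mult_left_mono powr_mono divide_left_mono) auto
    finally have *: "enn2real I powr (1 / q) \<le> C powr (1 / p0) * K * enn2real J powr (1 / q)" by (simp add: mult_ac)
    have "Lp_norm p \<Omega> g = ennreal (enn2real I powr (1 / q))"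
      using p I by (simp add: Lp_norm_def I_def q_def Let_def)
    also have "\<dots> \<le> ennreal (C powr (1 / p0) * K * enn2real J powr (1 / q))" by (rule ennreal_leI[OF *])
    also have "\<dots> = ennreal (C powr (1 / p0) * K) * ennreal (enn2real J powr (1 / q))"
      using c by (intro ennreal_mult) auto
    also have "ennreal (enn2real J powr (1 / q)) = Lp_norm p \<Omega> f"
      using p False by (simp add: Lp_norm_def J_def q_def Let_def)
    finally show ?thesis .
  qed
qed

lemma C2_domain_normal_domain:
  fixes \<Omega> :: "(real^'d) set"
  assumes "CARD('d) \<ge> 2" "compact \<Omega>" "C2_domain \<Omega>" "\<mu> \<ge> sqrt (diameter \<Omega>) + 1" "\<Omega> \<noteq> {}"
  obtains \<kappa> where "normal_domain \<Omega> \<kappa> \<mu>"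
proof -
  obtain \<kappa> where \<kappa>: "\<kappa> > 0" and v: "\<And>x. x \<in> frontier \<Omega> \<Longrightarrow> \<exists>v. is_unit_outer_normal \<Omega> x v \<and>
      ball (x - \<kappa> *\<^sub>R v) \<kappa> \<subseteq> \<Omega> \<and> ball (x + \<kappa> *\<^sub>R v) \<kappa> \<subseteq> - \<Omega>"
    using assms(3) unfolding C2_domain_def by blast
  have uon: "norm (unit_outer_normal \<Omega> x) = 1 \<and> ball (x - \<kappa> *\<^sub>R unit_outer_normal \<Omega> x) \<kappa> \<subseteq> \<Omega> \<and>
      ball (x + \<kappa> *\<^sub>R unit_outer_normal \<Omega> x) \<kappa> \<subseteq> - \<Omega>" if x: "x \<in> frontier \<Omega>" for x
  proof -
    obtain v where v: "is_unit_outer_normal \<Omega> x v" "ball (x - \<kappa> *\<^sub>R v) \<kappa> \<subseteq> \<Omega>" "ball (x + \<kappa> *\<^sub>R v) \<kappa> \<subseteq> - \<Omega>"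
      using v[OF x] by blast
    \<comment> \<open>\<open>unit_outer_normal\<close> is a definite description; uniqueness
      identifies it with the normal for which the tangent balls are given.\<close>
    have "unit_outer_normal \<Omega> x = v"
      unfolding unit_outer_normal_def
      by (rule the_equality, rule v(1), rule unit_outer_normal_unique[OF x _ v(1)])
    then show ?thesis using v by (simp add: is_unit_outer_normal_def)
  qed
  have "normal_domain \<Omega> \<kappa> \<mu>"
    by unfold_locales (use assms \<kappa> uon in auto)
  then show ?thesis by (rule that)
qed

theorem theorem1p3:
  fixes \<Omega> :: "(real^'d) set" and \<mu> p0 :: real and r j l :: nat
  assumes "CARD('d) \<ge> 2"
    and "compact \<Omega>" and "C2_domain \<Omega>"
    and "\<mu> \<ge> sqrt (diameter \<Omega>) + 1"
    and "p0 > 0"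
  shows "\<exists>C>0. \<forall>p::ennreal. p \<ge> ennreal p0 \<longrightarrow>
           (\<forall>n::nat. n \<ge> 1 \<longrightarrow> (\<forall>f \<in> poly_space n.
              Lp_norm p \<Omega> (\<lambda>x. bdry_weight (frontier \<Omega>) n x ^ j
                                 * boundary_deriv_max \<Omega> \<mu> n r (j + l) f x)
                \<le> ennreal (C * real n ^ (r + j + 2 * l)) * Lp_norm p \<Omega> f))"
proof (cases "\<Omega> = {}")
  case True
  have "Lp_norm p {} g = 0" for p and g :: "real^'d \<Rightarrow> real"
    by (simp add: Lp_norm_def bot_ennreal)
  then show ?thesis using True by (intro exI[of _ 1]) simp
next
  case False
  obtain \<kappa> where "normal_domain \<Omega> \<kappa> \<mu>"
    using C2_domain_normal_domain[OF assms(1-4) False] by blast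
  then interpret normal_domain \<Omega> \<kappa> \<mu> .
  obtain C1 where C1: "C1 \<ge> 1" and int:
    "\<And>n f F q. n \<ge> 1 \<Longrightarrow> complexifies n f F \<Longrightarrow> q \<ge> p0 \<Longrightarrow>
      (\<integral>\<^sup>+x\<in>\<Omega>. ennreal (\<bar>weighted_deriv r j l n f x\<bar> powr q) \<partial>lebesgue) \<le>
      ennreal ((C1 * real n ^ (r + j + 2 * l)) powr q * C1) * (\<integral>\<^sup>+x\<in>\<Omega>. ennreal (\<bar>f x\<bar> powr q) \<partial>lebesgue)"
    by (rule integral_bound[OF assms(5), of r j l]) blast
  obtain C2 where C2: "C2 > 0" and unif:
    "\<And>x n f F M. x \<in> \<Omega> \<Longrightarrow> n \<ge> 1 \<Longrightarrow> complexifies n f F \<Longrightarrow> (\<And>y. y \<in> \<Omega> \<Longrightarrow> \<bar>f y\<bar> \<le> M) \<Longrightarrow>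
      \<bar>weighted_deriv r j l n f x\<bar> \<le> C2 * real n ^ (r + j + 2 * l) * M"
    by (rule uniform_bound[of r j l]) blast
  \<comment> \<open>\<open>C2\<close> serves \<open>p = \<infinity>\<close>; for finite
    \<open>p\<close> the root of the outer constant contributes \<open>C1 powr (1 / p0)\<close>, and
    the second \<open>C1\<close> comes from inside the power.\<close>
  define C where "C = max C2 (C1 powr (1 / p0) * C1)"
  show ?thesis
  proof (intro exI[of _ C] conjI allI impI ballI)
    show "C > 0" using C2 by (simp add: C_def)
    fix p :: ennreal and n :: nat and f :: "real^'d \<Rightarrow> real"
    assume p: "p \<ge> ennreal p0" and n: "n \<ge> 1" and f: "f \<in> poly_space n"
    obtain F where F: "complexifies n f F" using poly_space_complexifies[OF f] by blast
    have "Lp_norm p \<Omega> (weighted_deriv r j l n f) \<le> ennreal (C * real n ^ (r + j + 2 * l)) * Lp_norm p \<Omega> f"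
    proof (cases "p = \<infinity>")
      case True
      obtain y where y: "y \<in> \<Omega>" "\<And>z. z \<in> \<Omega> \<Longrightarrow> \<bar>f z\<bar> \<le> \<bar>f y\<bar>"
        by (rule max_attained[OF F]) blast
      have "(SUP x\<in>\<Omega>. ennreal \<bar>weighted_deriv r j l n f x\<bar>) \<le> ennreal (C * real n ^ (r + j + 2 * l)) * ennreal \<bar>f y\<bar>"
      proof (rule SUP_least)
        fix x assume x: "x \<in> \<Omega>"
        have "\<bar>weighted_deriv r j l n f x\<bar> \<le> C2 * real n ^ (r + j + 2 * l) * \<bar>f y\<bar>" by (rule unif[OF x n F y(2)])
        also have "\<dots> \<le> C * real n ^ (r + j + 2 * l) * \<bar>f y\<bar>"
          by (intro mult_right_mono) (auto simp: C_def)
        finally have "ennreal \<bar>weighted_deriv r j l n f x\<bar> \<le> ennreal (C * real n ^ (r + j + 2 * l) * \<bar>f y\<bar>)" by (rule ennreal_leI)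
        also have "\<dots> = ennreal (C * real n ^ (r + j + 2 * l)) * ennreal \<bar>f y\<bar>"
          using C2 by (intro ennreal_mult) (auto simp: C_def)
        finally show "ennreal \<bar>weighted_deriv r j l n f x\<bar> \<le> ennreal (C * real n ^ (r + j + 2 * l)) * ennreal \<bar>f y\<bar>" .
      qed
      also have "\<dots> \<le> ennreal (C * real n ^ (r + j + 2 * l)) * (SUP x\<in>\<Omega>. ennreal \<bar>f x\<bar>)"
        by (intro mult_left_mono SUP_upper y) simp
      finally show ?thesis using True by (simp add: Lp_norm_def)
    next
      case False
      have "Lp_norm p \<Omega> (weighted_deriv r j l n f) \<le> ennreal (C1 powr (1 / p0) * (C1 * real n ^ (r + j + 2 * l))) * Lp_norm p \<Omega> f"
        using C1 n by (intro Lp_norm_le_of_integral_le[OF False p assms(5) C1 _ int[OF n F le_enn2real[OF False p]]]) simp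
      also have "\<dots> \<le> ennreal (C * real n ^ (r + j + 2 * l)) * Lp_norm p \<Omega> f"
        by (intro mult_right_mono ennreal_leI) (auto simp: C_def mult.assoc[symmetric] intro!: mult_right_mono)
      finally show ?thesis .
    qed
    then show "Lp_norm p \<Omega> (\<lambda>x. bdry_weight (frontier \<Omega>) n x ^ j * boundary_deriv_max \<Omega> \<mu> n r (j + l) f x)
        \<le> ennreal (C * real n ^ (r + j + 2 * l)) * Lp_norm p \<Omega> f"
      by (simp only: bdry_weight_eq weighted_deriv_def)
  qed
qed

end
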